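(* Let $1<\alpha<2$ and $B_\alpha=\{(x,y)\in\mathbb{R}^2:|x|^\alpha+|y|^\alpha\le1\}$. (i) There exist constants $c_0(\alpha)\in(0,1)$ and $C(\alpha)\ge1$, depending only on $\alpha$, such that for every $(x_0,y_0)\in\partial B_\alpha$ with $0\le x_0\le y_0$, with $\boldsymbol{u}$ the outward unit normal to $B_\alpha$ at $(x_0,y_0)$, $\boldsymbol{v}$ one of the two unit vectors orthogonal to $\boldsymbol{u}$, and $$l_i(t)=\max\{s\in\mathbb{R}:(x_0,y_0)-t\boldsymbol{u}+(-1)^i s\boldsymbol{v}\in B_\alpha\},\quad i=1,2,\quad 0<t<1,$$ we have $$C(\alpha)^{-1}\,t^{\frac12}\bigl(\max\{t,x_0^\alpha\}\bigr)^{\frac1\alpha-\frac12}\le l_i(t)\le C(\alpha)\,t^{\frac12}\bigl(\max\{t,x_0^\alpha\}\bigr)^{\frac1\alpha-\frac12},\quad 0<t\le c_0(\alpha),\quad i=1,2.$$ (ii) For every $\sigma>0$ there exists a constant $C(\alpha,\sigma)\ge1$, depending only on $\alpha$ and $\sigma$, such that for every $(x_0,y_0)\in\partial B_\alpha$ with $0\le x_0\le y_0$, every integer $n\ge1$, and every $\boldsymbol{x}\in B_\alpha\setminus\partial B_\alpha$ satisfying $$\delta:=|\boldsymbol{x}-(x_0,y_0)|=\min\{|\boldsymbol{x}-(x,y)|:(x,y)\in\partial B_\alpha\}\quad\text{and}\quad \sigma n^{-2}\le\delta\le1,$$ we have $$C(\alpha,\sigma)^{-1}\,n^{-2}\delta^{\frac12}\bigl(\max\{\delta,x_0^\alpha\}\bigr)^{\frac1\alpha-\frac12}\le\lambda_n(B_\alpha,\boldsymbol{x})\le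 C(\alpha,\sigma)\,n^{-2}\delta^{\frac12}\bigl(\max\{\delta,x_0^\alpha\}\bigr)^{\frac1\alpha-\frac12}.$$
   Context: $|\cdot|$ applied to vectors is the Euclidean norm in $\mathbb{R}^2$, and $\partial B_\alpha$ is the boundary of $B_\alpha$. $\mathcal{P}_n$ denotes the space of all real algebraic polynomials of total degree $\le n$ in two variables. For a compact set $D\subset\mathbb{R}^2$ with non-empty interior, the Christoffel function (with uniform weight $w\equiv1$) is $$\lambda_n(D,\boldsymbol{x})=\left(\sum_{k=1}^N\varphi_k(\boldsymbol{x})^2\right)^{-1},\quad \boldsymbol{x}\in D,$$ where $\{\varphi_k\}_{k=1}^N$ is any orthonormal basis of $\mathcal{P}_n$ with respect to the inner product $\langle f,g\rangle=\int_D f(\boldsymbol{y})g(\boldsymbol{y})\,d\boldsymbol{y}$. Equivalently, $\lambda_n(D,\boldsymbol{x})=\min\{\int_D f^2(\boldsymbol{y})\,d\boldsymbol{y}: f\in\mathcal{P}_n,\ f(\boldsymbol{x})=1\}$. *)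

theory Defs
  imports "HOL-Analysis.Analysis"
begin

text \<open>The plane is the type \<^typ>\<open>real \<times> real\<close>, whose library norm is the Euclidean one.\<close>

definition lball :: "real \<Rightarrow> (real \<times> real) set" where
  "lball \<alpha> = {(x, y). \<bar>x\<bar> powr \<alpha> + \<bar>y\<bar> powr \<alpha> \<le> 1}"

text \<open>Outward unit normal to a planar domain at a boundary point \<open>z\<close> where the boundary curve has a
  tangent line: \<open>u\<close> is orthogonal to that line (all limits of secant directions of the boundary at
  \<open>z\<close>), and it points out of \<open>D\<close>.\<close>

definition outward_unit_normal :: "(real \<times> real) set \<Rightarrow> real \<times> real \<Rightarrow> real \<times> real \<Rightarrow> bool" where
  "outward_unit_normal D z u \<longleftrightarrow>
     norm u = 1 \<and>
     ((\<lambda>p. ((p - z) /\<^sub>R norm (p - z)) \<bullet> u) \<longlongrightarrow> 0) (at z within frontier D) \<and>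
     (\<forall>\<^sub>F s in at_right 0. z + s *\<^sub>R u \<notin> D)"

definition half_chord ::
    "(real \<times> real) set \<Rightarrow> real \<times> real \<Rightarrow> real \<times> real \<Rightarrow> real \<times> real \<Rightarrow> nat \<Rightarrow> real \<Rightarrow> real" where
  "half_chord D z u v i t = (GREATEST s. z - t *\<^sub>R u + ((-1) ^ i * s) *\<^sub>R v \<in> D)"

definition poly2 :: "nat \<Rightarrow> (real \<times> real \<Rightarrow> real) set" where
  "poly2 n = {f. \<exists>c :: nat \<Rightarrow> nat \<Rightarrow> real.
     f = (\<lambda>(x, y). \<Sum>i\<le>n. \<Sum>j\<le>n - i. c i j * x ^ i * y ^ j)}"

definition L2_inner ::
    "(real \<times> real) set \<Rightarrow> (real \<times> real \<Rightarrow> real) \<Rightarrow> (real \<times> real \<Rightarrow> real) \<Rightarrow> real" where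
  "L2_inner D f g = (LINT y:D|lborel. f y * g y)"

text \<open>Linear independence is not listed because it follows from orthonormality.\<close>

definition orthonormal_basis ::
    "nat \<Rightarrow> (real \<times> real) set \<Rightarrow> (real \<times> real \<Rightarrow> real) set \<Rightarrow> bool" where
  "orthonormal_basis n D \<Phi> \<longleftrightarrow>
     finite \<Phi> \<and> \<Phi> \<subseteq> poly2 n \<and>
     (\<forall>\<phi>\<in>\<Phi>. \<forall>\<psi>\<in>\<Phi>. L2_inner D \<phi> \<psi> = (if \<phi> = \<psi> then 1 else 0)) \<and>
     (\<forall>f\<in>poly2 n. \<exists>a. f = (\<lambda>x. \<Sum>\<phi>\<in>\<Phi>. a \<phi> * \<phi> x))"

text \<open>The choice of basis does not matter: see \<open>christoffel_eq\<close> below.\<close>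

definition christoffel :: "nat \<Rightarrow> (real \<times> real) set \<Rightarrow> real \<times> real \<Rightarrow> real" where
  "christoffel n D x = inverse (\<Sum>\<phi>\<in>(SOME \<Phi>. orthonormal_basis n D \<Phi>). (\<phi> x)\<^sup>2)"

lemma continuous_on_poly2:
  assumes "f \<in> poly2 n"
  shows "continuous_on S f"
proof -
  obtain c where "f = (\<lambda>(x, y). \<Sum>i\<le>n. \<Sum>j\<le>n - i. c i j * x ^ i * y ^ j)"
    using assms unfolding poly2_def by blast
  then show ?thesis
    by (auto simp: case_prod_unfold intro!: continuous_intros)
qed

lemma set_integrable_poly2_mult:
  assumes "compact D" "f \<in> poly2 n" "g \<in> poly2 n"
  shows "set_integrable lborel D (\<lambda>y. f y * g y)"
  unfolding set_integrable_def
  by (intro borel_integrable_compact assms continuous_on_mult continuous_on_poly2[OF assms(2)]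
      continuous_on_poly2[OF assms(3)])

lemma orthonormal_basis_expand:
  assumes "compact D" and \<Phi>: "orthonormal_basis n D \<Phi>" and f: "f \<in> poly2 n"
  shows "f x = (\<Sum>\<phi>\<in>\<Phi>. L2_inner D f \<phi> * \<phi> x)"
proof -
  obtain a where a: "f = (\<lambda>x. \<Sum>\<phi>\<in>\<Phi>. a \<phi> * \<phi> x)"
    using \<Phi> f unfolding orthonormal_basis_def by blast
  have fin: "finite \<Phi>" and sub: "\<Phi> \<subseteq> poly2 n"
    and on: "\<And>\<phi> \<psi>. \<phi> \<in> \<Phi> \<Longrightarrow> \<psi> \<in> \<Phi> \<Longrightarrow> L2_inner D \<phi> \<psi> = (if \<phi> = \<psi> then 1 else 0)"
    using \<Phi> unfolding orthonormal_basis_def by auto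
  have "L2_inner D f \<psi> = a \<psi>" if \<psi>: "\<psi> \<in> \<Phi>" for \<psi>
  proof -
    have int: "set_integrable lborel D (\<lambda>y. a \<phi> * (\<phi> y * \<psi> y))" if "\<phi> \<in> \<Phi>" for \<phi>
      using set_integrable_poly2_mult[OF \<open>compact D\<close>, of \<phi> n \<psi>] that \<psi> sub
      by (intro set_integrable_mult_right) auto
    have "L2_inner D f \<psi> = (LINT y:D|lborel. \<Sum>\<phi>\<in>\<Phi>. a \<phi> * (\<phi> y * \<psi> y))"
      unfolding L2_inner_def a by (simp add: sum_distrib_right mult.assoc)
    also have "\<dots> = (\<Sum>\<phi>\<in>\<Phi>. LINT y:D|lborel. a \<phi> * (\<phi> y * \<psi> y))"
      using int unfolding set_lebesgue_integral_def set_integrable_def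
      by (simp only: scaleR_sum_right) (intro Bochner_Integration.integral_sum, auto)
    also have "\<dots> = (\<Sum>\<phi>\<in>\<Phi>. a \<phi> * L2_inner D \<phi> \<psi>)"
      unfolding L2_inner_def by simp
    also have "\<dots> = (\<Sum>\<phi>\<in>\<Phi>. if \<phi> = \<psi> then a \<phi> else 0)"
      using on \<psi> by (intro sum.cong) auto
    also have "\<dots> = a \<psi>"
      using fin \<psi> by simp
    finally show ?thesis .
  qed
  then show ?thesis
    by (subst a) simp
qed

lemma orthonormal_basis_kernel_unique:
  assumes "compact D" and \<Phi>: "orthonormal_basis n D \<Phi>" and \<Psi>: "orthonormal_basis n D \<Psi>"
  shows "(\<Sum>\<phi>\<in>\<Phi>. (\<phi> x)\<^sup>2) = (\<Sum>\<psi>\<in>\<Psi>. (\<psi> x)\<^sup>2)"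
proof -
  have sub: "\<Phi> \<subseteq> poly2 n" "\<Psi> \<subseteq> poly2 n"
    using \<Phi> \<Psi> unfolding orthonormal_basis_def by auto
  have "(\<Sum>\<phi>\<in>\<Phi>. (\<phi> x)\<^sup>2) = (\<Sum>\<phi>\<in>\<Phi>. \<phi> x * (\<Sum>\<psi>\<in>\<Psi>. L2_inner D \<phi> \<psi> * \<psi> x))"
    using orthonormal_basis_expand[OF assms(1) \<Psi>, of _ x] sub
    by (intro sum.cong refl) (metis power2_eq_square subsetD)
  also have "\<dots> = (\<Sum>\<phi>\<in>\<Phi>. \<Sum>\<psi>\<in>\<Psi>. \<phi> x * (L2_inner D \<phi> \<psi> * \<psi> x))"
    by (simp add: sum_distrib_left)
  also have "\<dots> = (\<Sum>\<psi>\<in>\<Psi>. \<Sum>\<phi>\<in>\<Phi>. \<phi> x * (L2_inner D \<phi> \<psi> * \<psi> x))"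
    by (rule sum.swap)
  also have "\<dots> = (\<Sum>\<psi>\<in>\<Psi>. \<psi> x * (\<Sum>\<phi>\<in>\<Phi>. L2_inner D \<psi> \<phi> * \<phi> x))"
    by (simp add: sum_distrib_left L2_inner_def mult_ac)
  also have "\<dots> = (\<Sum>\<psi>\<in>\<Psi>. (\<psi> x)\<^sup>2)"
    using orthonormal_basis_expand[OF assms(1) \<Phi>, of _ x] sub
    by (intro sum.cong refl) (metis power2_eq_square subsetD)
  finally show ?thesis .
qed

lemma christoffel_eq:
  assumes "compact D" "orthonormal_basis n D \<Phi>"
  shows "christoffel n D x = inverse (\<Sum>\<phi>\<in>\<Phi>. (\<phi> x)\<^sup>2)"
  unfolding christoffel_def
  using orthonormal_basis_kernel_unique[OF assms(1) someI[of "orthonormal_basis n D", OF assms(2)]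
      assms(2), of x]
  by simp

end

theory Submission
  imports Defs "HOL-Computational_Algebra.Polynomial"
begin

text \<open>
Write \<open>g\<close> for the gauge \<open>\<bar>x\<bar> powr \<alpha> + \<bar>y\<bar> powr \<alpha>\<close>, and compare \<open>\<bar>p + \<tau>\<bar> powr \<alpha>\<close> with its tangent at \<open>p\<close>.
The remainder is of order \<open>\<tau>\<^sup>2 (\<bar>p\<bar> + \<bar>\<tau>\<bar>) powr (\<alpha> - 2)\<close>, with matching upper and lower bounds
(\<open>powr_le_tangent_quadratic\<close>, \<open>powr_le_tangent_powr\<close>, \<open>powr_ge_tangent_quadratic\<close>). Everything geometric about the
ball follows from these inequalities.

Part (i). At a point of the chord at depth \<open>t\<close> the linear part of the gauge has dropped by a quantity of order
\<open>t\<close>, so the point is in the ball exactly as long as the remainder in the first coordinate stays of order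
\<open>t\<close>. Solving \<open>\<tau>\<^sup>2 (x0 + \<bar>\<tau>\<bar>) powr (\<alpha> - 2) \<approx> t\<close> for \<open>\<tau>\<close> gives the asserted length. The unit normal is
identified from its definition by secants in \<open>outward_unit_normal_lball\<close>.

Part (ii). The Christoffel function is the minimum of the square integral of \<open>f\<close> among polynomials with value
one at the point (\<open>christoffel_le_L2_inner\<close>, \<open>inverse_le_christoffel\<close>). Put \<open>m powr \<alpha> = max \<delta> (x0 powr \<alpha>)\<close>.

For the upper bound take a product \<open>f = q\<^sub>1(L\<^sub>1) q\<^sub>2(L\<^sub>2)\<close>, where \<open>L\<^sub>1\<close> and \<open>L\<^sub>2\<close> vanish on the tangents at the
boundary points with abscissa about \<open>m\<close> and \<open>- m\<close>. The ball lies in the parallelogram of two strips, on which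
the integral splits. In one variable a polynomial of degree \<open>n\<close> with value one at distance \<open>l\<close> from the end of an
interval can have square integral of order \<open>sqrt l / n\<close>, if \<open>l\<close> is at least of order \<open>1 / n\<^sup>2\<close> (\<open>exists_poly_peak\<close>). Here \<open>l\<close> is of order \<open>\<delta>\<close> and
\<open>m powr \<alpha>\<close>, and the angle of the strips contributes \<open>m powr (1 - \<alpha>)\<close>; the product of the three factors is the claim.

For the lower bound a region between two parallel parabolas is placed in the ball just below the boundary, with
horizontal width \<open>\<beta>\<close> of order \<open>m powr (1 - \<alpha>/2)\<close>. It has a polynomial parametrization by a square with constant
Jacobian. The inequality \<open>p(s)\<^sup>2 \<le> C n / sqrt s\<close> times the integral of \<open>p\<^sup>2\<close>, applied in each
variable (\<open>poly_point_le_integral\<close>), bounds \<open>f\<^sup>2\<close> at the point by a multiple of \<open>n\<^sup>2 / (\<beta> sqrt \<delta>)\<close> times its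
integral.

The two one-dimensional facts are trigonometric: after the substitution \<open>s = (1 - cos \<theta>) / 2\<close> the factor
\<open>sin (N t)\<close> with \<open>N\<close> of order \<open>1 / \<theta>\<close> is of order one at \<open>\<theta>\<close>, while \<open>sin\<^sup>2 (N t) \<le> N sin t\<close> exchanges the flat
weight for the weight \<open>sin t\<close> of the substitution. What remains is orthogonality of sines and cosines.
\<close>

section \<open>Orthogonality and sums of sines\<close>

lemma has_integral_cos_int:
  fixes j :: int
  shows "((\<lambda>t. cos (of_int j * t)) has_integral (if j = 0 then pi else 0)) {0..pi}"
proof (cases "j = 0")
  case True
  then show ?thesis using has_integral_const_real[of "1::real" 0 pi] by simp
next
  case False
  have "((\<lambda>t. cos (of_int j * t)) has_integral
          sin (of_int j * pi) / of_int j - sin (of_int j * 0) / of_int j) {0..pi}"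
    by (rule fundamental_theorem_of_calculus)
       (use False in \<open>auto intro!: derivative_eq_intros
          simp flip: has_real_derivative_iff_has_vector_derivative\<close>)
  then show ?thesis
    using False sin_npi_int[of j] by (simp add: mult.commute)
qed

lemma has_integral_cos_mult_cos:
  "((\<lambda>t. cos (real k * t) * cos (real l * t)) has_integral
     (if k = l then if k = 0 then pi else pi / 2 else 0)) {0..pi}"
proof -
  have "((\<lambda>t. (cos (of_int (int k - int l) * t) + cos (of_int (int k + int l) * t)) / 2) has_integral
     ((if int k - int l = 0 then pi else 0) + (if int k + int l = 0 then pi else 0)) / 2) {0..pi}"
    by (intro has_integral_divide has_integral_add has_integral_cos_int)
  then show ?thesis
    by (auto simp: cos_times_cos algebra_simps)
qed

lemma has_integral_sin_mult_sin:
  assumes "k > 0" "l > 0"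
  shows "((\<lambda>t. sin (real k * t) * sin (real l * t)) has_integral (if k = l then pi / 2 else 0)) {0..pi}"
proof -
  have "((\<lambda>t. (cos (of_int (int k - int l) * t) - cos (of_int (int k + int l) * t)) / 2) has_integral
     ((if int k - int l = 0 then pi else 0) - (if int k + int l = 0 then pi else 0)) / 2) {0..pi}"
    by (intro has_integral_divide has_integral_diff has_integral_cos_int)
  then show ?thesis
    using assms by (auto simp: sin_times_sin algebra_simps split: if_splits)
qed

lemma has_integral_square_sum:
  fixes e :: "nat \<Rightarrow> real \<Rightarrow> real"
  assumes "finite I"
    and "\<And>k l. k \<in> I \<Longrightarrow> l \<in> I \<Longrightarrow> ((\<lambda>t. e k t * e l t) has_integral (if k = l then c k else 0)) S"
  shows "((\<lambda>t. (\<Sum>k\<in>I. a k * e k t)\<^sup>2) has_integral (\<Sum>k\<in>I. c k * (a k)\<^sup>2)) S"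
proof -
  have "((\<lambda>t. \<Sum>k\<in>I. \<Sum>l\<in>I. (a k * a l) * (e k t * e l t)) has_integral
          (\<Sum>k\<in>I. \<Sum>l\<in>I. (a k * a l) * (if k = l then c k else 0))) S"
    using assms by (intro has_integral_sum has_integral_mult_right) auto
  moreover have "(\<Sum>k\<in>I. \<Sum>l\<in>I. (a k * a l) * (if k = l then c k else 0)) = (\<Sum>k\<in>I. c k * (a k)\<^sup>2)"
    using assms(1) by (intro sum.cong) (auto simp: power2_eq_square if_distrib sum.delta cong: if_cong)
  moreover have "(\<Sum>k\<in>I. a k * e k t)\<^sup>2 = (\<Sum>k\<in>I. \<Sum>l\<in>I. (a k * a l) * (e k t * e l t))" for t
    by (simp add: power2_eq_square sum_product mult_ac)
  ultimately show ?thesis by simp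
qed

text \<open>The odd trigonometric polynomials of degree at most \<open>K\<close>. They are described by existence of coefficients
because only the degree and closure under multiplication by \<open>cos\<close> matter.\<close>

definition sine_sum :: "nat \<Rightarrow> (real \<Rightarrow> real) \<Rightarrow> bool" where
  "sine_sum K H \<longleftrightarrow> (\<exists>a. \<forall>t. H t = (\<Sum>k=1..K. a k * sin (real k * t)))"

lemma sine_sum_add:
  assumes "sine_sum K F" "sine_sum K G"
  shows "sine_sum K (\<lambda>t. F t + G t)"
proof -
  obtain a b where "\<forall>t. F t = (\<Sum>k=1..K. a k * sin (real k * t))"
    "\<forall>t. G t = (\<Sum>k=1..K. b k * sin (real k * t))"
    using assms unfolding sine_sum_def by blast
  then show ?thesis unfolding sine_sum_def
    by (intro exI[of _ "\<lambda>k. a k + b k"]) (simp add: algebra_simps sum.distrib)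
qed

lemma sine_sum_scale:
  assumes "sine_sum K F"
  shows "sine_sum K (\<lambda>t. c * F t)"
proof -
  obtain a where "\<forall>t. F t = (\<Sum>k=1..K. a k * sin (real k * t))"
    using assms unfolding sine_sum_def by blast
  then show ?thesis unfolding sine_sum_def
    by (intro exI[of _ "\<lambda>k. c * a k"]) (simp add: sum_distrib_left mult_ac)
qed

lemma sine_sum_zero: "sine_sum K (\<lambda>t. 0)"
  unfolding sine_sum_def by (intro exI[of _ "\<lambda>k. 0"]) simp

lemma sine_sum_sum:
  assumes "\<And>i. i \<in> I \<Longrightarrow> sine_sum K (F i)"
  shows "sine_sum K (\<lambda>t. \<Sum>i\<in>I. F i t)"
  using assms
  by (induction I rule: infinite_finite_induct) (auto intro: sine_sum_zero sine_sum_add)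

lemma sine_sum_sin:
  assumes "k \<le> K"
  shows "sine_sum K (\<lambda>t. sin (real k * t))"
proof -
  have "(\<Sum>j=1..K. (if j = k then 1 else 0) * sin (real j * t)) = sin (real k * t)" for t
  proof (cases "k = 0")
    case False
    then have "(\<Sum>j=1..K. (if j = k then 1 else 0) * sin (real j * t))
         = (\<Sum>j=1..K. if j = k then sin (real j * t) else 0)"
      by (intro sum.cong) auto
    then show ?thesis using assms False by simp
  qed (auto intro!: sum.neutral)
  then show ?thesis unfolding sine_sum_def by metis
qed

lemma sine_sum_mono:
  assumes "sine_sum K H" "K \<le> L"
  shows "sine_sum L H"
proof -
  obtain a where a: "\<forall>t. H t = (\<Sum>k=1..K. a k * sin (real k * t))"
    using assms unfolding sine_sum_def by blast
  have "sine_sum L (\<lambda>t. \<Sum>k=1..K. a k * sin (real k * t))"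
    using assms(2) by (intro sine_sum_sum sine_sum_scale sine_sum_sin) auto
  then show ?thesis using a by presburger
qed

lemma sine_sum_cos_mult:
  assumes "sine_sum K H"
  shows "sine_sum (Suc K) (\<lambda>t. cos t * H t)"
proof -
  obtain a where a: "\<forall>t. H t = (\<Sum>k=1..K. a k * sin (real k * t))"
    using assms unfolding sine_sum_def by blast
  have *: "cos t * (\<Sum>k=1..K. a k * sin (real k * t)) =
     (\<Sum>k=1..K. a k / 2 * (sin (real (k + 1) * t) + sin (real (k - 1) * t)))" for t
    unfolding sum_distrib_left
    by (intro sum.cong refl) (auto simp: algebra_simps of_nat_diff sin_add sin_diff)
  have "sine_sum (Suc K)
     (\<lambda>t. \<Sum>k=1..K. a k / 2 * (sin (real (k + 1) * t) + sin (real (k - 1) * t)))"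
    by (rule sine_sum_sum, rule sine_sum_scale, rule sine_sum_add; rule sine_sum_sin) auto
  moreover have "(\<lambda>t. cos t * H t) =
     (\<lambda>t. \<Sum>k=1..K. a k / 2 * (sin (real (k + 1) * t) + sin (real (k - 1) * t)))"
    using a * by simp
  ultimately show ?thesis by simp
qed

text \<open>The factor \<open>sin (N t)\<close> turns the even function \<open>p ((1 - cos t) / 2)\<close> into an odd one at the price of
\<open>N\<close> extra degrees; later \<open>N\<close> is tuned to the point at which \<open>p\<close> is estimated.\<close>

lemma sine_sum_poly_mult_sin:
  "sine_sum (N + degree p) (\<lambda>t. poly p ((1 - cos t) / 2) * sin (real N * t))"
proof (induction p)
  case 0
  then show ?case by (simp add: sine_sum_zero)
next
  case (pCons c p)
  let ?F = "\<lambda>t. poly p ((1 - cos t) / 2) * sin (real N * t)"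
  let ?M = "N + degree (pCons c p)"
  have const: "sine_sum ?M (\<lambda>t. c * sin (real N * t))"
    by (intro sine_sum_scale sine_sum_sin) simp
  show ?case
  proof (cases "p = 0")
    case True
    then show ?thesis using const by simp
  next
    case False
    then have M: "?M = Suc (N + degree p)" by simp
    have "sine_sum ?M (\<lambda>t. c * sin (real N * t) + ((1/2) * ?F t + (- 1/2) * (cos t * ?F t)))"
      using sine_sum_cos_mult[OF pCons.IH] sine_sum_mono[OF pCons.IH, of ?M] unfolding M
      by (intro sine_sum_add[OF const[unfolded M] sine_sum_add[OF sine_sum_scale sine_sum_scale]]) simp_all
    then show ?thesis by (simp add: field_simps)
  qed
qed

lemma sine_sum_point_le_integral:
  assumes "sine_sum K H"
  shows "(H t)\<^sup>2 \<le> 2 * real K / pi * integral {0..pi} (\<lambda>t. (H t)\<^sup>2)"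
    and "(\<lambda>t. (H t)\<^sup>2) integrable_on {0..pi}"
proof -
  obtain a where a: "\<forall>t. H t = (\<Sum>k=1..K. a k * sin (real k * t))"
    using assms unfolding sine_sum_def by blast
  have "((\<lambda>t. (H t)\<^sup>2) has_integral (\<Sum>k=1..K. pi / 2 * (a k)\<^sup>2)) {0..pi}"
    unfolding a[rule_format]
    by (intro has_integral_square_sum) (auto intro!: has_integral_sin_mult_sin[THEN has_integral_eq_rhs])
  then have int: "((\<lambda>t. (H t)\<^sup>2) has_integral pi / 2 * (\<Sum>k=1..K. (a k)\<^sup>2)) {0..pi}"
    by (simp add: sum_distrib_left)
  have "(H t)\<^sup>2 \<le> (\<Sum>k=1..K. (a k)\<^sup>2) * (\<Sum>k=1..K. (sin (real k * t))\<^sup>2)"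
    unfolding a[rule_format] by (rule Cauchy_Schwarz_ineq_sum)
  also have "\<dots> \<le> (\<Sum>k=1..K. (a k)\<^sup>2) * (\<Sum>k=1..K. 1)"
    by (intro mult_left_mono sum_mono sum_nonneg) (simp_all add: abs_square_le_1)
  also have "\<dots> = 2 * real K / pi * integral {0..pi} (\<lambda>t. (H t)\<^sup>2)"
    by (simp add: integral_unique[OF int])
  finally show "(H t)\<^sup>2 \<le> 2 * real K / pi * integral {0..pi} (\<lambda>t. (H t)\<^sup>2)" .
  show "(\<lambda>t. (H t)\<^sup>2) integrable_on {0..pi}" using int by blast
qed

lemma abs_sin_mult_le:
  fixes t :: real
  shows "\<bar>sin (real N * t)\<bar> \<le> real N * \<bar>sin t\<bar>"
proof (induction N)
  case (Suc N)
  have "\<bar>sin (real (Suc N) * t)\<bar> = \<bar>sin (real N * t) * cos t + cos (real N * t) * sin t\<bar>"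
    by (simp add: algebra_simps sin_add)
  also have "\<dots> \<le> \<bar>sin (real N * t)\<bar> * \<bar>cos t\<bar> + \<bar>cos (real N * t)\<bar> * \<bar>sin t\<bar>"
    by (metis abs_mult abs_triangle_ineq)
  also have "\<dots> \<le> \<bar>sin (real N * t)\<bar> * 1 + 1 * \<bar>sin t\<bar>"
    by (intro add_mono mult_mono) auto
  finally show ?case using Suc.IH by (simp add: algebra_simps)
qed simp

text \<open>This inequality exchanges the flat weight for the weight \<open>sin t\<close> of the substitution
\<open>x = (1 - cos t) / 2\<close>, losing only a factor \<open>N\<close>. Both the upper and the lower estimate for
polynomials on the unit interval depend on it: one multiplies by \<open>sin (N t)\<close>, the other by
\<open>sin (N t) / sin t\<close>.\<close>

lemma sin_mult_square_le:
  fixes t :: real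
  assumes "0 \<le> t" "t \<le> pi"
  shows "(sin (real N * t))\<^sup>2 \<le> real N * sin t"
proof -
  have "(sin (real N * t))\<^sup>2 = \<bar>sin (real N * t)\<bar> * \<bar>sin (real N * t)\<bar>"
    by (simp add: power2_eq_square)
  also have "\<dots> \<le> 1 * \<bar>sin (real N * t)\<bar>" by (intro mult_right_mono) auto
  also have "\<dots> \<le> real N * sin t"
    using abs_sin_mult_le[of N t] assms by (simp add: sin_ge_zero)
  finally show ?thesis .
qed

lemma integral_chebyshev_substitution:
  fixes f :: "real \<Rightarrow> real"
  assumes "continuous_on {0..1} f"
  shows "((\<lambda>t. f ((1 - cos t) / 2) * sin t) has_integral 2 * integral {0..1} f) {0..pi}"
proof -
  have "((\<lambda>t. (sin t / 2) *\<^sub>R f ((1 - cos t) / 2)) has_integral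
      (integral {(1 - cos 0) / 2..(1 - cos pi) / 2} f)) {0..pi}"
    by (rule has_integral_substitution[where c = 0 and d = 1])
       (use assms in \<open>auto intro!: derivative_eq_intros simp: \<close>)
  then have "((\<lambda>t. 2 * ((sin t / 2) *\<^sub>R f ((1 - cos t) / 2))) has_integral
      2 * (integral {(1 - cos 0) / 2..(1 - cos pi) / 2} f)) {0..pi}"
    by (rule has_integral_mult_right)
  then show ?thesis by (simp add: mult.commute)
qed

lemma jordan_sin:
  fixes x :: real
  assumes "0 \<le> x" "x \<le> pi / 2"
  shows "2 * x / pi \<le> sin x"
proof -
  have "convex_on {0..pi/2} (\<lambda>x. - sin x)"
  proof (rule f''_ge0_imp_convex[where f' = "\<lambda>x. - cos x" and f'' = sin])
    fix x :: real
    show "((\<lambda>x. - sin x) has_real_derivative - cos x) (at x)"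
      "((\<lambda>x. - cos x) has_real_derivative sin x) (at x)"
      by (auto intro!: derivative_eq_intros)
    show "0 \<le> sin x" if "x \<in> {0..pi/2}"
      using that by (intro sin_ge_zero) auto
  qed simp
  from convex_onD[OF this, of "2 * x / pi" 0 "pi / 2"] show ?thesis
    using assms by (simp add: field_simps)
qed

lemma chebyshev_angle:
  assumes "0 < s" "s \<le> 1/2"
  obtains \<theta> where "0 < \<theta>" "\<theta> \<le> pi / 2" "(1 - cos \<theta>) / 2 = s" "2 * sqrt s \<le> \<theta>" "\<theta> \<le> pi * sqrt s"
proof -
  define \<theta> where "\<theta> = arccos (1 - 2 * s)"
  have c: "cos \<theta> = 1 - 2 * s" unfolding \<theta>_def using assms by (intro cos_arccos) auto
  have 1: "\<theta> \<le> pi / 2" unfolding \<theta>_def using assms by (intro arccos_le_pi2) auto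
  have 0: "0 \<le> \<theta>" unfolding \<theta>_def using assms by (intro arccos_lbound) auto
  have "\<theta> \<noteq> 0" using c assms by auto
  with 0 have 0: "0 < \<theta>" by simp
  have "(sin (\<theta> / 2))\<^sup>2 = s" using c cos_double_sin[of "\<theta>/2"] by simp
  moreover have "0 \<le> sin (\<theta> / 2)" using 0 1 by (intro sin_ge_zero) auto
  ultimately have sq: "sqrt s = sin (\<theta> / 2)" by (metis real_sqrt_unique)
  have "sin (\<theta> / 2) \<le> \<theta> / 2" using 0 by (intro sin_x_le_x) auto
  moreover have "\<theta> / pi \<le> sin (\<theta> / 2)"
    using jordan_sin[of "\<theta> / 2"] 0 1 by simp
  ultimately show ?thesis using that[of \<theta>] 0 1 c sq by (auto simp: field_simps)
qed

section \<open>Polynomials in one variable: the value at a point against the square mean\<close>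

text \<open>The frequency \<open>N\<close> is about \<open>1 / \<theta>\<close>, so that \<open>sin (N \<theta>)\<close> is bounded away from zero.\<close>

lemma pi_quotient_floor:
  assumes "0 < \<theta>" "\<theta> \<le> pi / 2"
  defines "N \<equiv> nat \<lfloor>pi / (2 * \<theta>)\<rfloor>"
  shows "1 \<le> N" "real N * \<theta> \<le> pi / 2" "pi / 4 \<le> real N * \<theta>"
proof -
  have 1: "1 \<le> pi / (2 * \<theta>)" using assms(1,2) by (simp add: field_simps)
  then show N1: "1 \<le> N" unfolding N_def by linarith
  have N: "real N \<le> pi / (2 * \<theta>)" "pi / (2 * \<theta>) < real N + 1"
    using 1 unfolding N_def by linarith+
  show "real N * \<theta> \<le> pi / 2" using N(1) assms(1) by (simp add: field_simps)
  have "pi / (2 * \<theta>) < 2 * real N" using N(2) N1 by linarith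
  then show "pi / 4 \<le> real N * \<theta>" using assms(1) by (simp add: field_simps)
qed

text \<open>The function \<open>p ((1 - cos t) / 2) sin (N t)\<close> is an odd trigonometric polynomial of degree at most
\<open>n + N\<close>; its square at \<open>\<theta>\<close> is comparable with \<open>p(s)\<^sup>2\<close>, and its square integral is at most
\<open>2 N\<close> times that of \<open>p\<close>, since \<open>sin\<^sup>2 (N t) \<le> N sin t\<close>. As \<open>N\<close> has size \<open>1 / sqrt s\<close>,
the constant is of the correct order \<open>n / sqrt s\<close> when \<open>s\<close> is at least of order \<open>1 / n\<^sup>2\<close>.\<close>

lemma poly_point_le_integral:
  fixes p :: "real poly"
  assumes "0 < s" "s \<le> 1/2" "degree p \<le> n"
  shows "(poly p s)\<^sup>2 \<le> 4 * (real n + 1 / sqrt s) / sqrt s * integral {0..1} (\<lambda>x. (poly p x)\<^sup>2)"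
proof -
  obtain \<theta> where \<theta>: "0 < \<theta>" "\<theta> \<le> pi / 2" "(1 - cos \<theta>) / 2 = s" "2 * sqrt s \<le> \<theta>"
    using chebyshev_angle[OF assms(1,2)] by blast
  define N where "N = nat \<lfloor>pi / (2 * \<theta>)\<rfloor>"
  note N = pi_quotient_floor[OF \<theta>(1,2), folded N_def]
  have rs: "0 < sqrt s" using assms by simp
  define K where "K = N + degree p"
  define I where "I = integral {0..1} (\<lambda>x. (poly p x)\<^sup>2)"
  let ?H = "\<lambda>t. poly p ((1 - cos t) / 2) * sin (real N * t)"
  have I0: "0 \<le> I" unfolding I_def by (intro integral_nonneg integrable_continuous_real continuous_intros) auto
  have sub: "((\<lambda>t. (poly p ((1 - cos t) / 2))\<^sup>2 * sin t) has_integral 2 * I) {0..pi}"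
    unfolding I_def using integral_chebyshev_substitution[of "\<lambda>x. (poly p x)\<^sup>2"]
    by (simp add: continuous_intros)
  have ss: "sine_sum K ?H" unfolding K_def by (rule sine_sum_poly_mult_sin)
  have "integral {0..pi} (\<lambda>t. (?H t)\<^sup>2) \<le> real N * (2 * I)"
  proof (rule has_integral_le[OF integrable_integral[OF sine_sum_point_le_integral(2)[OF ss]]
        has_integral_mult_right[OF sub]])
    fix t assume t: "t \<in> {0..pi}"
    have "(?H t)\<^sup>2 = (poly p ((1 - cos t) / 2))\<^sup>2 * (sin (real N * t))\<^sup>2"
      by (simp add: power_mult_distrib)
    also have "\<dots> \<le> (poly p ((1 - cos t) / 2))\<^sup>2 * (real N * sin t)"
      using t by (intro mult_left_mono sin_mult_square_le) auto
    finally show "(?H t)\<^sup>2 \<le> real N * ((poly p ((1 - cos t) / 2))\<^sup>2 * sin t)"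
      by (simp add: mult_ac)
  qed
  with sine_sum_point_le_integral(1)[OF ss, of \<theta>]
  have H: "(?H \<theta>)\<^sup>2 \<le> 2 * real K / pi * (real N * (2 * I))"
    by (meson mult_left_mono order_trans divide_nonneg_pos pi_gt_zero of_nat_0_le_iff mult_nonneg_nonneg zero_le_numeral)
  have "1 / 2 = 2 * (pi / 4) / pi" by simp
  also have "\<dots> \<le> 2 * (real N * \<theta>) / pi" using N(3) by (intro divide_right_mono mult_left_mono) auto
  also have "\<dots> \<le> sin (real N * \<theta>)" using N(2) \<theta>(1) by (intro jordan_sin) auto
  finally have "1 / 2 \<le> sin (real N * \<theta>)" .
  then have "(1 / 2)\<^sup>2 \<le> (sin (real N * \<theta>))\<^sup>2" by (intro power_mono) auto
  then have "(poly p s)\<^sup>2 * (1 / 2)\<^sup>2 \<le> (poly p s)\<^sup>2 * (sin (real N * \<theta>))\<^sup>2"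
    by (intro mult_left_mono) auto
  also have "\<dots> = (?H \<theta>)\<^sup>2" using \<theta>(3) by (simp add: power_mult_distrib)
  finally have "(poly p s)\<^sup>2 \<le> 4 * (?H \<theta>)\<^sup>2" by (simp add: power2_eq_square[of 2] power2_eq_square[of "1/2"])
  also have "\<dots> \<le> 4 * (2 * real K / pi * (real N * (2 * I)))" using H by linarith
  finally have 1: "(poly p s)\<^sup>2 \<le> 16 / pi * real K * real N * I" by (simp add: mult_ac)
  have "real N * (2 * sqrt s) \<le> pi / 2"
    using N(2) \<theta>(4) by (meson mult_left_mono of_nat_0_le_iff order_trans)
  then have Ns: "real N \<le> (pi / 4) / sqrt s" using rs by (simp add: field_simps)
  also have "\<dots> \<le> 1 / sqrt s" using rs pi_less_4 by (intro divide_right_mono) auto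
  finally have Ks: "real K \<le> real n + 1 / sqrt s" using assms(3) unfolding K_def by simp
  have "16 / pi * real K * real N * I \<le> 16 / pi * (real n + 1 / sqrt s) * ((pi / 4) / sqrt s) * I"
    using Ns Ks I0 rs by (intro mult_right_mono mult_mono) auto
  also have "\<dots> = 4 * (real n + 1 / sqrt s) / sqrt s * I"
  proof -
    have "16 / pi * x * ((pi / 4) / y) * I = 4 * x / y * I" for x y :: real by simp
    then show ?thesis .
  qed
  finally show ?thesis using 1 unfolding I_def by linarith
qed

text \<open>Single terms may vanish, but \<open>cos x\<close> and \<open>cos (2 x)\<close> are never both small:
\<open>c + (2 c - 1)\<^sup>2 \<ge> 7/16\<close> for \<open>c = cos\<^sup>2 x\<close>.\<close>

lemma sum_cos_square_ge:
  fixes \<theta> :: real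
  shows "7 / 64 * (real j + 1) \<le> (\<Sum>k\<le>j. (cos (real k * \<theta>))\<^sup>2)"
proof -
  define i where "i = j div 2"
  have pair: "7 / 16 \<le> (cos x)\<^sup>2 + (cos (2 * x))\<^sup>2" for x :: real
  proof -
    have "0 \<le> (2 * (cos x)\<^sup>2 - 3 / 4)\<^sup>2" by simp
    then show ?thesis unfolding cos_double_cos by (simp add: power2_eq_square field_simps)
  qed
  have "(\<Sum>k\<le>i. (cos (2 * (real k * \<theta>)))\<^sup>2) = (\<Sum>k\<in>(\<lambda>k. 2 * k) ` {..i}. (cos (real k * \<theta>))\<^sup>2)"
    by (subst sum.reindex) (auto simp: inj_on_def mult.assoc)
  also have "\<dots> \<le> (\<Sum>k\<le>j. (cos (real k * \<theta>))\<^sup>2)"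
    unfolding i_def by (intro sum_mono2) auto
  finally have a: "(\<Sum>k\<le>i. (cos (2 * (real k * \<theta>)))\<^sup>2) \<le> (\<Sum>k\<le>j. (cos (real k * \<theta>))\<^sup>2)" .
  have b: "(\<Sum>k\<le>i. (cos (real k * \<theta>))\<^sup>2) \<le> (\<Sum>k\<le>j. (cos (real k * \<theta>))\<^sup>2)"
    unfolding i_def by (intro sum_mono2) auto
  have "(\<Sum>k\<le>i. 7 / 16 :: real) \<le> (\<Sum>k\<le>i. (cos (real k * \<theta>))\<^sup>2 + (cos (2 * (real k * \<theta>)))\<^sup>2)"
    by (intro sum_mono pair)
  then have "7 / 16 * (real i + 1) \<le> 2 * (\<Sum>k\<le>j. (cos (real k * \<theta>))\<^sup>2)"
    using a b by (simp add: sum.distrib algebra_simps)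
  moreover have "j + 1 \<le> 2 * (i + 1)" unfolding i_def by presburger
  then have "real j + 1 \<le> 2 * (real i + 1)" using of_nat_mono[of "j + 1" "2 * (i + 1)", where ?'a = real] by simp
  ultimately show ?thesis by simp
qed

text \<open>
Both kinds of Chebyshev polynomials obey this recurrence, with \<open>w = 1\<close> for the first kind and \<open>w = sin\<close> for
the second. The variable \<open>(1 - cos t) / 2\<close> runs through the unit interval.\<close>

lemma chebyshev_recurrence_poly:
  fixes F :: "nat \<Rightarrow> real \<Rightarrow> real"
  assumes F0: "\<And>t. F 0 t = w t" and F1: "\<And>t. F 1 t = w t * poly q ((1 - cos t) / 2)" "degree q \<le> 1"
    and rec: "\<And>k t. F (Suc (Suc k)) t = 2 * cos t * F (Suc k) t - F k t"
  shows "\<exists>p. degree p \<le> k \<and> (\<forall>t. w t * poly p ((1 - cos t) / 2) = F k t)"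
proof (induction k rule: induct_nat_012)
  case 0
  show ?case by (rule exI[of _ 1]) (simp add: F0)
next
  case 1
  show ?case using F1 by (intro exI[of _ q]) simp
next
  case (ge2 k)
  obtain p where p: "degree p \<le> k" "\<And>t. w t * poly p ((1 - cos t) / 2) = F k t"
    using ge2.IH(1) by blast
  obtain q where q: "degree q \<le> Suc k" "\<And>t. w t * poly q ((1 - cos t) / 2) = F (Suc k) t"
    using ge2.IH(2) by blast
  let ?r = "smult 2 ([:1, -2:] * q) - p"
  have "degree ?r \<le> Suc (Suc k)"
    by (intro degree_diff_le order_trans[OF degree_smult_le] order_trans[OF degree_mult_le])
       (use p(1) q(1) in auto)
  moreover have "w t * poly ?r ((1 - cos t) / 2) = F (Suc (Suc k)) t" for t
  proof -
    have "w t * poly ?r ((1 - cos t) / 2)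
      = 2 * cos t * (w t * poly q ((1 - cos t) / 2)) - w t * poly p ((1 - cos t) / 2)"
      by (simp add: field_simps)
    then show ?thesis unfolding p(2) q(2) rec .
  qed
  ultimately show ?case by blast
qed

lemma chebyshev_first_poly:
  "\<exists>p :: real poly. degree p \<le> k \<and> (\<forall>t. poly p ((1 - cos t) / 2) = cos (real k * t))"
proof -
  have "cos (real (Suc (Suc k)) * t) = 2 * cos t * cos (real (Suc k) * t) - cos (real k * t)" for k t
    using cos_add[of "real (Suc k) * t" t] cos_diff[of "real (Suc k) * t" t] by (simp add: algebra_simps)
  then show ?thesis
    using chebyshev_recurrence_poly[of "\<lambda>k t. cos (real k * t)" "\<lambda>t. 1" "[:1, -2:]" k]
    by (simp add: field_simps)
qed

lemma chebyshev_second_poly: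
  "\<exists>p :: real poly. degree p \<le> k \<and> (\<forall>t. sin t * poly p ((1 - cos t) / 2) = sin (real (Suc k) * t))"
proof (rule chebyshev_recurrence_poly[where q = "[:2, -4:]"])
  show "sin (real (Suc 1) * t) = sin t * poly [:2, -4:] ((1 - cos t) / 2)" for t
    using sin_double[of t] by (simp add: field_simps)
  show "sin (real (Suc (Suc (Suc k))) * t)
      = 2 * cos t * sin (real (Suc (Suc k)) * t) - sin (real (Suc k) * t)" for k t
    using sin_add[of "real (Suc (Suc k)) * t" t] sin_diff[of "real (Suc (Suc k)) * t" t]
    by (simp add: algebra_simps)
qed auto

text \<open>The polynomial is a product of two kernels of degree at most \<open>n / 2\<close>. The Dirichlet type kernel \<open>D\<close>, a
multiple of the sum of \<open>cos (k \<theta>) cos (k t)\<close>, equals one at \<open>\<theta>\<close> and has square integral of order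
\<open>1 / n\<close> with respect to \<open>dt\<close>. The factor \<open>sin (N t) / (K sin t)\<close> also equals one at \<open>\<theta>\<close>, and its
square reduces the weight \<open>sin t\<close> to a quantity of order \<open>1 / N\<close>. The product therefore has square
integral of order \<open>1 / (n N)\<close>, where \<open>N\<close> is the smaller of \<open>1 / \<theta>\<close> and \<open>n\<close>.\<close>

lemma exists_poly_peak:
  assumes "0 < s" "s \<le> 1/2"
  obtains p :: "real poly" where "degree p \<le> n" "poly p s = 1"
    "integral {0..1} (\<lambda>x. (poly p x)\<^sup>2) \<le> 600 * (sqrt s + 1 / (real n + 1)) / (real n + 1)"
proof -
  obtain \<theta> where \<theta>: "0 < \<theta>" "\<theta> \<le> pi / 2" "(1 - cos \<theta>) / 2 = s" "\<theta> \<le> pi * sqrt s"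
    using chebyshev_angle[OF assms] by blast
  define j where "j = n div 2"
  define M where "M = nat \<lfloor>pi / (2 * \<theta>)\<rfloor>"
  note M = pi_quotient_floor[OF \<theta>(1,2), folded M_def]
  \<comment> \<open>the cap keeps the degree at most n when the point is very close to the end of the interval\<close>
  define N where "N = min M (j + 1)"
  have N: "1 \<le> N" "N \<le> j + 1" using M(1) unfolding N_def by auto
  have N\<theta>: "real N * \<theta> \<le> pi / 2"
  proof -
    have "real N * \<theta> \<le> real M * \<theta>" using \<theta>(1) unfolding N_def by (intro mult_right_mono) auto
    with M(2) show ?thesis by linarith
  qed
  define S where "S = (\<Sum>k\<le>j. (cos (real k * \<theta>))\<^sup>2)"
  have "n + 1 \<le> 2 * (j + 1)" unfolding j_def by presburger
  then have j1: "real n + 1 \<le> 2 * (real j + 1)" using of_nat_mono[of "n + 1" "2 * (j + 1)", where ?'a = real] by simp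
  have S: "7 / 64 * (real j + 1) \<le> S" unfolding S_def by (rule sum_cos_square_ge)
  then have S0: "0 < S" by (smt (verit) mult_pos_pos of_nat_0_le_iff divide_pos_pos)
  have "\<exists>T. \<forall>k. degree (T k) \<le> k \<and> (\<forall>t. poly (T k) ((1 - cos t) / 2) = cos (real k * t))"
    using chebyshev_first_poly by (intro choice allI)
  then obtain T :: "nat \<Rightarrow> real poly" where T: "\<And>k. degree (T k) \<le> k"
    "\<And>k t. poly (T k) ((1 - cos t) / 2) = cos (real k * t)" by blast
  obtain U :: "real poly" where U: "degree U \<le> N - 1"
    "\<And>t. sin t * poly U ((1 - cos t) / 2) = sin (real N * t)"
    using chebyshev_second_poly[of "N - 1"] N(1) by auto
  define D where "D = (\<Sum>k\<le>j. smult (cos (real k * \<theta>) / S) (T k))"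
  have Dt: "poly D ((1 - cos t) / 2) = (\<Sum>k\<le>j. (cos (real k * \<theta>) / S) * cos (real k * t))" for t
    unfolding D_def by (simp add: poly_sum T(2))
  have degD: "degree D \<le> j" unfolding D_def
    by (intro degree_sum_le order_trans[OF degree_smult_le] order_trans[OF T(1)]) auto
  have Ds: "poly D s = 1"
  proof -
    have "poly D s = (\<Sum>k\<le>j. (cos (real k * \<theta>))\<^sup>2 / S)"
      using Dt[of \<theta>] \<theta>(3) by (simp add: power2_eq_square)
    also have "\<dots> = S / S" unfolding S_def sum_divide_distrib ..
    finally show ?thesis using S0 by simp
  qed
  define K where "K = poly U s"
  have sin\<theta>: "0 < sin \<theta>" using \<theta> pi_gt_zero by (intro sin_gt_zero) linarith+
  have K: "2 * real N / pi \<le> K"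
  proof -
    have "(2 * real N / pi) * sin \<theta> \<le> (2 * real N / pi) * \<theta>"
      using \<theta>(1) by (intro mult_left_mono sin_x_le_x) auto
    also have "\<dots> \<le> sin (real N * \<theta>)"
      using jordan_sin[of "real N * \<theta>"] N\<theta> \<theta>(1) by (simp add: mult_ac)
    also have "\<dots> = K * sin \<theta>" using U(2)[of \<theta>] \<theta>(3) unfolding K_def by (simp add: mult.commute)
    finally show ?thesis using sin\<theta> by (simp only: mult_le_cancel_right_pos)
  qed
  have K0: "0 < K" using K N(1) by (smt (verit) divide_pos_pos pi_gt_zero of_nat_1 of_nat_mono)
  define p where "p = smult (1 / K) (U * D)"
  have "degree p \<le> (N - 1) + j" unfolding p_def
    by (intro order_trans[OF degree_smult_le] order_trans[OF degree_mult_le] add_mono U degD)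
  also have "\<dots> \<le> n" using N unfolding j_def by linarith
  finally have 1: "degree p \<le> n" .
  have 2: "poly p s = 1" unfolding p_def using Ds K0 K_def by simp
  have "((\<lambda>t. (\<Sum>k\<le>j. (cos (real k * \<theta>) / S) * cos (real k * t))\<^sup>2) has_integral
      (\<Sum>k\<le>j. (if k = 0 then pi else pi / 2) * (cos (real k * \<theta>) / S)\<^sup>2)) {0..pi}"
    by (intro has_integral_square_sum finite_atMost has_integral_cos_mult_cos)
  then have intD: "((\<lambda>t. (poly D ((1 - cos t) / 2))\<^sup>2) has_integral
      (\<Sum>k\<le>j. (if k = 0 then pi else pi / 2) * (cos (real k * \<theta>) / S)\<^sup>2)) {0..pi}"
    unfolding Dt .
  have "(\<Sum>k\<le>j. (if k = 0 then pi else pi / 2) * (cos (real k * \<theta>) / S)\<^sup>2)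
      \<le> (\<Sum>k\<le>j. pi * (cos (real k * \<theta>) / S)\<^sup>2)"
    by (intro sum_mono mult_right_mono) auto
  also have "\<dots> = pi / S\<^sup>2 * S" unfolding S_def
    by (simp add: sum_distrib_left power_divide)
  also have "\<dots> = pi / S" using S0 by (simp add: power2_eq_square)
  finally have D_le: "(\<Sum>k\<le>j. (if k = 0 then pi else pi / 2) * (cos (real k * \<theta>) / S)\<^sup>2) \<le> pi / S" .
  define I where "I = integral {0..1} (\<lambda>x. (poly p x)\<^sup>2)"
  have sub: "((\<lambda>t. (poly p ((1 - cos t) / 2))\<^sup>2 * sin t) has_integral 2 * I) {0..pi}"
    unfolding I_def using integral_chebyshev_substitution[of "\<lambda>x. (poly p x)\<^sup>2"]
    by (simp add: continuous_intros)
  have "2 * I \<le> real N / K\<^sup>2 * (\<Sum>k\<le>j. (if k = 0 then pi else pi / 2) * (cos (real k * \<theta>) / S)\<^sup>2)"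
  proof (rule has_integral_le[OF sub has_integral_mult_right[OF intD]])
    fix t assume t: "t \<in> {0..pi}"
    let ?u = "poly U ((1 - cos t) / 2)" and ?d = "poly D ((1 - cos t) / 2)"
    have "?u\<^sup>2 * sin t \<le> real N"
    proof (cases "sin t = 0")
      case False
      then have st: "0 < sin t" using t sin_ge_zero[of t] by auto
      have "(?u\<^sup>2 * sin t) * sin t = (sin (real N * t))\<^sup>2"
        unfolding U(2)[of t, symmetric] by (simp add: power2_eq_square mult_ac)
      also have "\<dots> \<le> real N * sin t" using t by (intro sin_mult_square_le) auto
      finally show ?thesis using st by (simp only: mult_le_cancel_right_pos)
    qed simp
    then have "(?u\<^sup>2 * sin t) * (?d\<^sup>2 / K\<^sup>2) \<le> real N * (?d\<^sup>2 / K\<^sup>2)"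
      by (intro mult_right_mono) auto
    then show "(poly p ((1 - cos t) / 2))\<^sup>2 * sin t \<le> real N / K\<^sup>2 * ?d\<^sup>2"
      unfolding p_def by (simp add: power_mult_distrib power_divide mult_ac)
  qed
  also have "\<dots> \<le> real N / K\<^sup>2 * (pi / S)"
    by (intro mult_left_mono D_le) auto
  also have "\<dots> \<le> real N / (2 * real N / pi)\<^sup>2 * (pi / S)"
    using K K0 N(1) S0 by (intro mult_right_mono divide_left_mono power_mono mult_pos_pos) auto
  also have "\<dots> = pi ^ 3 / 4 * (1 / real N) * (1 / S)"
    using N(1) S0 by (simp add: field_simps power2_eq_square power3_eq_cube)
  also have "\<dots> \<le> 4 ^ 3 / 4 * (4 * sqrt s + 4 / (real n + 1)) * ((128 / 7) / (real n + 1))"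
  proof (intro mult_mono divide_right_mono power_mono)
    show "pi \<le> 4" using pi_less_4 by simp
    show "1 / S \<le> (128 / 7) / (real n + 1)"
    proof -
      have "7 / 128 * (real n + 1) \<le> 7 / 128 * (2 * (real j + 1))"
        using j1 by (intro mult_left_mono) auto
      also have "\<dots> = 7 / 64 * (real j + 1)" by simp
      finally have "7 / 128 * (real n + 1) \<le> S" using S by (rule order_trans)
      then show ?thesis using S0 by (simp add: field_simps)
    qed
    show "1 / real N \<le> 4 * sqrt s + 4 / (real n + 1)"
    proof (cases "M \<le> j + 1")
      case True
      have "pi / 4 \<le> real N * (pi * sqrt s)"
        using M(3) \<theta>(4) True by (smt (verit) N_def min.absorb1 mult_left_mono of_nat_0_le_iff)
      then have "1 \<le> real N * (4 * sqrt s)" by simp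
      then have "1 / real N \<le> 4 * sqrt s" using N(1) by (simp add: field_simps)
      then show ?thesis by (smt (verit) divide_nonneg_nonneg of_nat_0_le_iff)
    next
      case False
      then have "real n + 1 \<le> 2 * real N" using j1 unfolding N_def by simp
      then have "1 / real N \<le> 2 / (real n + 1)" using N(1) by (simp add: field_simps)
      also have "\<dots> \<le> 4 / (real n + 1)" by (intro divide_right_mono) auto
      finally show ?thesis using real_sqrt_ge_zero[of s] assms(1) by linarith
    qed
  qed (use S0 assms(1) in auto)
  also have "\<dots> \<le> 2 * (600 * (sqrt s + 1 / (real n + 1)) / (real n + 1))"
  proof -
    have "0 \<le> (sqrt s + 1 / (real n + 1)) / (real n + 1)" using assms(1) by simp
    then have "8192 / 7 * ((sqrt s + 1 / (real n + 1)) / (real n + 1)) \<le> 1200 * ((sqrt s + 1 / (real n + 1)) / (real n + 1))"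
      by (intro mult_right_mono) auto
    then show ?thesis by (simp add: field_simps)
  qed
  finally have "I \<le> 600 * (sqrt s + 1 / (real n + 1)) / (real n + 1)"
    by (rule mult_left_le_imp_le) simp
  then show ?thesis using that[OF 1 2] unfolding I_def by blast
qed

section \<open>Polynomials in two variables and integration over the plane\<close>

lemma poly2_add:
  assumes "f \<in> poly2 n" "g \<in> poly2 n"
  shows "(\<lambda>z. f z + g z) \<in> poly2 n"
proof -
  obtain c d where "f = (\<lambda>(x, y). \<Sum>i\<le>n. \<Sum>j\<le>n - i. c i j * x ^ i * y ^ j)"
    "g = (\<lambda>(x, y). \<Sum>i\<le>n. \<Sum>j\<le>n - i. d i j * x ^ i * y ^ j)"
    using assms unfolding poly2_def by blast
  then show ?thesis unfolding poly2_def
    by (intro CollectI exI[of _ "\<lambda>i j. c i j + d i j"])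
       (auto simp: fun_eq_iff sum.distrib algebra_simps)
qed

lemma poly2_scale:
  assumes "f \<in> poly2 n"
  shows "(\<lambda>z. r * f z) \<in> poly2 n"
proof -
  obtain c where "f = (\<lambda>(x, y). \<Sum>i\<le>n. \<Sum>j\<le>n - i. c i j * x ^ i * y ^ j)"
    using assms unfolding poly2_def by blast
  then show ?thesis unfolding poly2_def
    by (intro CollectI exI[of _ "\<lambda>i j. r * c i j"])
       (auto simp: fun_eq_iff sum_distrib_left mult_ac)
qed

lemma poly2_monomial:
  assumes "i + j \<le> n"
  shows "(\<lambda>z. fst z ^ i * snd z ^ j) \<in> poly2 n"
proof -
  have "(\<Sum>k\<le>n. \<Sum>l\<le>n - k. (if k = i \<and> l = j then 1 else 0) * x ^ k * y ^ l) = x ^ i * y ^ j"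
    for x y :: real
  proof -
    have "(\<Sum>k\<le>n. \<Sum>l\<le>n - k. (if k = i \<and> l = j then 1 else 0) * x ^ k * y ^ l)
      = (\<Sum>k\<le>n. if k = i then \<Sum>l\<le>n - i. if l = j then x ^ i * y ^ j else 0 else 0)"
      by (intro sum.cong refl) (simp add: if_distrib[of "\<lambda>c. c * _"] cong: if_cong)
    then show ?thesis using assms by simp
  qed
  then show ?thesis unfolding poly2_def
    by (intro CollectI exI[of _ "\<lambda>k l. if k = i \<and> l = j then 1 else 0"]) (auto simp: fun_eq_iff)
qed

lemma poly2_const: "(\<lambda>z. r) \<in> poly2 n"
  using poly2_scale[OF poly2_monomial[of 0 0 n], of r] by simp

lemma poly2_sum:
  assumes "\<And>k. k \<in> I \<Longrightarrow> F k \<in> poly2 n"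
  shows "(\<lambda>z. \<Sum>k\<in>I. F k z) \<in> poly2 n"
  using assms
  by (induction I rule: infinite_finite_induct) (auto intro: poly2_const poly2_add)

lemma poly2_expand:
  assumes "f \<in> poly2 n"
  obtains c where "\<And>z. f z = (\<Sum>i\<le>n. \<Sum>j\<le>n - i. c i j * (fst z ^ i * snd z ^ j))"
  using assms unfolding poly2_def by (auto simp: mult.assoc)

lemma poly2_mult_monomial:
  assumes "f \<in> poly2 n" "a + b \<le> d"
  shows "(\<lambda>z. fst z ^ a * snd z ^ b * f z) \<in> poly2 (d + n)"
proof -
  obtain c where c: "\<And>z. f z = (\<Sum>i\<le>n. \<Sum>j\<le>n - i. c i j * (fst z ^ i * snd z ^ j))"
    using poly2_expand[OF assms(1)] by blast
  have "(\<lambda>z. \<Sum>i\<le>n. \<Sum>j\<le>n - i. c i j * (fst z ^ (a + i) * snd z ^ (b + j))) \<in> poly2 (d + n)"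
    using assms(2) by (intro poly2_sum poly2_scale poly2_monomial) auto
  moreover have "(\<lambda>z. fst z ^ a * snd z ^ b * f z)
      = (\<lambda>z. \<Sum>i\<le>n. \<Sum>j\<le>n - i. c i j * (fst z ^ (a + i) * snd z ^ (b + j)))"
    unfolding c by (simp add: sum_distrib_left power_add mult_ac)
  ultimately show ?thesis by simp
qed

lemma poly2_mono:
  assumes "f \<in> poly2 n" "n \<le> m"
  shows "f \<in> poly2 m"
  using poly2_mult_monomial[OF assms(1), of 0 0 "m - n"] assms(2) by simp

lemma poly2_mult_affine:
  assumes "f \<in> poly2 n"
  shows "(\<lambda>z. (p + q * fst z + r * snd z) * f z) \<in> poly2 (Suc n)"
proof -
  have "(\<lambda>z. p * f z + (q * (fst z ^ 1 * snd z ^ 0 * f z) + r * (fst z ^ 0 * snd z ^ 1 * f z))) \<in> poly2 (1 + n)"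
    by (intro poly2_add poly2_scale poly2_mult_monomial assms) (auto intro: poly2_mono[OF assms])
  then show ?thesis by (simp add: algebra_simps)
qed

lemma poly2_mult_poly_affine:
  assumes "f \<in> poly2 n" "degree u \<le> m"
  shows "(\<lambda>z. poly u (p + q * fst z + r * snd z) * f z) \<in> poly2 (m + n)"
proof -
  have "(\<lambda>z. poly u (p + q * fst z + r * snd z) * f z) \<in> poly2 (degree u + n)"
  proof (induction u)
    case 0
    then show ?case using poly2_const[of 0] by simp
  next
    case (pCons c u)
    show ?case
    proof (cases "u = 0")
      case True
      then show ?thesis using poly2_scale[OF assms(1)] by simp
    next
      case False
      then have "(\<lambda>z. c * f z + (p + q * fst z + r * snd z) *
          (poly u (p + q * fst z + r * snd z) * f z)) \<in> poly2 (Suc (degree u + n))"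
        by (intro poly2_add poly2_scale poly2_mult_affine pCons.IH) (auto intro: poly2_mono[OF assms(1)])
      then show ?thesis using False by (simp add: algebra_simps)
    qed
  qed
  then show ?thesis by (rule poly2_mono) (use assms(2) in simp)
qed

lemma poly2_compose_poly:
  assumes "f \<in> poly2 n" "degree X \<le> d" "degree Y \<le> d"
  obtains p where "degree p \<le> d * n" "\<And>t. poly p t = f (poly X t, poly Y t)"
proof -
  obtain c where c: "\<And>z. f z = (\<Sum>i\<le>n. \<Sum>j\<le>n - i. c i j * (fst z ^ i * snd z ^ j))"
    using poly2_expand[OF assms(1)] by blast
  define p where "p = (\<Sum>i\<le>n. \<Sum>j\<le>n - i. smult (c i j) (X ^ i * Y ^ j))"
  have "degree p \<le> d * n" unfolding p_def
  proof (intro degree_sum_le order_trans[OF degree_smult_le] order_trans[OF degree_mult_le])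
    fix i j assume ij: "i \<in> {..n}" "j \<in> {..n - i}"
    have "degree (X ^ i) + degree (Y ^ j) \<le> degree X * i + degree Y * j"
      by (intro add_mono degree_power_le)
    also have "\<dots> \<le> d * i + d * j" using assms by (intro add_mono mult_right_mono) auto
    also have "\<dots> = d * (i + j)" by (simp add: algebra_simps)
    also have "\<dots> \<le> d * n" using ij by (intro mult_left_mono) auto
    finally show "degree (X ^ i) + degree (Y ^ j) \<le> d * n" .
  qed auto
  moreover have "poly p t = f (poly X t, poly Y t)" for t
    unfolding p_def c by (simp add: poly_sum poly_power)
  ultimately show ?thesis using that by blast
qed

lemma poly2_measurable [measurable]: "f \<in> poly2 n \<Longrightarrow> f \<in> borel_measurable borel"
  by (intro borel_measurable_continuous_onI continuous_on_poly2)

lemma nn_integral_square_L2_inner: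
  assumes "compact D" "f \<in> poly2 n"
  shows "(\<integral>\<^sup>+z. ennreal ((f z)\<^sup>2) * indicator D z \<partial>lborel) = ennreal (L2_inner D f f)"
proof -
  have "(\<integral>\<^sup>+z. ennreal ((f z)\<^sup>2) * indicator D z \<partial>lborel) = (\<integral>\<^sup>+z. ennreal (indicator D z *\<^sub>R (f z * f z)) \<partial>lborel)"
    by (intro nn_integral_cong) (auto simp: indicator_def power2_eq_square)
  also have "\<dots> = ennreal (L2_inner D f f)"
    unfolding L2_inner_def set_lebesgue_integral_def
    using set_integrable_poly2_mult[OF assms assms(2)]
    by (intro nn_integral_eq_integral) (auto simp: set_integrable_def)
  finally show ?thesis .
qed

lemma L2_inner_nonneg: "0 \<le> L2_inner D f f"
  unfolding L2_inner_def set_lebesgue_integral_def by (intro integral_nonneg_AE) auto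

lemma nn_integral_poly_square:
  fixes p :: "real poly"
  shows "(\<integral>\<^sup>+x. ennreal ((poly p x)\<^sup>2) * indicator {0..1} x \<partial>lborel)
     = ennreal (integral {0..1} (\<lambda>x. (poly p x)\<^sup>2))"
  by (intro nn_integral_has_integral_lebesgue' integrable_integral integrable_continuous_real
      continuous_intros) auto

lemma nn_integral_plane:
  fixes f :: "real \<times> real \<Rightarrow> ennreal"
  assumes "f \<in> borel_measurable borel"
  shows "(\<integral>\<^sup>+z. f z \<partial>lborel) = (\<integral>\<^sup>+x. \<integral>\<^sup>+y. f (x, y) \<partial>lborel \<partial>lborel)"
proof -
  have "f \<in> borel_measurable (lborel \<Otimes>\<^sub>M lborel)" using assms by (simp add: lborel_prod)
  from lborel.nn_integral_fst[OF this] show ?thesis by (simp add: lborel_prod)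
qed

text \<open>Change of variables to the two linear forms \<open>c - a x - b y\<close> and \<open>c + a x - b y\<close>. The map is not diagonal,
so Tonelli's theorem is used twice: for fixed \<open>x\<close> the first form replaces \<open>y\<close>, and for fixed value of the
first form the second one replaces \<open>x\<close>.\<close>

lemma nn_integral_strips:
  fixes g h :: "real \<Rightarrow> ennreal"
  assumes [measurable]: "g \<in> borel_measurable borel" "h \<in> borel_measurable borel"
    and "0 < a" "0 < b"
  shows "(\<integral>\<^sup>+z. g (c - a * fst z - b * snd z) * h (c + a * fst z - b * snd z) \<partial>lborel)
    = ennreal (1 / (2 * a * b)) * ((\<integral>\<^sup>+x. g x \<partial>lborel) * (\<integral>\<^sup>+x. h x \<partial>lborel))"
proof -
  let ?f = "\<lambda>x y. g (c - a * x - b * y) * h (c + a * x - b * y)"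
  have "(\<integral>\<^sup>+z. g (c - a * fst z - b * snd z) * h (c + a * fst z - b * snd z) \<partial>lborel)
    = (\<integral>\<^sup>+x. \<integral>\<^sup>+y. ?f x y \<partial>lborel \<partial>lborel)"
  proof (subst nn_integral_plane)
    have "(\<lambda>z. c - a * fst z - b * snd z) \<in> borel_measurable borel"
      "(\<lambda>z. c + a * fst z - b * snd z) \<in> borel_measurable borel"
      by (auto intro!: borel_measurable_continuous_onI continuous_intros)
    note this[measurable]
    show "(\<lambda>z. g (c - a * fst z - b * snd z) * h (c + a * fst z - b * snd z)) \<in> borel_measurable borel"
      by measurable
  qed simp
  also have "\<dots> = (\<integral>\<^sup>+x. ennreal (1 / b) * (\<integral>\<^sup>+u. g u * h (2 * a * x + u) \<partial>lborel) \<partial>lborel)"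
  proof (rule nn_integral_cong)
    fix x :: real
    have *: "(\<integral>\<^sup>+y. ?f x y \<partial>lborel)
      = \<bar>- 1 / b\<bar> * (\<integral>\<^sup>+u. g (c - a * x - b * ((c - a * x) / b + (- 1 / b) * u))
           * h (c + a * x - b * ((c - a * x) / b + (- 1 / b) * u)) \<partial>lborel)"
      using assms(4) by (intro nn_integral_real_affine) auto
    have **: "c - a * x - b * ((c - a * x) / b + (- 1 / b) * u) = u"
      "c + a * x - b * ((c - a * x) / b + (- 1 / b) * u) = 2 * a * x + u" for u
      using assms(4) by (simp_all add: field_simps)
    show "(\<integral>\<^sup>+y. ?f x y \<partial>lborel)
      = ennreal (1 / b) * (\<integral>\<^sup>+u. g u * h (2 * a * x + u) \<partial>lborel)"
      using * assms(4) unfolding ** by simp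
  qed
  also have "\<dots> = ennreal (1 / b) * (\<integral>\<^sup>+x. \<integral>\<^sup>+u. g u * h (2 * a * x + u) \<partial>lborel \<partial>lborel)"
    by (intro nn_integral_cmult) auto
  also have "(\<integral>\<^sup>+x. \<integral>\<^sup>+u. g u * h (2 * a * x + u) \<partial>lborel \<partial>lborel)
     = (\<integral>\<^sup>+u. \<integral>\<^sup>+x. g u * h (2 * a * x + u) \<partial>lborel \<partial>lborel)"
    by (rule lborel_pair.Fubini') auto
  also have "\<dots> = (\<integral>\<^sup>+u. g u * (ennreal (1 / (2 * a)) * (\<integral>\<^sup>+x. h x \<partial>lborel)) \<partial>lborel)"
  proof (rule nn_integral_cong)
    fix u :: real
    have "(\<integral>\<^sup>+x. h x \<partial>lborel) = \<bar>2 * a\<bar> * (\<integral>\<^sup>+x. h (u + 2 * a * x) \<partial>lborel)"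
      using assms(3) by (intro nn_integral_real_affine) auto
    then have "ennreal (1 / (2 * a)) * (\<integral>\<^sup>+x. h x \<partial>lborel)
       = (ennreal (1 / (2 * a)) * ennreal (2 * a)) * (\<integral>\<^sup>+x. h (2 * a * x + u) \<partial>lborel)"
      using assms(3) by (simp add: mult.assoc add.commute)
    also have "ennreal (1 / (2 * a)) * ennreal (2 * a) = 1"
      using assms(3) by (simp flip: ennreal_mult)
    finally show "(\<integral>\<^sup>+x. g u * h (2 * a * x + u) \<partial>lborel)
       = g u * (ennreal (1 / (2 * a)) * (\<integral>\<^sup>+x. h x \<partial>lborel))"
      by (simp add: nn_integral_cmult)
  qed
  also have "\<dots> = (\<integral>\<^sup>+u. g u \<partial>lborel) * (ennreal (1 / (2 * a)) * (\<integral>\<^sup>+x. h x \<partial>lborel))"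
    by (intro nn_integral_multc) auto
  also have "ennreal (1 / b) * \<dots>
     = (ennreal (1 / b) * ennreal (1 / (2 * a))) * ((\<integral>\<^sup>+x. g x \<partial>lborel) * (\<integral>\<^sup>+x. h x \<partial>lborel))"
    by (simp add: mult_ac)
  also have "ennreal (1 / b) * ennreal (1 / (2 * a)) = ennreal (1 / (2 * a * b))"
    using assms(3,4) by (simp flip: ennreal_mult add: mult_ac)
  finally show ?thesis .
qed

text \<open>The source of upper bounds for the Christoffel function. The domain lies in the parallelogram cut out by
two strips; the product of two one-dimensional peaks, one across each strip, is integrated over the whole
parallelogram. The factor \<open>1 / (a b)\<close>, up to a constant the reciprocal Jacobian, accounts for the angle
between the strips. Widening the strips to length six leaves the point in the half where the one-dimensional
peaks are available.\<close>

lemma exists_poly2_peak: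
  assumes D: "compact D" and ab: "0 < a" "0 < b"
    and strip: "\<And>w. w \<in> D \<Longrightarrow> 1 - a * fst w - b * snd w \<in> {0..6} \<and> 1 + a * fst w - b * snd w \<in> {0..6}"
    and z: "1 - a * fst z - b * snd z = l1" "1 + a * fst z - b * snd z = l2"
    and l: "0 < l1" "l1 \<le> 3" "0 < l2" "l2 \<le> 3" and n: "1 \<le> n"
  obtains f where "f \<in> poly2 n" "f z = 1"
    "L2_inner D f f \<le> 18 * 2400\<^sup>2 / (a * b) * ((sqrt l1 + 1 / real n) / real n * ((sqrt l2 + 1 / real n) / real n))"
proof -
  define j where "j = n div 2"
  have "n + 1 \<le> 2 * (j + 1)" unfolding j_def by presburger
  then have j1: "real n \<le> 2 * (real j + 1)"
    using of_nat_mono[of "n + 1" "2 * (j + 1)", where ?'a = real] by simp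
  have bound: "600 * (sqrt (l / 6) + 1 / (real j + 1)) / (real j + 1) \<le> 2400 * ((sqrt l + 1 / real n) / real n)"
    if "0 < l" for l
  proof -
    have r: "1 / (real j + 1) \<le> 2 / real n" using j1 n by (simp add: field_simps)
    have "600 * (sqrt (l / 6) + 1 / (real j + 1)) * (1 / (real j + 1))
       \<le> 600 * (2 * sqrt l + 2 / real n) * (2 / real n)"
      using r that by (intro mult_mono add_mono order_trans[OF real_sqrt_le_mono[of "l/6" l]]) auto
    also have "\<dots> = 2400 * ((sqrt l + 1 / real n) / real n)" by (simp add: algebra_simps add_divide_distrib)
    finally show ?thesis by (simp only: mult_1_right times_divide_eq_right)
  qed
  obtain p1 where p1: "degree p1 \<le> j" "poly p1 (l1 / 6) = 1"
    "integral {0..1} (\<lambda>x. (poly p1 x)\<^sup>2) \<le> 600 * (sqrt (l1 / 6) + 1 / (real j + 1)) / (real j + 1)"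
    using exists_poly_peak[of "l1 / 6" j] l by auto
  obtain p2 where p2: "degree p2 \<le> j" "poly p2 (l2 / 6) = 1"
    "integral {0..1} (\<lambda>x. (poly p2 x)\<^sup>2) \<le> 600 * (sqrt (l2 / 6) + 1 / (real j + 1)) / (real j + 1)"
    using exists_poly_peak[of "l2 / 6" j] l by auto
  define I1 where "I1 = integral {0..1} (\<lambda>x. (poly p1 x)\<^sup>2)"
  define I2 where "I2 = integral {0..1} (\<lambda>x. (poly p2 x)\<^sup>2)"
  have I0: "0 \<le> I1" "0 \<le> I2" unfolding I1_def I2_def
    by (intro integral_nonneg integrable_continuous_real continuous_intros; simp)+
  define f where "f = (\<lambda>w. poly p1 (1/6 + (- a/6) * fst w + (- b/6) * snd w) *
      (poly p2 (1/6 + (a/6) * fst w + (- b/6) * snd w) * 1))"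
  have "f \<in> poly2 (j + (j + 0))" unfolding f_def
    by (intro poly2_mult_poly_affine poly2_const p1 p2)
  then have f2: "f \<in> poly2 n" by (rule poly2_mono) (simp add: j_def)
  have fz: "f z = 1"
  proof -
    have *: "1/6 + (- a/6) * fst z + (- b/6) * snd z = l1 / 6"
      "1/6 + (a/6) * fst z + (- b/6) * snd z = l2 / 6"
      unfolding z[symmetric] by (simp_all add: field_simps)
    show ?thesis unfolding f_def * p1(2) p2(2) by simp
  qed
  let ?g = "\<lambda>p x. ennreal ((poly p x)\<^sup>2) * indicator {0..1} x :: ennreal"
  have meas: "?g p \<in> borel_measurable borel" for p :: "real poly"
  proof -
    have "(\<lambda>x. (poly p x)\<^sup>2) \<in> borel_measurable borel"
      by (intro borel_measurable_continuous_onI continuous_intros)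
    note this[measurable]
    show ?thesis by measurable
  qed
  have "ennreal (L2_inner D f f) = (\<integral>\<^sup>+w. ennreal ((f w)\<^sup>2) * indicator D w \<partial>lborel)"
    by (rule nn_integral_square_L2_inner[OF D f2, symmetric])
  also have "\<dots> \<le> (\<integral>\<^sup>+w. ?g p1 (1/6 - a/6 * fst w - b/6 * snd w) * ?g p2 (1/6 + a/6 * fst w - b/6 * snd w) \<partial>lborel)"
  proof (rule nn_integral_mono)
    fix w :: "real \<times> real"
    show "ennreal ((f w)\<^sup>2) * indicator D w
      \<le> ?g p1 (1/6 - a/6 * fst w - b/6 * snd w) * ?g p2 (1/6 + a/6 * fst w - b/6 * snd w)"
    proof (cases "w \<in> D")
      case True
      then have "1/6 - a/6 * fst w - b/6 * snd w \<in> {0..1}" "1/6 + a/6 * fst w - b/6 * snd w \<in> {0..1}"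
        using strip[OF True] by (auto simp: field_simps)
      then show ?thesis using True unfolding f_def
        by (simp add: power_mult_distrib ennreal_mult)
    qed simp
  qed
  also have "\<dots> = ennreal (1 / (2 * (a/6) * (b/6))) * (ennreal I1 * ennreal I2)"
    unfolding I1_def I2_def nn_integral_poly_square[symmetric]
    by (rule nn_integral_strips[OF meas meas]) (use ab in auto)
  also have "\<dots> = ennreal (18 / (a * b) * (I1 * I2))"
    using ab I0 by (simp flip: ennreal_mult)
  finally have "L2_inner D f f \<le> 18 / (a * b) * (I1 * I2)"
    using ab I0 by (subst (asm) ennreal_le_iff) auto
  also have "\<dots> \<le> 18 / (a * b) * ((2400 * ((sqrt l1 + 1 / real n) / real n)) * (2400 * ((sqrt l2 + 1 / real n) / real n)))"
    using I0 ab l p1(3) p2(3) bound[of l1] bound[of l2]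
    unfolding I1_def[symmetric] I2_def[symmetric]
    by (intro mult_left_mono mult_mono) auto
  also have "\<dots> = 18 * 2400\<^sup>2 / (a * b) * ((sqrt l1 + 1 / real n) / real n * ((sqrt l2 + 1 / real n) / real n))"
  proof -
    have "18 / (a * b) * ((2400 * A) * (2400 * B)) = 18 * 2400\<^sup>2 / (a * b) * (A * B)" for A B :: real
      by (simp add: power2_eq_square)
    then show ?thesis .
  qed
  finally show ?thesis using that f2 fz by blast
qed

text \<open>The source of lower bounds for the Christoffel function. The image of the square under
\<open>(r, t) \<mapsto> (x1 + \<beta> t, y1 + c s - k t - c t\<^sup>2 - c r)\<close> is a region between two parallel parabolas inside \<open>D\<close>.
The parametrization is polynomial, so \<open>f\<close> pulls back to a polynomial of degree \<open>n\<close> in \<open>r\<close> and \<open>2 n\<close> in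
\<open>t\<close>, and its Jacobian is constant. The one-dimensional inequality is applied in \<open>t\<close> at the middle of the
interval and in \<open>r\<close> at the parameter \<open>s\<close> of the given point.\<close>

lemma poly2_point_le_integral:
  assumes D: "compact D" and f: "f \<in> poly2 n" and n: "1 \<le> n"
    and pos: "0 < \<beta>" "0 < c" "0 < s" "s \<le> 1/2"
    and sub: "\<And>r t. r \<in> {0..1} \<Longrightarrow> t \<in> {-1..1} \<Longrightarrow>
        (x1 + \<beta> * t, y1 + c * s - k * t - c * t\<^sup>2 - c * r) \<in> D"
  shows "(f (x1, y1))\<^sup>2 \<le> 64 * real n * ((real n + 1 / sqrt s) / sqrt s) / (\<beta> * c) * L2_inner D f f"
proof -
  \<comment> \<open>T maps the unit interval, on which the one-variable estimate is stated, to the range of t\<close>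
  define T where "T = (\<lambda>t::real. 2 * t - 1)"
  define X where "X = (\<lambda>t. x1 + \<beta> * T t)"
  define P where "P = (\<lambda>t. y1 + c * s - k * T t - c * (T t)\<^sup>2)"
  let ?F = "\<lambda>t r. ennreal ((f (X t, P t - c * r))\<^sup>2)"
  have meas: "X \<in> borel_measurable borel" "P \<in> borel_measurable borel" "f \<in> borel_measurable borel"
    "D \<in> sets borel"
    using f D unfolding X_def P_def T_def by (auto intro: poly2_measurable borel_compact)
  note [measurable] = meas
  define I where "I = L2_inner D f f"
  define K1 where "K1 = 4 * (real n + 1 / sqrt s) / sqrt s"
  define K2 where "K2 = 16 * real (2 * n)"
  have K: "0 \<le> K1" "0 \<le> K2" unfolding K1_def K2_def using pos by auto
  have inner: "?F t s
      \<le> ennreal K1 * (\<integral>\<^sup>+r. ?F t r * indicator {0..1} r \<partial>lborel)" for t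
  proof -
    obtain p where p: "degree p \<le> 1 * n" "\<And>r. poly p r = f (poly [:X t:] r, poly [:P t, - c:] r)"
      by (rule poly2_compose_poly[OF f, of "[:X t:]" 1 "[:P t, - c:]"]) auto
    then have p': "poly p r = f (X t, P t - c * r)" for r by (simp add: mult.commute)
    show ?thesis
      using poly_point_le_integral[of s p n] pos p(1) K
      unfolding p'[symmetric] nn_integral_poly_square K1_def[symmetric]
      by (simp flip: ennreal_mult' add: ennreal_leI)
  qed
  have "?F (1/2) s
      \<le> ennreal K2 * (\<integral>\<^sup>+t. ?F t s * indicator {0..1} t \<partial>lborel)"
  proof -
    obtain p where p: "degree p \<le> 2 * n"
      "\<And>t. poly p t = f (poly [:x1 - \<beta>, 2 * \<beta>:] t, poly [:y1 + k - c, 4 * c - 2 * k, - 4 * c:] t)"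
      by (rule poly2_compose_poly[OF f, of "[:x1 - \<beta>, 2 * \<beta>:]" 2 "[:y1 + k - c, 4 * c - 2 * k, - 4 * c:]"]) auto
    have p': "poly p t = f (X t, P t - c * s)" for t
      unfolding p(2) X_def P_def T_def by (simp add: algebra_simps power2_eq_square)
    have s2: "1 \<le> sqrt 2" "sqrt 2 \<le> 2" by (auto simp: real_le_lsqrt)
    have "4 * (real (2 * n) + 1 / sqrt (1/2)) / sqrt (1/2) = 4 * (real (2 * n) + sqrt 2) * sqrt 2"
      by (simp add: real_sqrt_divide)
    also have "\<dots> \<le> 4 * (real (2 * n) + real (2 * n)) * 2"
      using s2 n by (intro mult_mono add_mono) auto
    finally have k2: "4 * (real (2 * n) + 1 / sqrt (1/2)) / sqrt (1/2) \<le> K2"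
      unfolding K2_def by simp
    have i0: "0 \<le> integral {0..1} (\<lambda>x. (poly p x)\<^sup>2)"
      by (intro integral_nonneg integrable_continuous_real continuous_intros) simp
    have "(poly p (1/2))\<^sup>2 \<le> K2 * integral {0..1} (\<lambda>x. (poly p x)\<^sup>2)"
      using poly_point_le_integral[of "1/2" p "2 * n"] p(1) mult_right_mono[OF k2 i0] by simp
    then show ?thesis using K
      unfolding p'[symmetric] nn_integral_poly_square
      by (simp flip: ennreal_mult' add: ennreal_leI)
  qed
  also have "\<dots> \<le> ennreal K2 * (\<integral>\<^sup>+t. ennreal K1 *
      ((\<integral>\<^sup>+r. ?F t r * indicator {0..1} r \<partial>lborel) * indicator {0..1} t) \<partial>lborel)"
    by (intro mult_left_mono nn_integral_mono) (auto simp: mult.assoc[symmetric] intro!: mult_right_mono inner)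
  also have "\<dots> = ennreal (K2 * K1) * (\<integral>\<^sup>+t.
      (\<integral>\<^sup>+r. ?F t r * indicator {0..1} r \<partial>lborel) * indicator {0..1} t \<partial>lborel)"
    using K by (subst nn_integral_cmult) (auto simp: ennreal_mult mult.assoc)
  also have "(\<integral>\<^sup>+t. (\<integral>\<^sup>+r. ?F t r * indicator {0..1} r \<partial>lborel) * indicator {0..1} t \<partial>lborel)
     \<le> (\<integral>\<^sup>+t. (\<integral>\<^sup>+r. ?F t r * indicator D (X t, P t - c * r) \<partial>lborel) \<partial>lborel)"
  proof (rule nn_integral_mono)
    fix t :: real
    show "(\<integral>\<^sup>+r. ?F t r * indicator {0..1} r \<partial>lborel) * indicator {0..1} t
      \<le> (\<integral>\<^sup>+r. ?F t r * indicator D (X t, P t - c * r) \<partial>lborel)"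
    proof (cases "t \<in> {0..1}")
      case True
      then have "(X t, P t - c * r) \<in> D" if "r \<in> {0..1}" for r
        unfolding X_def P_def using sub[of r "T t"] that by (auto simp: T_def)
      then show ?thesis using True by (auto intro!: nn_integral_mono simp: indicator_def)
    qed simp
  qed
  also have "(\<integral>\<^sup>+t. (\<integral>\<^sup>+r. ?F t r * indicator D (X t, P t - c * r) \<partial>lborel) \<partial>lborel)
     = ennreal (1 / (2 * \<beta> * c)) * ennreal I"
  proof -
    let ?G = "\<lambda>z. ennreal ((f z)\<^sup>2) * indicator D z :: ennreal"
    have "ennreal I = (\<integral>\<^sup>+x. \<integral>\<^sup>+y. ?G (x, y) \<partial>lborel \<partial>lborel)"
      unfolding I_def nn_integral_square_L2_inner[OF D f, symmetric]
      by (rule nn_integral_plane) auto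
    also have "\<dots> = ennreal \<bar>2 * \<beta>\<bar> * (\<integral>\<^sup>+t. \<integral>\<^sup>+y. ?G ((x1 - \<beta>) + 2 * \<beta> * t, y) \<partial>lborel \<partial>lborel)"
      by (rule nn_integral_real_affine) (use pos in auto)
    also have "\<dots> = ennreal (2 * \<beta>) * (\<integral>\<^sup>+t. ennreal c * (\<integral>\<^sup>+r. ?G (X t, P t - c * r) \<partial>lborel) \<partial>lborel)"
    proof (intro arg_cong2[where f = "(*)"] nn_integral_cong)
      fix t :: real
      have "(\<integral>\<^sup>+y. ?G (X t, y) \<partial>lborel) = \<bar>- c\<bar> * (\<integral>\<^sup>+r. ?G (X t, P t + (- c) * r) \<partial>lborel)"
        by (rule nn_integral_real_affine) (use pos in auto)
      moreover have "(x1 - \<beta>) + 2 * \<beta> * t = X t" unfolding X_def T_def by (simp add: algebra_simps)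
      ultimately show "(\<integral>\<^sup>+y. ?G ((x1 - \<beta>) + 2 * \<beta> * t, y) \<partial>lborel)
         = ennreal c * (\<integral>\<^sup>+r. ?G (X t, P t - c * r) \<partial>lborel)" using pos by simp
    qed (use pos in auto)
    also have "\<dots> = ennreal (2 * \<beta>) * (ennreal c * (\<integral>\<^sup>+t. \<integral>\<^sup>+r. ?G (X t, P t - c * r) \<partial>lborel \<partial>lborel))"
      by (subst nn_integral_cmult) auto
    finally have "ennreal (1 / (2 * \<beta> * c)) * ennreal I = ennreal (1 / (2 * \<beta> * c)) *
       (ennreal (2 * \<beta>) * (ennreal c * (\<integral>\<^sup>+t. \<integral>\<^sup>+r. ?G (X t, P t - c * r) \<partial>lborel \<partial>lborel)))" by simp
    also have "\<dots> = ennreal (1 / (2 * \<beta> * c) * (2 * \<beta>) * c) * (\<integral>\<^sup>+t. \<integral>\<^sup>+r. ?G (X t, P t - c * r) \<partial>lborel \<partial>lborel)"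
      using pos by (simp add: ennreal_mult mult.assoc del: times_divide_eq_left)
    finally show ?thesis using pos by simp
  qed
  finally have "?F (1/2) s \<le> ennreal (K2 * K1) * (ennreal (1 / (2 * \<beta> * c)) * ennreal I)"
    by (simp add: mult_left_mono)
  also have "\<dots> = ennreal (K2 * K1 * (1 / (2 * \<beta> * c)) * I)"
  proof -
    have "0 \<le> 1 / (2 * \<beta> * c)" using pos by simp
    moreover have "0 \<le> I" unfolding I_def by (rule L2_inner_nonneg)
    ultimately show ?thesis using K by (simp only: ennreal_mult mult_nonneg_nonneg mult.assoc)
  qed
  finally have "(f (X (1/2), P (1/2) - c * s))\<^sup>2 \<le> K2 * K1 * (1 / (2 * \<beta> * c)) * I"
    using K pos L2_inner_nonneg[of D f] unfolding I_def by (subst (asm) ennreal_le_iff) auto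
  moreover have "16 * (2 * N) * (4 * A / r) * (1 / (2 * \<beta> * c)) * I = 64 * N * (A / r) / (\<beta> * c) * I"
    for A r N by (simp add: field_simps)
  then have "K2 * K1 * (1 / (2 * \<beta> * c)) * I = 64 * real n * ((real n + 1 / sqrt s) / sqrt s) / (\<beta> * c) * I"
    unfolding K1_def K2_def by (simp only: of_nat_mult of_nat_numeral)
  moreover have "X (1/2) = x1" "P (1/2) - c * s = y1" unfolding X_def P_def T_def by simp_all
  ultimately show ?thesis unfolding I_def by simp
qed

section \<open>The extremal property of the Christoffel function\<close>

lemma L2_inner_commute: "L2_inner D f g = L2_inner D g f"
  unfolding L2_inner_def by (simp add: mult.commute)

lemma L2_inner_add_left:
  assumes "compact D" "f \<in> poly2 n" "g \<in> poly2 n" "h \<in> poly2 n"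
  shows "L2_inner D (\<lambda>z. f z + g z) h = L2_inner D f h + L2_inner D g h"
  using set_integrable_poly2_mult[OF assms(1) assms(2) assms(4)]
    set_integrable_poly2_mult[OF assms(1) assms(3) assms(4)]
  unfolding L2_inner_def by (simp add: distrib_right set_integral_add)

lemma L2_inner_scale_left: "L2_inner D (\<lambda>z. r * f z) h = r * L2_inner D f h"
  unfolding L2_inner_def by (simp add: mult.assoc)

lemma L2_inner_sum_left:
  assumes "compact D" "\<And>k. k \<in> I \<Longrightarrow> F k \<in> poly2 n" "h \<in> poly2 n"
  shows "L2_inner D (\<lambda>z. \<Sum>k\<in>I. r k * F k z) h = (\<Sum>k\<in>I. r k * L2_inner D (F k) h)"
  using assms(2)
proof (induction I rule: infinite_finite_induct)
  case (insert k I)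
  then have "L2_inner D (\<lambda>z. r k * F k z + (\<Sum>k\<in>I. r k * F k z)) h
     = L2_inner D (\<lambda>z. r k * F k z) h + L2_inner D (\<lambda>z. \<Sum>k\<in>I. r k * F k z) h"
    by (intro L2_inner_add_left[where n = n] assms(1,3) poly2_sum poly2_scale) auto
  then show ?case using insert by (simp add: L2_inner_scale_left)
qed (auto simp: L2_inner_def)

text \<open>The pointwise inequality above, applied to a small parabolic region around each interior point, makes
\<open>f\<close> vanish on the interior; the restriction of \<open>f\<close> to any line through an interior point then has
infinitely many zeros.\<close>

lemma poly2_eq_0_if_L2_inner_eq_0:
  assumes D: "compact D" "interior D \<noteq> {}" and f: "f \<in> poly2 n" and 0: "L2_inner D f f = 0"
  shows "f = (\<lambda>z. 0)"
proof -
  have int0: "f w = 0" if w: "w \<in> interior D" for w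
  proof -
    obtain e where e: "0 < e" "ball w e \<subseteq> D"
      using w by (meson mem_interior)
    define c where "c = e / 8"
    have "(f (fst w, snd w))\<^sup>2 \<le> 64 * real (Suc n) * ((real (Suc n) + 1 / sqrt (1/2)) / sqrt (1/2)) / (c * c)
        * L2_inner D f f"
    proof (rule poly2_point_le_integral[where k = 0, OF D(1)])
      show "f \<in> poly2 (Suc n)" by (rule poly2_mono[OF f]) simp
      fix r t :: real
      assume rt: "r \<in> {0..1}" "t \<in> {-1..1}"
      have t2: "t\<^sup>2 \<le> 1" using rt by (auto simp: abs_square_le_1)
      let ?p = "(fst w + c * t, snd w + c * (1/2) - 0 * t - c * t\<^sup>2 - c * r)"
      have "dist w ?p \<le> \<bar>fst w - fst ?p\<bar> + \<bar>snd w - snd ?p\<bar>"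
        by (simp add: dist_Pair_Pair dist_real_def dist_prod_def sqrt_sum_squares_le_sum_abs)
      also have "fst w - fst ?p = c * (- t)" by simp
      also have "snd w - snd ?p = c * (t\<^sup>2 + r - 1/2)" by (simp add: algebra_simps)
      also have "\<bar>c * (- t)\<bar> + \<bar>c * (t\<^sup>2 + r - 1/2)\<bar> \<le> c * 1 + c * 2"
        proof -
        have "\<bar>- t\<bar> \<le> 1" "\<bar>t\<^sup>2 + r - 1/2\<bar> \<le> 2"
          unfolding abs_le_iff using rt t2 zero_le_power2[of t] by (simp_all, linarith?)
        then show ?thesis unfolding abs_mult using e(1) unfolding c_def
          by (intro add_mono mult_mono) auto
      qed
      also have "\<dots> < e" using e(1) unfolding c_def by simp
      finally show "?p \<in> D" using e(2) by auto
    qed (use e c_def in auto)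
    then show ?thesis using 0 by simp
  qed
  obtain z where z: "z \<in> interior D" using D(2) by blast
  have "f w = 0" for w
  proof -
    obtain p where p: "\<And>t. poly p t = f (poly [:fst z, fst w - fst z:] t, poly [:snd z, snd w - snd z:] t)"
      by (rule poly2_compose_poly[OF f, of "[:fst z, fst w - fst z:]" 1 "[:snd z, snd w - snd z:]"]) auto
    have pt: "poly p t = f (z + t *\<^sub>R (w - z))" for t
      unfolding p by (simp add: plus_prod_def scaleR_prod_def)
    have "((\<lambda>t. z + t *\<^sub>R (w - z)) \<longlongrightarrow> z + 0 *\<^sub>R (w - z)) (at_right 0)"
      by (intro tendsto_intros)
    then have "\<forall>\<^sub>F t in at_right 0. z + t *\<^sub>R (w - z) \<in> interior D"
      using z by (intro topological_tendstoD) auto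
    then obtain b where b: "0 < b" "\<And>t. 0 < t \<Longrightarrow> t < b \<Longrightarrow> z + t *\<^sub>R (w - z) \<in> interior D"
      unfolding eventually_at_right_field by auto
    have "{0<..<b} \<subseteq> {t. poly p t = 0}"
      using int0[OF b(2)] pt by (intro subsetI) simp
    moreover have "infinite {0<..<b}" using b(1) by simp
    ultimately have "infinite {t. poly p t = 0}" using finite_subset by blast
    then have "p = 0" using poly_roots_finite by blast
    then show ?thesis using pt[of 1] by simp
  qed
  then show ?thesis by blast
qed

lemma gram_schmidt:
  assumes D: "compact D" "interior D \<noteq> {}" and "finite G" "G \<subseteq> poly2 n"
  shows "\<exists>\<Phi>. finite \<Phi> \<and> \<Phi> \<subseteq> poly2 n \<and>
    (\<forall>\<phi>\<in>\<Phi>. \<forall>\<psi>\<in>\<Phi>. L2_inner D \<phi> \<psi> = (if \<phi> = \<psi> then 1 else 0)) \<and>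
    (\<forall>g\<in>G. \<exists>a. g = (\<lambda>z. \<Sum>\<phi>\<in>\<Phi>. a \<phi> * \<phi> z))"
  using assms(3,4)
proof (induction G rule: finite_induct)
  case empty
  then show ?case by (intro exI[of _ "{}"]) auto
next
  case (insert g G)
  have "G \<subseteq> poly2 n" using insert.prems by simp
  from insert.IH[OF this] obtain \<Phi> where \<Phi>': "finite \<Phi>" "\<Phi> \<subseteq> poly2 n"
    "\<forall>\<phi>\<in>\<Phi>. \<forall>\<psi>\<in>\<Phi>. L2_inner D \<phi> \<psi> = (if \<phi> = \<psi> then 1 else 0)"
    "\<forall>g\<in>G. \<exists>a. g = (\<lambda>z. \<Sum>\<phi>\<in>\<Phi>. a \<phi> * \<phi> z)"
    by (elim exE conjE)
  note \<Phi> = \<Phi>'(1,2) \<Phi>'(3)[rule_format] \<Phi>'(4)[rule_format]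
  have g: "g \<in> poly2 n" using insert.prems by simp
  define s where "s = (\<lambda>z. \<Sum>\<phi>\<in>\<Phi>. L2_inner D g \<phi> * \<phi> z)"
  define r where "r = (\<lambda>z. g z + (- 1) * s z)"
  have s: "s \<in> poly2 n" unfolding s_def using \<Phi>(2) by (intro poly2_sum poly2_scale) auto
  have r: "r \<in> poly2 n" unfolding r_def by (intro poly2_add poly2_scale g s)
  have r_orth: "L2_inner D r \<phi> = 0" if "\<phi> \<in> \<Phi>" for \<phi>
  proof -
    have "L2_inner D s \<phi> = (\<Sum>\<psi>\<in>\<Phi>. L2_inner D g \<psi> * L2_inner D \<psi> \<phi>)"
      unfolding s_def using \<Phi>(2) that by (intro L2_inner_sum_left[OF D(1)]) auto
    also have "\<dots> = (\<Sum>\<psi>\<in>\<Phi>. if \<psi> = \<phi> then L2_inner D g \<psi> else 0)"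
      using \<Phi>(3) that by (intro sum.cong) auto
    also have "\<dots> = L2_inner D g \<phi>" using \<Phi>(1) that by simp
    finally show ?thesis unfolding r_def
      using L2_inner_add_left[OF D(1) g poly2_scale[OF s, of "-1"], of \<phi>] \<Phi>(2) that
        L2_inner_scale_left[of D "-1" s \<phi>]
      by (simp add: subset_iff)
  qed
  show ?case
  proof (cases "L2_inner D r r = 0")
    case True
    then have "r = (\<lambda>z. 0)" using poly2_eq_0_if_L2_inner_eq_0[OF D r] by simp
    then have "g = (\<lambda>z. \<Sum>\<phi>\<in>\<Phi>. L2_inner D g \<phi> * \<phi> z)"
      unfolding r_def s_def by (auto simp: fun_eq_iff)
    then have "\<exists>a. g = (\<lambda>z. \<Sum>\<phi>\<in>\<Phi>. a \<phi> * \<phi> z)" by blast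
    with \<Phi>'(4) have "\<forall>h\<in>insert g G. \<exists>a. h = (\<lambda>z. \<Sum>\<phi>\<in>\<Phi>. a \<phi> * \<phi> z)" by blast
    then show ?thesis using \<Phi>'(1-3) by blast
  next
    case False
    define q where "q = sqrt (L2_inner D r r)"
    have q: "0 < q" "q * q = L2_inner D r r" using False L2_inner_nonneg[of D r] unfolding q_def by auto
    define \<psi> where "\<psi> = (\<lambda>z. (1 / q) * r z)"
    have \<psi>: "\<psi> \<in> poly2 n" unfolding \<psi>_def by (rule poly2_scale[OF r])
    have \<psi>1: "L2_inner D \<psi> \<psi> = 1"
    proof -
      have "L2_inner D \<psi> \<psi> = (1 / q) * L2_inner D \<psi> r"
        using L2_inner_scale_left[of D "1 / q" r \<psi>] L2_inner_commute[of D r \<psi>]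
        unfolding \<psi>_def[symmetric] by simp
      also have "L2_inner D \<psi> r = (1 / q) * (q * q)"
        using L2_inner_scale_left[of D "1 / q" r r] q(2) unfolding \<psi>_def[symmetric] by simp
      finally show ?thesis using q(1) by simp
    qed
    have \<psi>0: "L2_inner D \<psi> \<phi> = 0" "L2_inner D \<phi> \<psi> = 0" if "\<phi> \<in> \<Phi>" for \<phi>
      using r_orth[OF that] L2_inner_commute[of D \<phi> \<psi>] unfolding \<psi>_def L2_inner_scale_left by auto
    have nin: "\<psi> \<notin> \<Phi>" using \<psi>0 \<psi>1 by fastforce
    have "\<exists>a. h = (\<lambda>z. \<Sum>\<phi>\<in>insert \<psi> \<Phi>. a \<phi> * \<phi> z)" if h: "h \<in> insert g G" for h
    proof (cases "h = g")
      case True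
      have "g = (\<lambda>z. \<Sum>\<phi>\<in>insert \<psi> \<Phi>. ((L2_inner D g)(\<psi> := q)) \<phi> * \<phi> z)"
      proof
        fix z
        have "(\<Sum>\<phi>\<in>insert \<psi> \<Phi>. ((L2_inner D g)(\<psi> := q)) \<phi> * \<phi> z) = q * \<psi> z + s z"
          unfolding s_def using nin \<Phi>(1) by (auto intro!: sum.cong)
        also have "\<dots> = g z" using q unfolding \<psi>_def r_def by simp
        finally show "g z = (\<Sum>\<phi>\<in>insert \<psi> \<Phi>. ((L2_inner D g)(\<psi> := q)) \<phi> * \<phi> z)" ..
      qed
      then show ?thesis using True by blast
    next
      case False
      then obtain a where a: "h = (\<lambda>z. \<Sum>\<phi>\<in>\<Phi>. a \<phi> * \<phi> z)" using \<Phi>(4) h by blast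
      have "(\<Sum>\<phi>\<in>insert \<psi> \<Phi>. (a(\<psi> := 0)) \<phi> * \<phi> z) = (\<Sum>\<phi>\<in>\<Phi>. a \<phi> * \<phi> z)" for z
        using nin \<Phi>(1) by (auto intro!: sum.cong)
      then have "h = (\<lambda>z. \<Sum>\<phi>\<in>insert \<psi> \<Phi>. (a(\<psi> := 0)) \<phi> * \<phi> z)" unfolding a by simp
      then show ?thesis by blast
    qed
    then have 4: "\<forall>h\<in>insert g G. \<exists>a. h = (\<lambda>z. \<Sum>\<phi>\<in>insert \<psi> \<Phi>. a \<phi> * \<phi> z)" by blast
    have 3: "\<forall>\<phi>\<in>insert \<psi> \<Phi>. \<forall>\<omega>\<in>insert \<psi> \<Phi>. L2_inner D \<phi> \<omega> = (if \<phi> = \<omega> then 1 else 0)"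
    proof (intro ballI)
      fix \<phi> \<omega> assume "\<phi> \<in> insert \<psi> \<Phi>" "\<omega> \<in> insert \<psi> \<Phi>"
      then show "L2_inner D \<phi> \<omega> = (if \<phi> = \<omega> then 1 else 0)"
        using \<Phi>(3)[of \<phi> \<omega>] \<psi>0[of \<phi>] \<psi>0[of \<omega>] \<psi>1 nin
        by (cases "\<phi> = \<psi>"; cases "\<omega> = \<psi>"; simp)
    qed
    have "finite (insert \<psi> \<Phi>)" "insert \<psi> \<Phi> \<subseteq> poly2 n" using \<Phi>(1,2) \<psi> by simp_all
    with 3 4 show ?thesis by blast
  qed
qed

lemma orthonormal_basis_exists:
  assumes D: "compact D" "interior D \<noteq> {}"
  obtains \<Phi> where "orthonormal_basis n D \<Phi>"
proof -
  let ?m = "\<lambda>(i, j) z. fst z ^ i * snd z ^ j :: real"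
  define G where "G = ?m ` (SIGMA i:{..n}. {..n - i})"
  have G: "G \<subseteq> poly2 n" unfolding G_def by (auto intro!: poly2_monomial)
  have fin: "finite G" unfolding G_def by auto
  from gram_schmidt[OF D fin G] obtain \<Phi> where \<Phi>: "finite \<Phi>" "\<Phi> \<subseteq> poly2 n"
    "\<forall>\<phi>\<in>\<Phi>. \<forall>\<psi>\<in>\<Phi>. L2_inner D \<phi> \<psi> = (if \<phi> = \<psi> then 1 else 0)"
    "\<forall>g\<in>G. \<exists>a. g = (\<lambda>z. \<Sum>\<phi>\<in>\<Phi>. a \<phi> * \<phi> z)"
    by (elim exE conjE)
  have "\<exists>a. f = (\<lambda>z. \<Sum>\<phi>\<in>\<Phi>. a \<phi> * \<phi> z)" if f: "f \<in> poly2 n" for f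
  proof -
    obtain c where c: "\<And>z. f z = (\<Sum>i\<le>n. \<Sum>j\<le>n - i. c i j * (fst z ^ i * snd z ^ j))"
      using poly2_expand[OF f] by blast
    define A where "A i j = (SOME a. ?m (i, j) = (\<lambda>z. \<Sum>\<phi>\<in>\<Phi>. a \<phi> * \<phi> z))" for i j
    have A: "fst z ^ i * snd z ^ j = (\<Sum>\<phi>\<in>\<Phi>. A i j \<phi> * \<phi> z)" if "i \<le> n" "j \<le> n - i" for i j z
    proof -
      have "?m (i, j) \<in> G" unfolding G_def using that by (intro imageI) auto
      from someI_ex[OF \<Phi>(4)[rule_format, OF this], folded A_def]
      have "?m (i, j) z = (\<Sum>\<phi>\<in>\<Phi>. A i j \<phi> * \<phi> z)" by (rule fun_cong)
      then show ?thesis by simp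
    qed
    have "f = (\<lambda>z. \<Sum>\<phi>\<in>\<Phi>. (\<Sum>i\<le>n. \<Sum>j\<le>n - i. c i j * A i j \<phi>) * \<phi> z)"
    proof
      fix z
      have "f z = (\<Sum>i\<le>n. \<Sum>j\<le>n - i. \<Sum>\<phi>\<in>\<Phi>. (c i j * A i j \<phi>) * \<phi> z)"
        unfolding c by (intro sum.cong refl) (simp add: A sum_distrib_left mult.assoc)
      also have "\<dots> = (\<Sum>i\<le>n. \<Sum>\<phi>\<in>\<Phi>. (\<Sum>j\<le>n - i. c i j * A i j \<phi>) * \<phi> z)"
        unfolding sum_distrib_right by (intro sum.cong refl) (rule sum.swap)
      also have "\<dots> = (\<Sum>\<phi>\<in>\<Phi>. (\<Sum>i\<le>n. \<Sum>j\<le>n - i. c i j * A i j \<phi>) * \<phi> z)"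
        unfolding sum_distrib_right[of _ "{..n}"] by (rule sum.swap)
      finally show "f z = (\<Sum>\<phi>\<in>\<Phi>. (\<Sum>i\<le>n. \<Sum>j\<le>n - i. c i j * A i j \<phi>) * \<phi> z)" .
    qed
    then show ?thesis by (rule exI[of _ "\<lambda>\<phi>. \<Sum>i\<le>n. \<Sum>j\<le>n - i. c i j * A i j \<phi>"])
  qed
  then have "orthonormal_basis n D \<Phi>"
    unfolding orthonormal_basis_def by (intro conjI \<Phi>(1-3)) (rule ballI)
  then show ?thesis by (rule that)
qed

lemma parseval_orthonormal_basis:
  assumes D: "compact D" and \<Phi>: "orthonormal_basis n D \<Phi>" and f: "f \<in> poly2 n"
  shows "L2_inner D f f = (\<Sum>\<phi>\<in>\<Phi>. (L2_inner D f \<phi>)\<^sup>2)"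
proof -
  have "f = (\<lambda>z. \<Sum>\<phi>\<in>\<Phi>. L2_inner D f \<phi> * \<phi> z)"
    using orthonormal_basis_expand[OF D \<Phi> f] by blast
  then have "L2_inner D f f = L2_inner D (\<lambda>z. \<Sum>\<phi>\<in>\<Phi>. L2_inner D f \<phi> * \<phi> z) f"
    by (rule arg_cong[where f = "\<lambda>g. L2_inner D g f"])
  also have "\<dots> = (\<Sum>\<phi>\<in>\<Phi>. L2_inner D f \<phi> * L2_inner D \<phi> f)"
    using \<Phi> f by (intro L2_inner_sum_left[OF D]) (auto simp: orthonormal_basis_def)
  also have "\<dots> = (\<Sum>\<phi>\<in>\<Phi>. (L2_inner D f \<phi>)\<^sup>2)"
    by (intro sum.cong refl) (metis L2_inner_commute power2_eq_square)
  finally show ?thesis .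
qed

lemma square_le_kernel:
  assumes D: "compact D" and \<Phi>: "orthonormal_basis n D \<Phi>" and f: "f \<in> poly2 n"
  shows "(f z)\<^sup>2 \<le> L2_inner D f f * (\<Sum>\<phi>\<in>\<Phi>. (\<phi> z)\<^sup>2)"
  unfolding parseval_orthonormal_basis[OF assms]
  by (subst orthonormal_basis_expand[OF assms]) (rule Cauchy_Schwarz_ineq_sum)

lemma christoffel_le_L2_inner:
  assumes D: "compact D" "interior D \<noteq> {}" and f: "f \<in> poly2 n" "f z = 1"
  shows "christoffel n D z \<le> L2_inner D f f"
proof -
  obtain \<Phi> where \<Phi>: "orthonormal_basis n D \<Phi>" using orthonormal_basis_exists[OF D] .
  define S where "S = (\<Sum>\<phi>\<in>\<Phi>. (\<phi> z)\<^sup>2)"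
  have 1: "1 \<le> L2_inner D f f * S"
    using square_le_kernel[OF D(1) \<Phi> f(1), of z] f(2) unfolding S_def by simp
  have "0 \<le> S" unfolding S_def by (intro sum_nonneg) auto
  with 1 have "0 < S" by (cases "S = 0") auto
  then show ?thesis using 1
    unfolding christoffel_eq[OF D(1) \<Phi>] S_def[symmetric] by (simp add: field_simps)
qed

text \<open>The reproducing kernel at \<open>z\<close> is the extremal polynomial, so it suffices to insert it into the hypothesis.\<close>

lemma inverse_le_christoffel:
  assumes D: "compact D" "interior D \<noteq> {}"
    and le: "\<And>f. f \<in> poly2 n \<Longrightarrow> (f z)\<^sup>2 \<le> K * L2_inner D f f"
  shows "inverse K \<le> christoffel n D z"
proof -
  obtain \<Phi> where \<Phi>: "orthonormal_basis n D \<Phi>" using orthonormal_basis_exists[OF D] .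
  define S where "S = (\<Sum>\<phi>\<in>\<Phi>. (\<phi> z)\<^sup>2)"
  have "1 \<le> L2_inner D (\<lambda>z. 1) (\<lambda>z. 1) * S"
    using square_le_kernel[OF D(1) \<Phi> poly2_const[of 1], of z] unfolding S_def by simp
  moreover have "0 \<le> S" unfolding S_def by (intro sum_nonneg) auto
  ultimately have S: "0 < S" by (cases "S = 0") auto
  define f where "f = (\<lambda>w. \<Sum>\<phi>\<in>\<Phi>. \<phi> z * \<phi> w)"
  have sub: "finite \<Phi>" "\<Phi> \<subseteq> poly2 n" using \<Phi> unfolding orthonormal_basis_def by auto
  have f: "f \<in> poly2 n" unfolding f_def using sub by (intro poly2_sum poly2_scale) auto
  have "L2_inner D f \<psi> = \<psi> z" if "\<psi> \<in> \<Phi>" for \<psi>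
  proof -
    have "L2_inner D f \<psi> = (\<Sum>\<phi>\<in>\<Phi>. \<phi> z * L2_inner D \<phi> \<psi>)"
      unfolding f_def using sub that by (intro L2_inner_sum_left[OF D(1)]) auto
    also have "\<dots> = (\<Sum>\<phi>\<in>\<Phi>. if \<phi> = \<psi> then \<phi> z else 0)"
      using \<Phi> that unfolding orthonormal_basis_def by (intro sum.cong) auto
    finally show ?thesis using sub that by simp
  qed
  then have "L2_inner D f f = S"
    unfolding parseval_orthonormal_basis[OF D(1) \<Phi> f] S_def by (intro sum.cong) auto
  moreover have "f z = S" unfolding f_def S_def by (simp add: power2_eq_square)
  ultimately have "S * S \<le> K * S" using le[OF f] by (simp add: power2_eq_square)
  then have "S \<le> K" using S by simp
  then show ?thesis unfolding christoffel_eq[OF D(1) \<Phi>] S_def[symmetric]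
    using S by (simp add: le_imp_inverse_le)
qed

section \<open>The power function and its tangents\<close>

text \<open>The weighted inequality between arithmetic and geometric mean; it replaces all differentiation below.\<close>

lemma powr_le_tangent_one:
  fixes x :: real
  assumes "0 \<le> x" "0 \<le> \<beta>" "\<beta> \<le> 1"
  shows "x powr \<beta> \<le> 1 + \<beta> * (x - 1)"
proof (cases "x = 0")
  case False
  then show ?thesis
    using Youngs_inequality_0[of \<beta> "1 - \<beta>" x 1] assms by (simp add: algebra_simps)
qed (use assms in simp)

text \<open>Young's inequality in the form that describes the supporting lines of the ball: summed over both
coordinates, with \<open>(\<bar>q\<^sub>1\<bar>, \<bar>q\<^sub>2\<bar>)\<close> on the boundary, it bounds the linear form with coefficients
\<open>\<bar>q\<^sub>i\<bar>\<close> raised to \<open>a - 1\<close> by one on the ball.\<close>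

lemma mult_powr_le:
  fixes w q :: real
  assumes "1 < a"
  shows "\<bar>w\<bar> * \<bar>q\<bar> powr (a - 1) \<le> \<bar>w\<bar> powr a / a + (1 - 1 / a) * \<bar>q\<bar> powr a"
proof -
  have "\<bar>w\<bar> * \<bar>q\<bar> powr (a - 1) \<le> \<bar>w\<bar> powr a / a + (\<bar>q\<bar> powr (a - 1)) powr (a / (a - 1)) / (a / (a - 1))"
    using assms by (intro Youngs_inequality) (auto simp: field_simps)
  also have "(\<bar>q\<bar> powr (a - 1)) powr (a / (a - 1)) = \<bar>q\<bar> powr a"
    using assms by (simp add: powr_powr)
  also have "\<dots> / (a / (a - 1)) = (1 - 1 / a) * \<bar>q\<bar> powr a"
    using assms by (simp add: field_simps)
  finally show ?thesis .
qed

lemma powr_ge_tangent: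
  fixes q h :: real
  assumes "1 < a"
  shows "\<bar>q\<bar> powr a + a * (sgn q * \<bar>q\<bar> powr (a - 1)) * h \<le> \<bar>q + h\<bar> powr a"
proof -
  have "sgn q * (q + h) \<le> \<bar>q + h\<bar>"
    by (auto simp: sgn_if)
  then have "(sgn q * (q + h)) * \<bar>q\<bar> powr (a - 1) \<le> \<bar>q + h\<bar> * \<bar>q\<bar> powr (a - 1)"
    by (intro mult_right_mono) auto
  also have "\<dots> \<le> \<bar>q + h\<bar> powr a / a + (1 - 1 / a) * \<bar>q\<bar> powr a"
    by (rule mult_powr_le[OF assms])
  finally have "a * ((sgn q * (q + h)) * \<bar>q\<bar> powr (a - 1))
      \<le> a * (\<bar>q + h\<bar> powr a / a + (1 - 1 / a) * \<bar>q\<bar> powr a)"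
    using assms by (intro mult_left_mono) auto
  also have "\<dots> = \<bar>q + h\<bar> powr a + (a - 1) * \<bar>q\<bar> powr a"
    using assms by (simp add: field_simps)
  finally have *: "a * ((sgn q * (q + h)) * \<bar>q\<bar> powr (a - 1)) \<le> \<bar>q + h\<bar> powr a + (a - 1) * \<bar>q\<bar> powr a" .
  have "sgn q * q * \<bar>q\<bar> powr (a - 1) = \<bar>q\<bar> powr a"
    using powr_mult_base[of "\<bar>q\<bar>" "a - 1"] by (cases "0 \<le> q") (auto simp: sgn_if)
  with * show ?thesis by (simp add: algebra_simps)
qed

text \<open>Split off one factor \<open>1 + h\<close> and bound the remaining concave power by its tangent at one.\<close>

lemma powr_le_tangent_quadratic_one:
  fixes h :: real
  assumes "1 < a" "a < 2"
  shows "\<bar>1 + h\<bar> powr a \<le> 1 + a * h + 3 * h\<^sup>2"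
proof (cases "-1 \<le> h")
  case True
  have "(1 + h) powr a = (1 + h) * (1 + h) powr (a - 1)"
    using powr_mult_base[of "1 + h" "a - 1"] True by simp
  also have "\<dots> \<le> (1 + h) * (1 + (a - 1) * h)"
    using powr_le_tangent_one[of "1 + h" "a - 1"] assms True by (intro mult_left_mono) auto
  also have "\<dots> = 1 + a * h + (a - 1) * h\<^sup>2" by (simp add: algebra_simps power2_eq_square)
  also have "\<dots> \<le> 1 + a * h + 3 * h\<^sup>2"
    using assms by (intro add_left_mono mult_right_mono) auto
  finally show ?thesis using True by simp
next
  case False
  have "\<bar>1 + h\<bar> powr a \<le> \<bar>h\<bar> powr a"
    using False assms by (intro powr_mono2) auto
  also have "\<dots> \<le> \<bar>h\<bar> powr 2" using False assms by (intro powr_mono) auto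
  also have "\<dots> = h\<^sup>2" using False by (simp add: powr_numeral)
  finally have "\<bar>1 + h\<bar> powr a \<le> h\<^sup>2" .
  moreover have "0 \<le> (- h) * (- h - 1)" using False by (intro mult_nonneg_nonneg) auto
  then have "- h \<le> h\<^sup>2" by (simp add: algebra_simps power2_eq_square)
  moreover have "a * (- h) \<le> 2 * (- h)" using False assms by (intro mult_right_mono) auto
  ultimately show ?thesis by linarith
qed

lemma powr_le_tangent_quadratic:
  fixes p h :: real
  assumes "1 < a" "a < 2" "p \<noteq> 0"
  shows "\<bar>p + h\<bar> powr a \<le> \<bar>p\<bar> powr a + a * (sgn p * \<bar>p\<bar> powr (a - 1)) * h + 3 * \<bar>p\<bar> powr (a - 2) * h\<^sup>2"
proof -
  have ap: "0 < \<bar>p\<bar>" using assms by simp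
  have "\<bar>p + h\<bar> = \<bar>p\<bar> * \<bar>1 + h / p\<bar>"
    using assms(3) by (simp flip: abs_mult add: algebra_simps)
  then have "\<bar>p + h\<bar> powr a = \<bar>p\<bar> powr a * \<bar>1 + h / p\<bar> powr a"
    by (simp add: powr_mult)
  also have "\<dots> \<le> \<bar>p\<bar> powr a * (1 + a * (h / p) + 3 * (h / p)\<^sup>2)"
    using assms by (intro mult_left_mono powr_le_tangent_quadratic_one) auto
  also have "\<dots> = \<bar>p\<bar> powr a + a * (\<bar>p\<bar> powr a / p) * h + 3 * (\<bar>p\<bar> powr a / \<bar>p\<bar>\<^sup>2) * h\<^sup>2"
    by (simp add: algebra_simps power_divide)
  also have "\<bar>p\<bar> powr a / p = sgn p * \<bar>p\<bar> powr (a - 1)"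
    using ap by (cases "p > 0") (auto simp: powr_diff sgn_if field_simps)
  also have "\<bar>p\<bar> powr a / \<bar>p\<bar>\<^sup>2 = \<bar>p\<bar> powr (a - 2)"
    using ap by (simp add: powr_diff powr_numeral)
  finally show ?thesis .
qed

text \<open>For \<open>\<bar>h\<bar> \<le> \<bar>p\<bar>\<close> this follows from the quadratic bound, which it replaces near \<open>p = 0\<close>, where the second
derivative of the power function is unbounded.\<close>

lemma powr_le_tangent_powr:
  fixes p h :: real
  assumes "1 < a" "a < 2"
  shows "\<bar>p + h\<bar> powr a \<le> \<bar>p\<bar> powr a + a * (sgn p * \<bar>p\<bar> powr (a - 1)) * h + 6 * \<bar>h\<bar> powr a"
proof (cases "\<bar>h\<bar> \<le> \<bar>p\<bar>")
  case True
  show ?thesis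
  proof (cases "h = 0")
    case False
    then have p: "p \<noteq> 0" using True by auto
    have "\<bar>p\<bar> powr (a - 2) * h\<^sup>2 \<le> \<bar>h\<bar> powr (a - 2) * \<bar>h\<bar> powr 2"
      using True False assms by (intro mult_mono powr_mono2') (auto simp: powr_numeral)
    also have "\<dots> = \<bar>h\<bar> powr a"
      using powr_add[of "\<bar>h\<bar>" "a - 2" 2] by simp
    also have "\<dots> \<le> 2 * \<bar>h\<bar> powr a" by simp
    finally show ?thesis using powr_le_tangent_quadratic[OF assms p, of h] by simp
  qed simp
next
  case False
  have "\<bar>p + h\<bar> powr a \<le> (2 * \<bar>h\<bar>) powr a" using False assms by (intro powr_mono2) auto
  also have "\<dots> = 2 powr a * \<bar>h\<bar> powr a" by (simp add: powr_mult)
  also have "\<dots> \<le> 2 powr 2 * \<bar>h\<bar> powr a" using assms by (intro mult_right_mono powr_mono) auto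
  also have "\<dots> = 4 * \<bar>h\<bar> powr a" by simp
  finally have 1: "\<bar>p + h\<bar> powr a \<le> 4 * \<bar>h\<bar> powr a" .
  have "\<bar>a * (sgn p * \<bar>p\<bar> powr (a - 1)) * h\<bar> = a * (\<bar>sgn p\<bar> * \<bar>p\<bar> powr (a - 1) * \<bar>h\<bar>)"
    using assms by (simp add: abs_mult)
  also have "\<dots> \<le> 2 * (1 * \<bar>h\<bar> powr (a - 1) * \<bar>h\<bar>)"
    using assms False by (intro mult_mono powr_mono2) (auto simp: sgn_if)
  also have "\<dots> = 2 * \<bar>h\<bar> powr a"
    using powr_mult_base[of "\<bar>h\<bar>" "a - 1"] by (simp add: mult.commute)
  finally show ?thesis using 1 powr_ge_zero[of "\<bar>p\<bar>" a] by linarith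
qed

text \<open>Applying the tangent inequality twice, at the midpoint \<open>1 + h / 2\<close> and at one, leaves the increment \<open>D\<close> of the
derivative over half of the interval. That increment is at least of order \<open>\<bar>h\<bar>\<close> times
\<open>1 + \<bar>h\<bar>\<close> raised to \<open>a - 2\<close>; for negative \<open>h\<close> the midpoint may lie on the other side of
zero, which is the reason for the case distinctions.\<close>

lemma powr_ge_tangent_quadratic_one:
  fixes h :: real
  assumes "1 < a" "a < 2"
  shows "1 + a * h + (a - 1) / 4 * h\<^sup>2 * (1 + \<bar>h\<bar>) powr (a - 2) \<le> \<bar>1 + h\<bar> powr a"
proof -
  define S where "S = \<bar>h\<bar> / 2"
  define q where "q = 1 + h / 2"
  define D where "D = sgn q * \<bar>q\<bar> powr (a - 1) - 1"
  have "\<bar>q\<bar> powr a + a * (sgn q * \<bar>q\<bar> powr (a - 1)) * (h / 2) \<le> \<bar>1 + h\<bar> powr a"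
    using powr_ge_tangent[OF assms(1), of q "h / 2"] unfolding q_def by (simp add: add.assoc)
  moreover have "1 + a * (h / 2) \<le> \<bar>q\<bar> powr a"
    using powr_ge_tangent[OF assms(1), of 1 "h / 2"] unfolding q_def by simp
  ultimately have 1: "1 + a * h + a * (h / 2 * D) \<le> \<bar>1 + h\<bar> powr a"
    unfolding D_def by (simp add: algebra_simps)
  have S0: "0 \<le> S" unfolding S_def by simp
  have P: "(1 + \<bar>h\<bar>) powr (a - 2) \<le> (1 + S) powr (a - 2)"
    unfolding S_def using assms by (intro powr_mono2') auto
  have P1: "(1 + S) powr (a - 2) \<le> 1"
    using S0 assms powr_mono2'[of "a - 2" 1 "1 + S"] by simp
  have key: "(a - 1) * S\<^sup>2 * (1 + S) powr (a - 2) \<le> a * (h / 2 * D)"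
  proof (cases "0 \<le> h")
    case True
    then have tS: "h / 2 = S" and q: "q = 1 + S" unfolding S_def q_def by auto
    have "(1 + S) powr (2 - a) \<le> (1 + S) - (a - 1) * S"
      using powr_le_tangent_one[of "1 + S" "2 - a"] S0 assms by (simp add: algebra_simps)
    then have "(1 + S) powr (a - 2) * (1 + S) powr (2 - a) \<le> (1 + S) powr (a - 2) * ((1 + S) - (a - 1) * S)"
      by (intro mult_left_mono) auto
    also have "(1 + S) powr (a - 2) * (1 + S) powr (2 - a) = 1"
      using S0 by (simp flip: powr_add)
    also have "(1 + S) powr (a - 2) * ((1 + S) - (a - 1) * S)
       = (1 + S) * (1 + S) powr (a - 2) - (a - 1) * S * (1 + S) powr (a - 2)" by (simp add: algebra_simps)
    also have "(1 + S) * (1 + S) powr (a - 2) = (1 + S) powr (a - 1)"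
      using powr_mult_base[of "1 + S" "a - 2"] S0 by simp
    finally have "(a - 1) * S * (1 + S) powr (a - 2) \<le> D"
      unfolding D_def q using S0 by (simp add: sgn_if)
    then have "S * ((a - 1) * S * (1 + S) powr (a - 2)) \<le> S * D" using S0 by (intro mult_left_mono)
    then have a: "(a - 1) * S\<^sup>2 * (1 + S) powr (a - 2) \<le> S * D" by (simp add: power2_eq_square mult_ac)
    moreover have "0 \<le> (a - 1) * S\<^sup>2 * (1 + S) powr (a - 2)" using assms by simp
    ultimately have "1 * (S * D) \<le> a * (S * D)" using assms by (intro mult_right_mono) linarith+
    with a show ?thesis unfolding tS by linarith
  next
    case False
    then have tS: "h / 2 = - S" and q: "q = 1 - S" and Spos: "0 < S" unfolding S_def q_def by auto
    have b: "(a - 1) / a * S * (1 + S) powr (a - 2) \<le> - D"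
    proof (cases "S \<le> 1")
      case True
      have "sgn q * \<bar>q\<bar> powr (a - 1) \<le> \<bar>q\<bar> powr (a - 1)"
        by (auto simp: sgn_if)
      also have "\<bar>q\<bar> powr (a - 1) \<le> 1 - (a - 1) * S"
        using powr_le_tangent_one[of "1 - S" "a - 1"] assms True unfolding q by (simp add: algebra_simps)
      finally have "(a - 1) * S \<le> - D" unfolding D_def by simp
      moreover have "(a - 1) / a * S * (1 + S) powr (a - 2) \<le> (a - 1) / 1 * S * 1"
        using assms S0 P1 by (intro mult_mono divide_left_mono) auto
      ultimately show ?thesis by simp
    next
      case False
      have D: "- D = 1 + (S - 1) powr (a - 1)" unfolding D_def q using False by (simp add: sgn_if)
      have "(1 + S) powr (a - 2) \<le> S powr (a - 2)" using assms Spos by (intro powr_mono2') auto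
      then have "(a - 1) / a * S * (1 + S) powr (a - 2) \<le> (1/2) * S * S powr (a - 2)"
        using assms S0 by (intro mult_mono) (auto simp: field_simps)
      also have "\<dots> = (1/2) * S powr (a - 1)"
        using powr_mult_base[of S "a - 2"] Spos by simp
      also have "\<dots> \<le> - D"
      proof (cases "S \<le> 2")
        case True
        have "S powr (a - 1) \<le> S powr 1" using assms False by (intro powr_mono) auto
        then have "S powr (a - 1) \<le> 2" using True Spos by simp
        then show ?thesis unfolding D using powr_ge_zero[of "S - 1" "a - 1"] by linarith
      next
        case False
        have "(1/2) * S powr (a - 1) \<le> (1/2) powr (a - 1) * S powr (a - 1)"
          using powr_mono'[of "a - 1" 1 "1/2::real"] assms by (intro mult_right_mono) auto
        also have "\<dots> = (1/2 * S) powr (a - 1)" by (rule powr_mult[symmetric])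
        also have "\<dots> \<le> (S - 1) powr (a - 1)" using assms False by (intro powr_mono2) auto
        finally show ?thesis unfolding D by simp
      qed
      finally show ?thesis .
    qed
    then have "(a * S) * ((a - 1) / a * S * (1 + S) powr (a - 2)) \<le> (a * S) * (- D)"
      using assms S0 by (intro mult_left_mono) auto
    then show ?thesis unfolding tS using assms by (simp add: power2_eq_square mult_ac)
  qed
  have "(a - 1) / 4 * h\<^sup>2 * (1 + \<bar>h\<bar>) powr (a - 2) = (a - 1) * S\<^sup>2 * (1 + \<bar>h\<bar>) powr (a - 2)"
    unfolding S_def by (simp add: power_divide)
  also have "\<dots> \<le> (a - 1) * S\<^sup>2 * (1 + S) powr (a - 2)"
    using assms P by (intro mult_left_mono) auto
  finally show ?thesis using key 1 by linarith
qed

lemma powr_ge_tangent_quadratic: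
  fixes p h :: real
  assumes "1 < a" "a < 2" "0 \<le> p"
  shows "p powr a + a * p powr (a - 1) * h + (a - 1) / 4 * h\<^sup>2 * (p + \<bar>h\<bar>) powr (a - 2) \<le> \<bar>p + h\<bar> powr a"
proof (cases "p = 0")
  case True
  have "h\<^sup>2 * \<bar>h\<bar> powr (a - 2) = \<bar>h\<bar> powr a"
    using powr_add[of "\<bar>h\<bar>" "a - 2" 2] by (simp add: mult.commute)
  then have "(a - 1) / 4 * h\<^sup>2 * \<bar>h\<bar> powr (a - 2) = (a - 1) / 4 * \<bar>h\<bar> powr a"
    by (simp only: mult.assoc)
  also have "\<dots> \<le> 1 * \<bar>h\<bar> powr a" using assms by (intro mult_right_mono) auto
  finally show ?thesis using True by simp
next
  case False
  then have p: "0 < p" using assms by simp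
  have *: "p + \<bar>h\<bar> = p * (1 + \<bar>h / p\<bar>)" using p by (simp add: algebra_simps)
  have "p powr a * (1 + a * (h / p) + (a - 1) / 4 * (h / p)\<^sup>2 * (1 + \<bar>h / p\<bar>) powr (a - 2))
      \<le> p powr a * \<bar>1 + h / p\<bar> powr a"
    using assms by (intro mult_left_mono powr_ge_tangent_quadratic_one) auto
  also have "\<dots> = (p * \<bar>1 + h / p\<bar>) powr a" using p by (simp add: powr_mult)
  also have "p * \<bar>1 + h / p\<bar> = \<bar>p + h\<bar>"
  proof -
    have "p * \<bar>1 + h / p\<bar> = \<bar>p * (1 + h / p)\<bar>" using p by (simp add: abs_mult)
    also have "p * (1 + h / p) = p + h" using p by (simp add: field_simps)
    finally show ?thesis .
  qed
  also have "p powr a * (1 + a * (h / p) + (a - 1) / 4 * (h / p)\<^sup>2 * (1 + \<bar>h / p\<bar>) powr (a - 2))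
     = p powr a + a * (p powr a / p) * h + (a - 1) / 4 * h\<^sup>2 * ((p powr a / p\<^sup>2) * (1 + \<bar>h / p\<bar>) powr (a - 2))"
    by (simp add: algebra_simps power_divide)
  also have "p powr a / p = p powr (a - 1)" using p by (simp add: powr_diff)
  also have "p powr a / p\<^sup>2 = p powr (a - 2)" using p by (simp add: powr_diff powr_numeral)
  also have "p powr (a - 2) * (1 + \<bar>h / p\<bar>) powr (a - 2) = (p + \<bar>h\<bar>) powr (a - 2)"
    unfolding * using p by (simp add: powr_mult)
  finally show ?thesis .
qed

section \<open>The ball and the depth of points on its chords\<close>

lemma lball_iff: "(x, y) \<in> lball \<alpha> \<longleftrightarrow> \<bar>x\<bar> powr \<alpha> + \<bar>y\<bar> powr \<alpha> \<le> 1"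
  unfolding lball_def by simp

lemma continuous_lball_gauge:
  assumes "0 < \<alpha>"
  shows "continuous_on UNIV (\<lambda>z::real \<times> real. \<bar>fst z\<bar> powr \<alpha> + \<bar>snd z\<bar> powr \<alpha>)"
  using assms by (intro continuous_intros continuous_on_powr') auto

lemma compact_lball:
  assumes "0 < \<alpha>"
  shows "compact (lball \<alpha>)"
proof -
  have "closed {z::real \<times> real. \<bar>fst z\<bar> powr \<alpha> + \<bar>snd z\<bar> powr \<alpha> \<le> 1}"
    by (intro closed_Collect_le continuous_lball_gauge assms) auto
  moreover have eq: "lball \<alpha> = {z. \<bar>fst z\<bar> powr \<alpha> + \<bar>snd z\<bar> powr \<alpha> \<le> 1}"
    unfolding lball_def by auto
  moreover have "lball \<alpha> \<subseteq> cbox (-1, -1) (1, 1)"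
  proof
    fix z assume z: "z \<in> lball \<alpha>"
    have le1: "\<bar>r\<bar> \<le> 1" if "\<bar>r\<bar> powr \<alpha> \<le> 1" for r :: real
    proof (rule ccontr)
      assume "\<not> \<bar>r\<bar> \<le> 1"
      then have "1 powr \<alpha> < \<bar>r\<bar> powr \<alpha>" using assms by (intro powr_less_mono2) auto
      with that show False by simp
    qed
    have "\<bar>fst z\<bar> powr \<alpha> \<le> 1" "\<bar>snd z\<bar> powr \<alpha> \<le> 1"
      using z powr_ge_zero[of "\<bar>fst z\<bar>" \<alpha>] powr_ge_zero[of "\<bar>snd z\<bar>" \<alpha>] unfolding eq mem_Collect_eq
      by linarith+
    then have "\<bar>fst z\<bar> \<le> 1" "\<bar>snd z\<bar> \<le> 1" by (auto intro: le1)
    then show "z \<in> cbox (-1, -1) (1, 1)" by (cases z) (auto simp: abs_le_iff)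
  qed
  then have "bounded (lball \<alpha>)" using bounded_cbox bounded_subset by blast
  ultimately show ?thesis by (simp add: compact_eq_bounded_closed)
qed

lemma frontier_lball_iff:
  assumes "0 < \<alpha>"
  shows "(x, y) \<in> frontier (lball \<alpha>) \<longleftrightarrow> \<bar>x\<bar> powr \<alpha> + \<bar>y\<bar> powr \<alpha> = 1"
proof -
  have fr: "frontier (lball \<alpha>) = lball \<alpha> - interior (lball \<alpha>)"
    using compact_lball[OF assms] by (simp add: frontier_def compact_imp_closed)
  have "open {z::real \<times> real. \<bar>fst z\<bar> powr \<alpha> + \<bar>snd z\<bar> powr \<alpha> < 1}"
    by (intro open_Collect_less continuous_lball_gauge assms) auto
  then have int: "{z. \<bar>fst z\<bar> powr \<alpha> + \<bar>snd z\<bar> powr \<alpha> < 1} \<subseteq> interior (lball \<alpha>)"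
    by (intro interior_maximal) (auto simp: lball_def)
  show ?thesis
  proof
    assume "(x, y) \<in> frontier (lball \<alpha>)"
    then have "(x, y) \<in> lball \<alpha>" "(x, y) \<notin> {z. \<bar>fst z\<bar> powr \<alpha> + \<bar>snd z\<bar> powr \<alpha> < 1}"
      using int unfolding fr by blast+
    then show "\<bar>x\<bar> powr \<alpha> + \<bar>y\<bar> powr \<alpha> = 1" by (simp add: lball_iff)
  next
    assume 1: "\<bar>x\<bar> powr \<alpha> + \<bar>y\<bar> powr \<alpha> = 1"
    have "(x, y) \<notin> interior (lball \<alpha>)"
    proof
      assume i: "(x, y) \<in> interior (lball \<alpha>)"
      have "((\<lambda>s. (x, y) + s *\<^sub>R (x, y)) \<longlongrightarrow> (x, y) + 0 *\<^sub>R (x, y)) (at_right 0)"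
        by (intro tendsto_intros)
      then have "\<forall>\<^sub>F s in at_right 0. (x, y) + s *\<^sub>R (x, y) \<in> interior (lball \<alpha>)"
        using i by (intro topological_tendstoD) auto
      then obtain c where c: "0 < c" "\<And>s. 0 < s \<Longrightarrow> s < c \<Longrightarrow> (x, y) + s *\<^sub>R (x, y) \<in> interior (lball \<alpha>)"
        unfolding eventually_at_right_field by auto
      define s where "s = c / 2"
      have s: "0 < s" "s < c" using c(1) unfolding s_def by auto
      have "((1 + s) * x, (1 + s) * y) \<in> lball \<alpha>"
        using c(2)[OF s] interior_subset by (auto simp: algebra_simps)
      then have "(1 + s) powr \<alpha> * (\<bar>x\<bar> powr \<alpha> + \<bar>y\<bar> powr \<alpha>) \<le> 1"
        using s(1) by (simp add: lball_iff abs_mult powr_mult distrib_left)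
      then have "(1 + s) powr \<alpha> \<le> 1" unfolding 1 by simp
      moreover have "1 powr \<alpha> < (1 + s) powr \<alpha>" using s(1) assms by (intro powr_less_mono2) auto
      ultimately show False by simp
    qed
    then show "(x, y) \<in> frontier (lball \<alpha>)" using 1 unfolding fr by (simp add: lball_iff)
  qed
qed

lemma interior_lball_nonempty:
  assumes "0 < \<alpha>"
  shows "interior (lball \<alpha>) \<noteq> {}"
proof -
  have "(0, 0) \<in> lball \<alpha>" "(0, 0) \<notin> frontier (lball \<alpha>)"
    by (simp_all add: frontier_lball_iff[OF assms] lball_iff)
  then show ?thesis by (auto simp: frontier_def closure_subset[THEN subsetD])
qed

text \<open>In the octant considered the second coordinate is bounded away from zero, so the boundary is singular only
through the first coordinate.\<close>

lemma upper_octant_bounds: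
  fixes x0 y0 :: real
  assumes "1 < \<alpha>" "\<alpha> < 2" "0 \<le> x0" "x0 \<le> y0" "x0 powr \<alpha> + y0 powr \<alpha> = 1"
  shows "1 / 2 \<le> y0" "y0 \<le> 1" "1 / 2 \<le> y0 powr (\<alpha> - 1)" "y0 powr (\<alpha> - 1) \<le> 1"
    "x0 powr (\<alpha> - 1) \<le> y0 powr (\<alpha> - 1)" "x0 powr \<alpha> \<le> 1 / 2" "x0 \<le> 1"
proof -
  have le: "x0 powr \<alpha> \<le> y0 powr \<alpha>" using assms by (intro powr_mono2) auto
  then show "x0 powr \<alpha> \<le> 1 / 2" using assms by linarith
  have y: "1 / 2 \<le> y0 powr \<alpha>" using le assms by linarith
  then have y0: "0 < y0" using assms by (cases "y0 = 0") auto
  show y1: "y0 \<le> 1"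
  proof (rule ccontr)
    assume "\<not> y0 \<le> 1"
    then have "1 powr \<alpha> < y0 powr \<alpha>" using assms by (intro powr_less_mono2) auto
    then show False using assms powr_ge_zero[of x0 \<alpha>] by simp
  qed
  have "y0 powr \<alpha> \<le> y0 powr 1" using assms y0 y1 by (intro powr_mono') auto
  then show y2: "1 / 2 \<le> y0" using y y0 by simp
  have "y0 powr 1 \<le> y0 powr (\<alpha> - 1)" using assms y0 y1 by (intro powr_mono') auto
  then show "1 / 2 \<le> y0 powr (\<alpha> - 1)" using y2 y0 by simp
  show "y0 powr (\<alpha> - 1) \<le> 1" using assms y0 y1 powr_mono2[of "\<alpha> - 1" y0 1] by simp
  show "x0 powr (\<alpha> - 1) \<le> y0 powr (\<alpha> - 1)" using assms by (intro powr_mono2) auto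
  show "x0 \<le> 1" using assms y1 by simp
qed

text \<open>The asserted order of magnitude of the half chord at depth \<open>t\<close>.\<close>

definition chord_scale :: "real \<Rightarrow> real \<Rightarrow> real \<Rightarrow> real" where
  "chord_scale \<alpha> t x0 = t powr (1/2) * (max t (x0 powr \<alpha>)) powr (1/\<alpha> - 1/2)"

text \<open>The two regimes: if \<open>t\<close> is below \<open>x0\<close> raised to \<open>\<alpha>\<close>, then the boundary looks like a parabola with curvature of
order \<open>x0\<close> raised to \<open>\<alpha> - 2\<close>, and otherwise like the graph of the power \<open>\<alpha>\<close> itself.\<close>

lemma chord_scale_facts:
  assumes "1 < \<alpha>" "\<alpha> < 2" "0 \<le> x0" "x0 \<le> 1" "0 < t" "t \<le> 1"
  shows "t powr (1/\<alpha>) \<le> chord_scale \<alpha> t x0" "(chord_scale \<alpha> t x0)\<^sup>2 \<le> t" "0 < chord_scale \<alpha> t x0"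
    "t \<le> x0 powr \<alpha> \<Longrightarrow> (chord_scale \<alpha> t x0)\<^sup>2 = t * x0 powr (2 - \<alpha>)"
    "x0 powr \<alpha> \<le> t \<Longrightarrow> chord_scale \<alpha> t x0 = t powr (1/\<alpha>)"
    "t \<le> t powr (1/\<alpha>)"
proof -
  define M where "M = max t (x0 powr \<alpha>)"
  have e0: "0 < 1/\<alpha> - 1/2" using assms by (simp add: field_simps)
  have M: "0 < M" "t \<le> M" "M \<le> 1"
    using assms powr_mono2[of \<alpha> x0 1] unfolding M_def by auto
  have c: "chord_scale \<alpha> t x0 = t powr (1/2) * M powr (1/\<alpha> - 1/2)" unfolding chord_scale_def M_def ..
  have tt: "t powr (1/2) * t powr (1/\<alpha> - 1/2) = t powr (1/\<alpha>)" using assms by (simp flip: powr_add)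
  have "t powr (1/2) * t powr (1/\<alpha> - 1/2) \<le> t powr (1/2) * M powr (1/\<alpha> - 1/2)"
    using M assms e0 by (intro mult_left_mono powr_mono2) auto
  then show "t powr (1/\<alpha>) \<le> chord_scale \<alpha> t x0" unfolding c tt .
  show "0 < chord_scale \<alpha> t x0" unfolding c using M assms by simp
  have sq: "(chord_scale \<alpha> t x0)\<^sup>2 = t * M powr (2/\<alpha> - 1)"
  proof -
    have "(chord_scale \<alpha> t x0)\<^sup>2 = (t powr (1/2) * t powr (1/2)) * (M powr (1/\<alpha> - 1/2) * M powr (1/\<alpha> - 1/2))"
      unfolding c power2_eq_square by (simp add: mult_ac)
    also have "\<dots> = t * M powr (2/\<alpha> - 1)" using assms M by (simp flip: powr_add)
    finally show ?thesis .
  qed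
  have "M powr (2/\<alpha> - 1) \<le> 1 powr (2/\<alpha> - 1)" using M e0 by (intro powr_mono2) auto
  then show "(chord_scale \<alpha> t x0)\<^sup>2 \<le> t" unfolding sq using assms mult_left_le[of "M powr (2/\<alpha> - 1)" t] by simp
  show "(chord_scale \<alpha> t x0)\<^sup>2 = t * x0 powr (2 - \<alpha>)" if "t \<le> x0 powr \<alpha>"
  proof -
    have "M = x0 powr \<alpha>" unfolding M_def using that by simp
    then have "M powr (2/\<alpha> - 1) = x0 powr (2 - \<alpha>)" using assms by (simp add: powr_powr right_diff_distrib)
    then show ?thesis unfolding sq by simp
  qed
  show "chord_scale \<alpha> t x0 = t powr (1/\<alpha>)" if "x0 powr \<alpha> \<le> t"
    unfolding chord_scale_def using that tt by (simp add: max_def)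
  have "t powr 1 \<le> t powr (1/\<alpha>)" using assms by (intro powr_mono') auto
  then show "t \<le> t powr (1/\<alpha>)" using assms by simp
qed

text \<open>Along the chord the linear part of the gauge decreases by \<open>\<alpha> t G\<close>. As long as the displacement is a small
multiple of the chord scale, the remainders in the two tangent inequalities do not consume that gain. The
condition on \<open>t\<close> makes the displacement along the normal negligible against the chord scale.\<close>

lemma chord_point_in_lball:
  fixes x0 y0 :: real
  assumes \<alpha>: "1 < \<alpha>" "\<alpha> < 2" and z: "0 \<le> x0" "x0 \<le> y0" "x0 powr \<alpha> + y0 powr \<alpha> = 1"
    and t: "0 < t" "t powr (1 - 1/\<alpha>) \<le> 1/48" "t \<le> 1"
    and G: "1/2 \<le> G"
    and sm: "\<bar>p\<bar> \<le> t + 1/48 * chord_scale \<alpha> t x0" "\<bar>q\<bar> \<le> t + 1/48 * chord_scale \<alpha> t x0"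
    and depth: "x0 powr (\<alpha> - 1) * p + y0 powr (\<alpha> - 1) * q = - (t * G)"
  shows "(x0 + p, y0 + q) \<in> lball \<alpha>"
proof -
  define l where "l = chord_scale \<alpha> t x0"
  note B = upper_octant_bounds[OF \<alpha> z]
  note L = chord_scale_facts[OF \<alpha> z(1) B(7) t(1,3), folded l_def]
  have "t = t powr (1 - 1/\<alpha>) * t powr (1/\<alpha>)" using t(1) by (simp flip: powr_add)
  also have "\<dots> \<le> 1/48 * l" using t L(1) by (intro mult_mono) auto
  finally have "\<bar>p\<bar> \<le> 1/24 * l" "\<bar>q\<bar> \<le> 1/24 * l" using sm unfolding l_def by linarith+
  note s = this
  have "q\<^sup>2 \<le> (1/24 * l)\<^sup>2" using s(2) L(3) by (intro abs_le_square_iff[THEN iffD1]) auto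
  also have "\<dots> = 1/576 * l\<^sup>2" by (simp add: power_mult_distrib power_divide)
  also have "\<dots> \<le> 1/576 * t" using L(2) by simp
  finally have w2: "q\<^sup>2 \<le> 1/576 * t" .
  have y0: "y0 powr (\<alpha> - 2) \<le> 2"
  proof -
    have "y0 powr (\<alpha> - 2) \<le> (1/2) powr (\<alpha> - 2)" using B \<alpha> by (intro powr_mono2') auto
    also have "\<dots> \<le> (1/2) powr (-1)" using \<alpha> by (intro powr_mono') auto
    finally show ?thesis by (simp add: powr_minus_divide)
  qed
  have Y: "\<bar>y0 + q\<bar> powr \<alpha> \<le> y0 powr \<alpha> + \<alpha> * y0 powr (\<alpha> - 1) * q + t / 8"
  proof -
    have "3 * y0 powr (\<alpha> - 2) * q\<^sup>2 \<le> 3 * 2 * (1/576 * t)"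
      using y0 w2 by (intro mult_mono) auto
    then show ?thesis using powr_le_tangent_quadratic[OF \<alpha>, of y0 q] B(1) t(1) by simp
  qed
  have X: "\<bar>x0 + p\<bar> powr \<alpha> \<le> x0 powr \<alpha> + \<alpha> * x0 powr (\<alpha> - 1) * p + t / 4"
  proof (cases "t \<le> x0 powr \<alpha>")
    case True
    then have x0: "0 < x0" using t(1) z(1) by (cases "x0 = 0") auto
    have "p\<^sup>2 \<le> (1/24 * l)\<^sup>2" using s(1) L(3) by (intro abs_le_square_iff[THEN iffD1]) auto
    also have "\<dots> = 1/576 * (t * x0 powr (2 - \<alpha>))" using L(4)[OF True] by (simp add: power_mult_distrib power_divide)
    finally have "x0 powr (\<alpha> - 2) * p\<^sup>2 \<le> x0 powr (\<alpha> - 2) * (1/576 * (t * x0 powr (2 - \<alpha>)))"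
      by (intro mult_left_mono) auto
    also have "\<dots> = 1/576 * t * (x0 powr (\<alpha> - 2) * x0 powr (2 - \<alpha>))" by simp
    also have "x0 powr (\<alpha> - 2) * x0 powr (2 - \<alpha>) = 1" using x0 by (simp flip: powr_add)
    finally show ?thesis using powr_le_tangent_quadratic[OF \<alpha>, of x0 p] x0 t(1) by simp
  next
    case False
    have "\<bar>p\<bar> powr \<alpha> \<le> (1/24 * l) powr \<alpha>" using s(1) \<alpha> by (intro powr_mono2) auto
    also have "\<dots> = (1/24) powr \<alpha> * (t powr (1/\<alpha>)) powr \<alpha>"
      using L(5) False powr_mult[of "1/24" "t powr (1/\<alpha>)" \<alpha>] by simp
    also have "\<dots> = (1/24) powr \<alpha> * t" using t(1) \<alpha> by (simp add: powr_powr)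
    also have "\<dots> \<le> (1/24) powr 1 * t" using t(1) \<alpha> by (intro mult_right_mono powr_mono') auto
    finally have "6 * \<bar>p\<bar> powr \<alpha> \<le> t / 4" by simp
    moreover have "sgn x0 * x0 powr (\<alpha> - 1) = x0 powr (\<alpha> - 1)" using z(1) by (auto simp: sgn_if)
    ultimately show ?thesis
      using powr_le_tangent_powr[OF \<alpha>, of x0 p] abs_of_nonneg[OF z(1)] by (simp only:)
  qed
  have "\<bar>x0 + p\<bar> powr \<alpha> + \<bar>y0 + q\<bar> powr \<alpha> \<le> 1 + \<alpha> * (x0 powr (\<alpha> - 1) * p + y0 powr (\<alpha> - 1) * q) + 3/8 * t"
    using X Y z(3) by (simp add: algebra_simps)
  also have "\<dots> = 1 - \<alpha> * (t * G) + 3/8 * t" unfolding depth by simp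
  also have "\<dots> \<le> 1"
  proof -
    have "1 * (t * (1/2)) \<le> \<alpha> * (t * G)" using \<alpha> t(1) G by (intro mult_mono) auto
    then show ?thesis using t(1) by simp
  qed
  finally show ?thesis by (simp add: lball_iff)
qed

text \<open>Conversely, inside the ball the quadratic remainder in the first coordinate cannot exceed the linear gain,
which has order \<open>t\<close>. Solving this inequality for the offset \<open>p\<close> gives the bound in both regimes.\<close>

lemma chord_offset_le:
  fixes x0 y0 :: real
  assumes \<alpha>: "1 < \<alpha>" "\<alpha> < 2" and z: "0 \<le> x0" "x0 \<le> y0" "x0 powr \<alpha> + y0 powr \<alpha> = 1"
    and t: "0 < t" "t \<le> 1" and G: "G \<le> 2"
    and depth: "x0 powr (\<alpha> - 1) * p + y0 powr (\<alpha> - 1) * q = - (t * G)"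
    and mem: "(x0 + p, y0 + q) \<in> lball \<alpha>"
  shows "\<bar>p\<bar> \<le> (32 / (\<alpha> - 1) + 1) * chord_scale \<alpha> t x0"
proof -
  define l where "l = chord_scale \<alpha> t x0"
  define A where "A = 32 / (\<alpha> - 1)"
  have A: "0 < A" unfolding A_def using \<alpha> by simp
  note B = upper_octant_bounds[OF \<alpha> z]
  note L = chord_scale_facts[OF \<alpha> z(1) B(7) t(1,2), folded l_def]
  have "y0 powr \<alpha> + \<alpha> * y0 powr (\<alpha> - 1) * q \<le> \<bar>y0 + q\<bar> powr \<alpha>"
    using powr_ge_tangent[OF \<alpha>(1), of y0 q] B(1) by simp
  moreover have "x0 powr \<alpha> + \<alpha> * x0 powr (\<alpha> - 1) * p + (\<alpha> - 1) / 4 * p\<^sup>2 * (x0 + \<bar>p\<bar>) powr (\<alpha> - 2) \<le> \<bar>x0 + p\<bar> powr \<alpha>"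
    by (rule powr_ge_tangent_quadratic[OF \<alpha> z(1)])
  ultimately have "(\<alpha> - 1) / 4 * p\<^sup>2 * (x0 + \<bar>p\<bar>) powr (\<alpha> - 2)
      \<le> - \<alpha> * (x0 powr (\<alpha> - 1) * p + y0 powr (\<alpha> - 1) * q)"
    using mem z(3) unfolding lball_iff by (simp add: algebra_simps)
  also have "\<dots> = \<alpha> * (t * G)" unfolding depth by simp
  also have "\<dots> \<le> \<alpha> * (t * 2)" using \<alpha> t(1) G by (intro mult_left_mono) auto
  also have "\<dots> \<le> 2 * (t * 2)" using \<alpha> t(1) by (intro mult_right_mono) auto
  finally have main: "p\<^sup>2 * (x0 + \<bar>p\<bar>) powr (\<alpha> - 2) \<le> A / 2 * t"
    unfolding A_def using \<alpha> by (simp add: field_simps)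
  have two: "2 powr (2 - \<alpha>) \<le> (2::real)" using powr_mono[of "2 - \<alpha>" 1 "2::real"] \<alpha> by simp
  have bound: "p\<^sup>2 * r powr (\<alpha> - 2) \<le> A * t" if r: "0 < r" "x0 + \<bar>p\<bar> \<le> 2 * r" "0 < x0 + \<bar>p\<bar>" for r
  proof -
    have "r powr (\<alpha> - 2) = 2 powr (2 - \<alpha>) * (2 * r) powr (\<alpha> - 2)"
      using r(1) by (simp add: powr_mult powr_add[symmetric] flip: mult.assoc)
    also have "\<dots> \<le> 2 * (x0 + \<bar>p\<bar>) powr (\<alpha> - 2)"
      using two r \<alpha> by (intro mult_mono powr_mono2') auto
    finally have "p\<^sup>2 * r powr (\<alpha> - 2) \<le> p\<^sup>2 * (2 * (x0 + \<bar>p\<bar>) powr (\<alpha> - 2))" by (intro mult_left_mono) auto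
    then show ?thesis using main by linarith
  qed
  have "\<bar>p\<bar> \<le> (A + 1) * l"
  proof (cases "\<bar>p\<bar> > x0")
    case True
    \<comment> \<open>here x0 is the smaller number and the remainder has order of the power alpha of the offset\<close>
    have "p\<^sup>2 * \<bar>p\<bar> powr (\<alpha> - 2) \<le> A * t" using True z(1) by (intro bound) auto
    moreover have "p\<^sup>2 * \<bar>p\<bar> powr (\<alpha> - 2) = \<bar>p\<bar> powr \<alpha>"
      using powr_add[of "\<bar>p\<bar>" "\<alpha> - 2" 2] by (simp add: mult.commute)
    ultimately have "\<bar>p\<bar> powr \<alpha> \<le> (A + 1) * t" using t(1) by (simp add: algebra_simps)
    then have "(\<bar>p\<bar> powr \<alpha>) powr (1/\<alpha>) \<le> ((A + 1) * t) powr (1/\<alpha>)" using \<alpha> by (intro powr_mono2) auto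
    also have "\<dots> = (A + 1) powr (1/\<alpha>) * t powr (1/\<alpha>)" by (rule powr_mult)
    also have "\<dots> \<le> (A + 1) powr 1 * l" using A \<alpha> L(1) by (intro mult_mono powr_mono) auto
    also have "(\<bar>p\<bar> powr \<alpha>) powr (1/\<alpha>) = \<bar>p\<bar>" using \<alpha> by (simp add: powr_powr)
    finally show ?thesis using A by simp
  next
    case False
    show ?thesis
    proof (cases "t \<le> x0 powr \<alpha>")
      case True
      then have x0: "0 < x0" using t(1) z(1) by (cases "x0 = 0") auto
      have "p\<^sup>2 * x0 powr (\<alpha> - 2) \<le> A * t" using False x0 by (intro bound) auto
      then have "(p\<^sup>2 * x0 powr (\<alpha> - 2)) * x0 powr (2 - \<alpha>) \<le> (A * t) * x0 powr (2 - \<alpha>)"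
        by (intro mult_right_mono) auto
      also have "(p\<^sup>2 * x0 powr (\<alpha> - 2)) * x0 powr (2 - \<alpha>) = p\<^sup>2"
        using x0 by (simp add: mult.assoc flip: powr_add)
      also have "(A * t) * x0 powr (2 - \<alpha>) = A * l\<^sup>2" using L(4)[OF True] by simp
      also have "\<dots> \<le> (A + 1)\<^sup>2 * l\<^sup>2" using A by (intro mult_right_mono) (auto simp: power2_eq_square algebra_simps)
      finally have "p\<^sup>2 \<le> ((A + 1) * l)\<^sup>2" by (simp add: power_mult_distrib)
      then have "\<bar>p\<bar> \<le> \<bar>(A + 1) * l\<bar>" unfolding abs_le_square_iff .
      also have "\<dots> = (A + 1) * l" using A L(3) by simp
      finally show ?thesis .
    next
      case c: False
      have "\<bar>p\<bar> \<le> x0" using False by simp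
      also have "x0 = (x0 powr \<alpha>) powr (1/\<alpha>)" using \<alpha> z(1) by (simp add: powr_powr)
      also have "\<dots> \<le> t powr (1/\<alpha>)" using c \<alpha> by (intro powr_mono2) auto
      also have "\<dots> \<le> 1 * l" using L(1) by simp
      also have "\<dots> \<le> (A + 1) * l" using A L(3) by (intro mult_right_mono) auto
      finally show ?thesis .
    qed
  qed
  then show ?thesis unfolding A_def l_def .
qed

section \<open>The unit normal and the half chords\<close>

text \<open>Up to the factor \<open>\<alpha>\<close>, the gradient of the gauge at a point with nonnegative coordinates.\<close>

definition lball_normal :: "real \<Rightarrow> real \<Rightarrow> real \<Rightarrow> real \<times> real" where
  "lball_normal \<alpha> x0 y0 = (x0 powr (\<alpha> - 1), y0 powr (\<alpha> - 1))"

lemma abs_component_le_norm: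
  fixes z :: "real \<times> real"
  shows "\<bar>fst z\<bar> \<le> norm z" "\<bar>snd z\<bar> \<le> norm z"
  using norm_fst_le[of "fst z" "snd z"] norm_snd_le[of "snd z" "fst z"] by simp_all

lemma norm_lball_normal:
  assumes "1 < \<alpha>" "\<alpha> < 2" "0 \<le> x0" "x0 \<le> y0" "x0 powr \<alpha> + y0 powr \<alpha> = 1"
  shows "1 / 2 \<le> norm (lball_normal \<alpha> x0 y0)" "norm (lball_normal \<alpha> x0 y0) \<le> 2"
proof -
  note B = upper_octant_bounds[OF assms]
  have "\<bar>snd (lball_normal \<alpha> x0 y0)\<bar> \<le> norm (lball_normal \<alpha> x0 y0)"
    by (rule abs_component_le_norm)
  then show "1 / 2 \<le> norm (lball_normal \<alpha> x0 y0)" using B(3) unfolding lball_normal_def by simp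
  have "norm (lball_normal \<alpha> x0 y0) \<le> norm (x0 powr (\<alpha> - 1)) + norm (y0 powr (\<alpha> - 1))"
    unfolding lball_normal_def by (rule norm_Pair_le)
  then show "norm (lball_normal \<alpha> x0 y0) \<le> 2" using B(4,5) by simp
qed

text \<open>Without this the limit in the definition of the normal would be vacuous.\<close>

lemma islimpt_frontier_lball:
  assumes \<alpha>: "1 < \<alpha>" "\<alpha> < 2" and z: "0 \<le> x0" "x0 \<le> y0" "x0 powr \<alpha> + y0 powr \<alpha> = 1"
  shows "(x0, y0) islimpt frontier (lball \<alpha>)"
  unfolding islimpt_approachable
proof (intro allI impI)
  fix e :: real assume e: "0 < e"
  define h where "h = (\<lambda>x::real. (1 - \<bar>x\<bar> powr \<alpha>) powr (1/\<alpha>))"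
  note B = upper_octant_bounds[OF \<alpha> z]
  have pos: "0 < 1 - x0 powr \<alpha>" using B(6) by simp
  have h0: "h x0 = y0"
  proof -
    have "1 - \<bar>x0\<bar> powr \<alpha> = y0 powr \<alpha>" using z by simp
    then have "h x0 = (y0 powr \<alpha>) powr (1/\<alpha>)" unfolding h_def by simp
    then show ?thesis using \<alpha> z by (simp add: powr_powr)
  qed
  have "((\<lambda>x. \<bar>x\<bar> powr \<alpha>) \<longlongrightarrow> \<bar>x0\<bar> powr \<alpha>) (at_right x0)"
    using \<alpha> by (intro tendsto_intros tendsto_powr') auto
  then have lim: "((\<lambda>x. 1 - \<bar>x\<bar> powr \<alpha>) \<longlongrightarrow> 1 - x0 powr \<alpha>) (at_right x0)"
    using tendsto_diff[OF tendsto_const[of 1]] z(1) by simp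
  then have "((\<lambda>x. (x, h x)) \<longlongrightarrow> (x0, h x0)) (at_right x0)"
    unfolding h_def using pos z \<alpha> by (intro tendsto_intros) auto
  then have "\<forall>\<^sub>F x in at_right x0. dist (x, h x) (x0, y0) < e"
    using e h0 by (auto simp: tendsto_iff)
  moreover have "\<forall>\<^sub>F x in at_right x0. 0 < 1 - \<bar>x\<bar> powr \<alpha>"
    using lim pos by (intro order_tendstoD(1)[OF lim]) auto
  moreover have "\<forall>\<^sub>F x in at_right x0. x0 < x" by (rule eventually_at_right_less)
  ultimately have "\<forall>\<^sub>F x in at_right x0. dist (x, h x) (x0, y0) < e \<and> 0 < 1 - \<bar>x\<bar> powr \<alpha> \<and> x0 < x"
    by eventually_elim simp
  then obtain x where x: "dist (x, h x) (x0, y0) < e" "0 < 1 - \<bar>x\<bar> powr \<alpha>" "x0 < x"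
    using eventually_happens[of _ "at_right x0"] by (auto simp: trivial_limit_at_right_real)
  have "\<bar>h x\<bar> powr \<alpha> = 1 - \<bar>x\<bar> powr \<alpha>" unfolding h_def using x(2) \<alpha> by (simp add: powr_powr)
  then have "(x, h x) \<in> frontier (lball \<alpha>)" using \<alpha> by (simp add: frontier_lball_iff)
  then show "\<exists>p\<in>frontier (lball \<alpha>). p \<noteq> (x0, y0) \<and> dist p (x0, y0) < e"
    using x by (intro bexI[of _ "(x, h x)"]) auto
qed

text \<open>The gauge is constant on the boundary, so its linear part there is bounded by the remainder in the tangent
inequality, which is of higher order than the length of the secant.\<close>

lemma frontier_secant_inner_normal_le:
  assumes \<alpha>: "1 < \<alpha>" "\<alpha> < 2" and z: "0 \<le> x0" "x0 \<le> y0" "x0 powr \<alpha> + y0 powr \<alpha> = 1"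
    and p: "p \<in> frontier (lball \<alpha>)"
  shows "\<bar>(p - (x0, y0)) \<bullet> lball_normal \<alpha> x0 y0\<bar> \<le> 12 * norm (p - (x0, y0)) powr \<alpha>"
proof -
  define d e where "d = fst p - x0" and "e = snd p - y0"
  define N where "N = norm (p - (x0, y0))"
  define J where "J = (p - (x0, y0)) \<bullet> lball_normal \<alpha> x0 y0"
  have J: "J = x0 powr (\<alpha> - 1) * d + y0 powr (\<alpha> - 1) * e"
    unfolding J_def lball_normal_def d_def e_def by (simp add: inner_prod_def mult.commute)
  have le: "\<bar>d\<bar> \<le> N" "\<bar>e\<bar> \<le> N"
    using abs_component_le_norm(1)[of "p - (x0, y0)"] abs_component_le_norm(2)[of "p - (x0, y0)"]
    unfolding N_def d_def e_def by (simp_all add: fst_diff snd_diff)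
  have 1: "\<bar>x0 + d\<bar> powr \<alpha> + \<bar>y0 + e\<bar> powr \<alpha> = 1"
    using p frontier_lball_iff[of \<alpha> "fst p" "snd p"] \<alpha> unfolding d_def e_def by simp
  have sg: "\<bar>x0\<bar> = x0" "\<bar>y0\<bar> = y0"
    "sgn x0 * x0 powr (\<alpha> - 1) = x0 powr (\<alpha> - 1)" "sgn y0 * y0 powr (\<alpha> - 1) = y0 powr (\<alpha> - 1)"
    using z by (auto simp: sgn_if)
  have "x0 powr \<alpha> + \<alpha> * x0 powr (\<alpha> - 1) * d \<le> \<bar>x0 + d\<bar> powr \<alpha>"
    "y0 powr \<alpha> + \<alpha> * y0 powr (\<alpha> - 1) * e \<le> \<bar>y0 + e\<bar> powr \<alpha>"
    using powr_ge_tangent[OF \<alpha>(1), of x0 d] powr_ge_tangent[OF \<alpha>(1), of y0 e] unfolding sg .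
  then have "\<alpha> * J \<le> 0" unfolding J using 1 z(3) by (simp add: algebra_simps)
  then have J0: "J \<le> 0" using \<alpha> by (simp add: mult_le_0_iff)
  have "\<bar>x0 + d\<bar> powr \<alpha> \<le> x0 powr \<alpha> + \<alpha> * x0 powr (\<alpha> - 1) * d + 6 * \<bar>d\<bar> powr \<alpha>"
    "\<bar>y0 + e\<bar> powr \<alpha> \<le> y0 powr \<alpha> + \<alpha> * y0 powr (\<alpha> - 1) * e + 6 * \<bar>e\<bar> powr \<alpha>"
    using powr_le_tangent_powr[OF \<alpha>, of x0 d] powr_le_tangent_powr[OF \<alpha>, of y0 e] unfolding sg .
  then have "- (\<alpha> * J) \<le> 6 * \<bar>d\<bar> powr \<alpha> + 6 * \<bar>e\<bar> powr \<alpha>"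
    unfolding J using 1 z(3) by (simp add: algebra_simps)
  also have "\<dots> \<le> 6 * N powr \<alpha> + 6 * N powr \<alpha>"
    using le \<alpha> by (intro add_mono mult_left_mono powr_mono2) auto
  finally have "\<alpha> * (- J) \<le> 12 * N powr \<alpha>" by simp
  moreover have "1 * (- J) \<le> \<alpha> * (- J)" using J0 \<alpha> by (intro mult_right_mono) auto
  ultimately have "\<bar>J\<bar> \<le> 12 * N powr \<alpha>" using J0 by linarith
  then show ?thesis unfolding J_def N_def .
qed

lemma inner_square_plus_rotated_inner_square:
  fixes g e :: "real \<times> real"
  shows "(g \<bullet> e)\<^sup>2 + ((snd g, - fst g) \<bullet> e)\<^sup>2 = (g \<bullet> g) * (e \<bullet> e)"
    and "(g \<bullet> g) * (u \<bullet> e) = (u \<bullet> g) * (g \<bullet> e) + (u \<bullet> (snd g, - fst g)) * ((snd g, - fst g) \<bullet> e)"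
  by (simp_all add: inner_prod_def power2_eq_square algebra_simps)

text \<open>Let \<open>e\<close> be the unit secant direction and \<open>k\<close> the rotated gradient. Both \<open>u \<bullet> e\<close> and \<open>g \<bullet> e\<close> tend to zero,
and in the plane \<open>e\<close> is then asymptotically \<open>\<plusminus> k / \<bar>k\<bar>\<close>; hence \<open>u\<close> is orthogonal to \<open>k\<close>. Avoiding a
parametrization of the boundary, this is expressed by a quadratic identity whose left side tends to zero and
whose right side \<open>(u \<bullet> k)\<^sup>2 G\<^sup>2\<close> is constant. The sign of \<open>u\<close> is decided by points of the
ball a little below the boundary.\<close>

lemma outward_unit_normal_lball:
  assumes \<alpha>: "1 < \<alpha>" "\<alpha> < 2" and z: "0 \<le> x0" "x0 \<le> y0" "x0 powr \<alpha> + y0 powr \<alpha> = 1"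
    and u: "outward_unit_normal (lball \<alpha>) (x0, y0) u"
  shows "u = lball_normal \<alpha> x0 y0 /\<^sub>R norm (lball_normal \<alpha> x0 y0)"
proof -
  define g where "g = lball_normal \<alpha> x0 y0"
  define k where "k = (snd g, - fst g)"
  define G where "G = norm g"
  have G: "1 / 2 \<le> G" unfolding G_def g_def by (rule norm_lball_normal[OF \<alpha> z])
  have gg: "g \<bullet> g = G\<^sup>2" unfolding G_def by (simp add: power2_norm_eq_inner)
  have u1: "norm u = 1"
    and ulim: "((\<lambda>p. ((p - (x0, y0)) /\<^sub>R norm (p - (x0, y0))) \<bullet> u) \<longlongrightarrow> 0) (at (x0, y0) within frontier (lball \<alpha>))"
    and uout: "\<forall>\<^sub>F s in at_right 0. (x0, y0) + s *\<^sub>R u \<notin> lball \<alpha>"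
    using u unfolding outward_unit_normal_def by auto
  let ?F = "at (x0, y0) within frontier (lball \<alpha>)"
  define e where "e = (\<lambda>p. (p - (x0, y0)) /\<^sub>R norm (p - (x0, y0)))"
  have ntriv: "?F \<noteq> bot" using islimpt_frontier_lball[OF \<alpha> z] by (simp add: trivial_limit_within)
  have ge: "((\<lambda>p. g \<bullet> e p) \<longlongrightarrow> 0) ?F"
  proof (rule Lim_null_comparison)
    show "((\<lambda>p. 12 * norm (p - (x0, y0)) powr (\<alpha> - 1)) \<longlongrightarrow> 0) ?F"
    proof -
      have "((\<lambda>p. norm (p - (x0, y0))) \<longlongrightarrow> norm ((x0, y0) - (x0, y0))) ?F"
        by (intro tendsto_intros)
      then have "((\<lambda>p. 12 * norm (p - (x0, y0)) powr (\<alpha> - 1)) \<longlongrightarrow> 12 * 0 powr (\<alpha> - 1)) ?F"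
        using \<alpha> by (intro tendsto_intros tendsto_powr') auto
      then show ?thesis by simp
    qed
    show "\<forall>\<^sub>F p in ?F. norm (g \<bullet> e p) \<le> 12 * norm (p - (x0, y0)) powr (\<alpha> - 1)"
      unfolding eventually_at_filter
    proof (intro always_eventually allI impI)
      fix p assume p: "p \<noteq> (x0, y0)" "p \<in> frontier (lball \<alpha>)"
      define N where "N = norm (p - (x0, y0))"
      have N: "0 < N" using p(1) unfolding N_def by simp
      have "g \<bullet> e p = ((p - (x0, y0)) \<bullet> g) / N"
        unfolding e_def N_def[symmetric] inner_scaleR_right
        by (simp only: inner_commute[of g] divide_inverse mult.commute)
      then have "norm (g \<bullet> e p) = \<bar>(p - (x0, y0)) \<bullet> g\<bar> / N"
        using N by (simp only: real_norm_def abs_divide abs_of_pos)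
      also have "\<dots> \<le> 12 * N powr \<alpha> / N"
        unfolding N_def g_def
        by (intro divide_right_mono frontier_secant_inner_normal_le[OF \<alpha> z p(2)]) auto
      also have "\<dots> = 12 * N powr (\<alpha> - 1)" using N by (simp add: powr_diff)
      finally show "norm (g \<bullet> e p) \<le> 12 * norm (p - (x0, y0)) powr (\<alpha> - 1)" unfolding N_def .
    qed
  qed
  have ue: "((\<lambda>p. u \<bullet> e p) \<longlongrightarrow> 0) ?F" using ulim unfolding e_def by (simp add: inner_commute)
  have "((\<lambda>p. G\<^sup>2 * (u \<bullet> e p) - (u \<bullet> g) * (g \<bullet> e p)) \<longlongrightarrow> G\<^sup>2 * 0 - (u \<bullet> g) * 0) ?F"
    by (intro tendsto_intros ue ge)
  then have "((\<lambda>p. (G\<^sup>2 * (u \<bullet> e p) - (u \<bullet> g) * (g \<bullet> e p))\<^sup>2 + (u \<bullet> k)\<^sup>2 * (g \<bullet> e p)\<^sup>2) \<longlongrightarrow>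
      (G\<^sup>2 * 0 - (u \<bullet> g) * 0)\<^sup>2 + (u \<bullet> k)\<^sup>2 * 0\<^sup>2) ?F"
    by (intro tendsto_intros ge ue)
  moreover have "\<forall>\<^sub>F p in ?F. (G\<^sup>2 * (u \<bullet> e p) - (u \<bullet> g) * (g \<bullet> e p))\<^sup>2 + (u \<bullet> k)\<^sup>2 * (g \<bullet> e p)\<^sup>2 = (u \<bullet> k)\<^sup>2 * G\<^sup>2"
    unfolding eventually_at_filter
  proof (intro always_eventually allI impI)
    fix p :: "real \<times> real" assume p: "p \<noteq> (x0, y0)"
    have e1: "e p \<bullet> e p = 1"
    proof -
      have "norm (e p) = 1" unfolding e_def using p by simp
      then show ?thesis by (simp add: norm_eq_1)
    qed
    have "G\<^sup>2 * (u \<bullet> e p) - (u \<bullet> g) * (g \<bullet> e p) = (u \<bullet> k) * (k \<bullet> e p)"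
      using inner_square_plus_rotated_inner_square(2)[of g u "e p"] gg unfolding k_def by simp
    moreover have "(g \<bullet> e p)\<^sup>2 + (k \<bullet> e p)\<^sup>2 = G\<^sup>2"
      using inner_square_plus_rotated_inner_square(1)[of g "e p"] gg e1 unfolding k_def by simp
    ultimately show "(G\<^sup>2 * (u \<bullet> e p) - (u \<bullet> g) * (g \<bullet> e p))\<^sup>2 + (u \<bullet> k)\<^sup>2 * (g \<bullet> e p)\<^sup>2 = (u \<bullet> k)\<^sup>2 * G\<^sup>2"
      by (metis (no_types, lifting) add.commute distrib_left power_mult_distrib)
  qed
  ultimately have "((\<lambda>p. (u \<bullet> k)\<^sup>2 * G\<^sup>2) \<longlongrightarrow> 0) ?F"
    by (simp add: tendsto_cong)
  then have "(u \<bullet> k)\<^sup>2 * G\<^sup>2 = 0" using tendsto_unique[OF ntriv tendsto_const] by blast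
  then have uk: "u \<bullet> k = 0" using G by simp
  have Gu: "G\<^sup>2 *\<^sub>R u = (u \<bullet> g) *\<^sub>R g"
  proof (rule vector_eq_rdot[THEN iffD1], rule allI)
    fix w
    show "(G\<^sup>2 *\<^sub>R u) \<bullet> w = ((u \<bullet> g) *\<^sub>R g) \<bullet> w"
      using inner_square_plus_rotated_inner_square(2)[of g u w] uk gg unfolding k_def by simp
  qed
  have "(u \<bullet> g)\<^sup>2 = G\<^sup>2"
    using inner_square_plus_rotated_inner_square(1)[of g u, folded k_def] uk gg u1
    by (simp add: norm_eq_1 inner_commute)
  then consider "u \<bullet> g = G" | "u \<bullet> g = - G" using power2_eq_iff by blast
  then show ?thesis
  proof cases
    case 1
    have "u = (1 / G\<^sup>2) *\<^sub>R (G\<^sup>2 *\<^sub>R u)" using G by simp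
    also have "\<dots> = g /\<^sub>R G" unfolding Gu 1 using G by (simp add: power2_eq_square inverse_eq_divide)
    finally show ?thesis unfolding g_def G_def .
  next
    case 2
    have "u = (1 / G\<^sup>2) *\<^sub>R (G\<^sup>2 *\<^sub>R u)" using G by simp
    also have "\<dots> = (- (1 / G)) *\<^sub>R g" unfolding Gu 2 using G by (simp add: power2_eq_square)
    finally have um: "u = (- (1 / G)) *\<^sub>R g" .
    obtain c where c: "0 < c" "\<And>s. 0 < s \<Longrightarrow> s < c \<Longrightarrow> (x0, y0) + s *\<^sub>R u \<notin> lball \<alpha>"
      using uout unfolding eventually_at_right_field by auto
    define s where "s = min (c / 2) (if x0 = 0 then 1/2 else min x0 (1/2))"
    have s: "0 < s" "s < c" "s \<le> 1/2" "x0 = 0 \<or> s \<le> x0" unfolding s_def using c(1) z(1) by auto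
    define a b where "a = x0 powr (\<alpha> - 1) / G" and "b = y0 powr (\<alpha> - 1) / G"
    have ab: "0 \<le> a" "a \<le> 1" "0 \<le> b" "b \<le> 1"
      using abs_component_le_norm[of g] G unfolding G_def[symmetric] a_def b_def
      by (simp_all add: g_def lball_normal_def divide_le_eq_1)
    have sab: "s * a \<le> s" "s * b \<le> s" using ab s(1) by (simp_all add: mult_left_le)
    \<comment> \<open>moving against the gradient decreases both coordinates towards zero, so u cannot be the inner normal\<close>
    have "s * a \<le> x0"
    proof (cases "x0 = 0")
      case True
      then show ?thesis unfolding a_def by simp
    next
      case False
      then show ?thesis using s(4) sab(1) by simp
    qed
    moreover have "s * b \<le> y0" using sab(2) s(3) upper_octant_bounds(1)[OF \<alpha> z] by linarith
    ultimately have "\<bar>x0 - s * a\<bar> powr \<alpha> + \<bar>y0 - s * b\<bar> powr \<alpha> \<le> x0 powr \<alpha> + y0 powr \<alpha>"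
      using ab s(1) \<alpha> by (intro add_mono powr_mono2) auto
    then have "(x0 - s * a, y0 - s * b) \<in> lball \<alpha>" using z(3) by (simp add: lball_iff)
    moreover have "(x0 - s * a, y0 - s * b) = (x0, y0) + s *\<^sub>R u"
      unfolding um a_def b_def g_def lball_normal_def by simp
    ultimately show ?thesis using c(2)[OF s(1,2)] by simp
  qed
qed

text \<open>The displacements from the boundary point are \<open>(p s, q s)\<close>, and the linear part of the gauge depends on the depth
only. The gradient is at least as large in the second coordinate, so the unit tangent vector is large in the
first, and bounding the offset \<open>p\<close> bounds \<open>s\<close>.\<close>

lemma half_chord_bounds:
  assumes \<alpha>: "1 < \<alpha>" "\<alpha> < 2" and z: "0 \<le> x0" "x0 \<le> y0" "x0 powr \<alpha> + y0 powr \<alpha> = 1"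
    and u: "outward_unit_normal (lball \<alpha>) (x0, y0) u" and v: "norm v = 1" "u \<bullet> v = 0"
    and t: "0 < t" "t powr (1 - 1/\<alpha>) \<le> 1/48" "t \<le> 1"
  shows "1/48 * chord_scale \<alpha> t x0 \<le> half_chord (lball \<alpha>) (x0, y0) u v i t"
    and "half_chord (lball \<alpha>) (x0, y0) u v i t \<le> (64 / (\<alpha> - 1) + 4) * chord_scale \<alpha> t x0"
proof -
  define g where "g = lball_normal \<alpha> x0 y0"
  define G where "G = norm g"
  define l where "l = chord_scale \<alpha> t x0"
  define w where "w = (-1 :: real) ^ i *\<^sub>R v"
  note B = upper_octant_bounds[OF \<alpha> z]
  note L = chord_scale_facts[OF \<alpha> z(1) B(7) t(1,3), folded l_def]
  have G: "1 / 2 \<le> G" "G \<le> 2" unfolding G_def g_def by (rule norm_lball_normal[OF \<alpha> z])+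
  have gg: "g \<bullet> g = G\<^sup>2" unfolding G_def by (simp add: power2_norm_eq_inner)
  have ug: "u = g /\<^sub>R G" unfolding g_def G_def by (rule outward_unit_normal_lball[OF \<alpha> z u])
  have w1: "norm w = 1" unfolding w_def using v by (simp add: power_abs)
  have gw: "g \<bullet> w = 0" using v(2) G(1) unfolding ug w_def by simp
  define p q where "p = (\<lambda>s. s * fst w - t * fst u)" and "q = (\<lambda>s. s * snd w - t * snd u)"
  have pt: "(x0, y0) - t *\<^sub>R u + ((-1) ^ i * s) *\<^sub>R v = (x0 + p s, y0 + q s)" for s
    unfolding p_def q_def w_def by (simp add: prod_eq_iff mult_ac)
  have depth: "x0 powr (\<alpha> - 1) * p s + y0 powr (\<alpha> - 1) * q s = - (t * G)" for s
  proof -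
    have "x0 powr (\<alpha> - 1) * p s + y0 powr (\<alpha> - 1) * q s = s * (g \<bullet> w) - t * (g \<bullet> u)"
      unfolding p_def q_def g_def lball_normal_def by (simp add: inner_prod_def algebra_simps)
    also have "g \<bullet> u = G" unfolding ug using G gg by (simp add: power2_eq_square)
    finally show ?thesis using gw by simp
  qed
  have uc: "\<bar>fst u\<bar> \<le> 1" "\<bar>snd u\<bar> \<le> 1"
    using abs_component_le_norm(1)[of u] abs_component_le_norm(2)[of u] u unfolding outward_unit_normal_def by simp_all
  have wc: "\<bar>fst w\<bar> \<le> 1" "\<bar>snd w\<bar> \<le> 1"
    using abs_component_le_norm(1)[of w] abs_component_le_norm(2)[of w] w1 by simp_all
  have fw: "1 / 2 \<le> \<bar>fst w\<bar>"
  proof -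
    define a b where "a = x0 powr (\<alpha> - 1)" and "b = y0 powr (\<alpha> - 1)"
    have ab: "0 \<le> a" "a \<le> b" "0 < b" using B unfolding a_def b_def by auto
    have "a * fst w + b * snd w = 0"
      using gw unfolding g_def lball_normal_def a_def b_def by (simp add: inner_prod_def)
    then have "b * snd w = - (a * fst w)" by simp
    then have "b * \<bar>snd w\<bar> = a * \<bar>fst w\<bar>" using ab by (metis abs_minus_cancel abs_mult abs_of_nonneg less_imp_le)
    also have "\<dots> \<le> b * \<bar>fst w\<bar>" using ab by (intro mult_right_mono) auto
    finally have "\<bar>snd w\<bar> \<le> \<bar>fst w\<bar>" using ab by simp
    then have "(snd w)\<^sup>2 \<le> (fst w)\<^sup>2" by (simp add: abs_le_square_iff)
    moreover have "(fst w)\<^sup>2 + (snd w)\<^sup>2 = 1"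
      using w1 by (simp add: norm_eq_1 inner_prod_def power2_eq_square)
    ultimately have "(1 / 2)\<^sup>2 \<le> (fst w)\<^sup>2" by (simp add: power2_eq_square)
    then show ?thesis by (simp flip: abs_le_square_iff)
  qed
  define S where "S = {s. (x0, y0) - t *\<^sub>R u + ((-1) ^ i * s) *\<^sub>R v \<in> lball \<alpha>}"
  have upper: "s \<le> (64 / (\<alpha> - 1) + 4) * l" if "s \<in> S" for s
  proof -
    have "(x0 + p s, y0 + q s) \<in> lball \<alpha>" using that unfolding S_def pt by simp
    from chord_offset_le[OF \<alpha> z t(1,3) G(2) depth this]
    have 1: "\<bar>p s\<bar> \<le> (32 / (\<alpha> - 1) + 1) * l" unfolding l_def .
    have "\<bar>s\<bar> * (1/2) \<le> \<bar>s\<bar> * \<bar>fst w\<bar>" using fw by (intro mult_left_mono) auto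
    also have "\<dots> = \<bar>p s + t * fst u\<bar>" unfolding p_def by (simp add: abs_mult)
    also have "\<dots> \<le> \<bar>p s\<bar> + \<bar>t * fst u\<bar>" by (rule abs_triangle_ineq)
    also have "\<bar>t * fst u\<bar> \<le> t * 1" unfolding abs_mult using t(1) uc by (intro mult_mono) auto
    also have "t * 1 \<le> l" using L(1,6) by simp
    finally have "\<bar>s\<bar> * (1/2) \<le> (32 / (\<alpha> - 1) + 1) * l + l" using 1 by linarith
    then have "2 * (\<bar>s\<bar> * (1/2)) \<le> 2 * ((32 / (\<alpha> - 1) + 1) * l + l)" by (intro mult_left_mono) auto
    then have "\<bar>s\<bar> \<le> 2 * ((32 / (\<alpha> - 1) + 1) * l + l)" by (simp only: mult_1_right times_divide_eq_right nonzero_mult_div_cancel_left mult.commute[of _ "1/2"])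
    also have "\<dots> = (64 / (\<alpha> - 1) + 4) * l" by (simp add: algebra_simps)
    finally show ?thesis by linarith
  qed
  have lower: "1/48 * l \<in> S"
  proof -
    have "\<bar>p (1/48 * l)\<bar> \<le> t + 1/48 * l" "\<bar>q (1/48 * l)\<bar> \<le> t + 1/48 * l"
    proof -
      have *: "\<bar>1/48 * l * r - t * r'\<bar> \<le> t + 1/48 * l" if "\<bar>r\<bar> \<le> 1" "\<bar>r'\<bar> \<le> 1" for r r'
      proof -
        have "\<bar>1/48 * l * r - t * r'\<bar> \<le> \<bar>1/48 * l * r\<bar> + \<bar>t * r'\<bar>" by (rule abs_triangle_ineq4)
        also have "\<dots> \<le> 1/48 * l * 1 + t * 1"
          unfolding abs_mult using that L(3) t(1) by (intro add_mono mult_mono) auto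
        finally show ?thesis by simp
      qed
      show "\<bar>p (1/48 * l)\<bar> \<le> t + 1/48 * l" "\<bar>q (1/48 * l)\<bar> \<le> t + 1/48 * l"
        unfolding p_def q_def using uc wc by (intro *; simp)+
    qed
    then have "(x0 + p (1/48 * l), y0 + q (1/48 * l)) \<in> lball \<alpha>"
      unfolding l_def by (intro chord_point_in_lball[OF \<alpha> z t G(1) _ _ depth]) auto
    then show ?thesis unfolding S_def pt by simp
  qed
  have bdd: "bdd_above S" using upper by (rule bdd_aboveI)
  have "closed ((\<lambda>s. (x0, y0) - t *\<^sub>R u + ((-1) ^ i * s) *\<^sub>R v) -` lball \<alpha>)"
    using \<alpha> by (intro continuous_closed_vimage compact_imp_closed compact_lball continuous_intros) auto
  then have "closed S" unfolding S_def vimage_def .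
  then have Sup: "Sup S \<in> S" using lower bdd by (intro closed_contains_Sup) auto
  have "half_chord (lball \<alpha>) (x0, y0) u v i t = Sup S"
    unfolding half_chord_def using Sup bdd
    by (intro Greatest_equality) (auto simp: S_def intro: cSup_upper[of _ S, unfolded S_def])
  moreover have "1/48 * l \<le> Sup S" using lower bdd by (rule cSup_upper)
  ultimately show "1/48 * chord_scale \<alpha> t x0 \<le> half_chord (lball \<alpha>) (x0, y0) u v i t"
    "half_chord (lball \<alpha>) (x0, y0) u v i t \<le> (64 / (\<alpha> - 1) + 4) * chord_scale \<alpha> t x0"
    using upper[OF Sup] unfolding l_def by auto
qed

section \<open>The Christoffel function of the ball\<close>

lemma inverse_nat_le_sqrt:
  assumes "0 < \<sigma>" "\<sigma> * inverse ((real n)\<^sup>2) \<le> \<delta>"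
  shows "1 / real n \<le> sqrt \<delta> / sqrt \<sigma>"
proof -
  have "sqrt (\<sigma> * inverse ((real n)\<^sup>2)) \<le> sqrt \<delta>" using assms(2) by (rule real_sqrt_le_mono)
  moreover have "sqrt (\<sigma> * inverse ((real n)\<^sup>2)) = sqrt \<sigma> * (1 / real n)"
    by (simp add: real_sqrt_mult real_sqrt_inverse divide_inverse flip: power_inverse)
  ultimately have "sqrt \<sigma> * (1 / real n) \<le> sqrt \<delta>" by simp
  then show ?thesis using assms(1) by (simp add: pos_le_divide_eq mult.commute)
qed

text \<open>The two strips are bounded by the tangents at the points with abscissa \<open>m\<close> and \<open>- m\<close>, where \<open>r\<close>, the power
\<open>\<alpha>\<close> of \<open>m\<close>, is of order \<open>max \<delta> (x0 powr \<alpha>)\<close>. The point lies at most of order \<open>\<delta>\<close> below the first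
tangent and of order \<open>r\<close> below the second, while the tangents meet at an angle of order
\<open>a\<close>, the power \<open>\<alpha> - 1\<close> of \<open>m\<close>. The resulting bound has order \<open>sqrt (\<delta> r) / (a n\<^sup>2)\<close>, which is
the asserted one. The hypothesis with \<open>\<sigma>\<close> absorbs the terms \<open>1 / n\<close> into the square roots of the depths.\<close>

lemma christoffel_lball_upper:
  assumes \<alpha>: "1 < \<alpha>" "\<alpha> < 2" and z: "0 \<le> x0" "x0 \<le> y0" "x0 powr \<alpha> + y0 powr \<alpha> = 1"
    and x: "\<bar>fst x\<bar> powr \<alpha> + \<bar>snd x\<bar> powr \<alpha> < 1"
    and \<delta>: "norm (x - (x0, y0)) \<le> \<delta>" "0 < \<delta>" "\<delta> \<le> 1"
    and \<sigma>: "0 < \<sigma>" "\<sigma> * inverse ((real n)\<^sup>2) \<le> \<delta>" and n: "1 \<le> n"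
  shows "christoffel n (lball \<alpha>) x \<le> 36 * 2400\<^sup>2 * (2 + 1 / sqrt \<sigma>) * (4 + 2 / sqrt \<sigma>)
    * (inverse ((real n)\<^sup>2) * \<delta> powr (1/2) * (max \<delta> (x0 powr \<alpha>)) powr (1/\<alpha> - 1/2))"
proof -
  note B0 = upper_octant_bounds[OF \<alpha> z]
  have a0: "0 < \<alpha>" using \<alpha> by simp
  \<comment> \<open>the divisor four keeps r below one half for all depths, so that the tangent at abscissa m is not too steep\<close>
  define r where "r = max (x0 powr \<alpha>) (\<delta> / 4)"
  define m where "m = r powr (1/\<alpha>)"
  have r0: "0 < r" unfolding r_def using \<delta>(2) by (simp add: less_max_iff_disj)
  have m0: "0 < m" unfolding m_def using r0 by simp
  have mr: "m powr \<alpha> = r" unfolding m_def using r0 \<alpha> by (simp add: powr_powr)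
  have x0r: "x0 powr \<alpha> \<le> r" and \<delta>r: "\<delta> \<le> 4 * r" and rhalf: "r \<le> 1/2"
    using B0(6) \<delta>(3) unfolding r_def by auto
  have x0m': "x0 \<le> m"
  proof -
    have "x0 = (x0 powr \<alpha>) powr (1/\<alpha>)" using \<alpha> z(1) by (simp add: powr_powr)
    also have "\<dots> \<le> m" unfolding m_def using x0r \<alpha> by (intro powr_mono2) auto
    finally show ?thesis .
  qed
  define ym where "ym = (1 - r) powr (1/\<alpha>)"
  have ym: "ym powr \<alpha> = 1 - r" unfolding ym_def using rhalf \<alpha> by (simp add: powr_powr)
  have mym: "m \<le> ym"
  proof -
    have "m = r powr (1/\<alpha>)" unfolding m_def ..
    also have "\<dots> \<le> ym" unfolding ym_def using rhalf r0 \<alpha> by (intro powr_mono2) auto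
    finally show ?thesis .
  qed
  have ryr: "m powr \<alpha> + ym powr \<alpha> = 1" unfolding ym mr by simp
  note B = upper_octant_bounds[OF \<alpha> less_imp_le[OF m0] mym ryr]
  define a b where "a = m powr (\<alpha> - 1)" and "b = ym powr (\<alpha> - 1)"
  have ab: "0 < a" "1/2 \<le> b" "a \<le> b" "b \<le> 1" using B m0 unfolding a_def b_def by auto
  have am: "a * m = r" unfolding a_def mr[symmetric] using powr_mult_base[of m "\<alpha> - 1"] m0 by (simp add: mult.commute)
  have bym: "b * ym = 1 - r"
    unfolding b_def ym[symmetric] using powr_mult_base[of ym "\<alpha> - 1"] B(1) by (simp add: mult.commute)
  have lin: "a * \<bar>p\<bar> + b * \<bar>q\<bar> \<le> (\<bar>p\<bar> powr \<alpha> + \<bar>q\<bar> powr \<alpha>) / \<alpha> + (1 - 1/\<alpha>)" for p q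
  proof -
    have "\<bar>p\<bar> * \<bar>m\<bar> powr (\<alpha> - 1) + \<bar>q\<bar> * \<bar>ym\<bar> powr (\<alpha> - 1)
       \<le> (\<bar>p\<bar> powr \<alpha> / \<alpha> + (1 - 1/\<alpha>) * \<bar>m\<bar> powr \<alpha>) + (\<bar>q\<bar> powr \<alpha> / \<alpha> + (1 - 1/\<alpha>) * \<bar>ym\<bar> powr \<alpha>)"
      by (intro add_mono mult_powr_le \<alpha>)
    also have "\<dots> = (\<bar>p\<bar> powr \<alpha> + \<bar>q\<bar> powr \<alpha>) / \<alpha> + (1 - 1/\<alpha>) * (\<bar>m\<bar> powr \<alpha> + \<bar>ym\<bar> powr \<alpha>)"
      by (simp add: add_divide_distrib distrib_left)
    also have "\<bar>m\<bar> powr \<alpha> + \<bar>ym\<bar> powr \<alpha> = 1" using ryr m0 B(1) by simp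
    finally show ?thesis unfolding a_def b_def using m0 B(1) by (simp add: mult.commute)
  qed
  have lin_le: "a * \<bar>p\<bar> + b * \<bar>q\<bar> \<le> 1" if "\<bar>p\<bar> powr \<alpha> + \<bar>q\<bar> powr \<alpha> \<le> 1" for p q
  proof -
    have "(\<bar>p\<bar> powr \<alpha> + \<bar>q\<bar> powr \<alpha>) / \<alpha> \<le> 1 / \<alpha>" using that a0 by (intro divide_right_mono) auto
    then show ?thesis using lin[of p q] by linarith
  qed
  have lin_less: "a * \<bar>fst x\<bar> + b * \<bar>snd x\<bar> < 1"
  proof -
    have "(\<bar>fst x\<bar> powr \<alpha> + \<bar>snd x\<bar> powr \<alpha>) / \<alpha> < 1 / \<alpha>" using x a0 by (intro divide_strict_right_mono) auto
    then show ?thesis using lin[of "fst x" "snd x"] by linarith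
  qed
  have abs_le: "\<bar>a * p\<bar> = a * \<bar>p\<bar>" "\<bar>b * p\<bar> = b * \<bar>p\<bar>" for p using ab by (simp_all add: abs_mult)
  define l1 l2 where "l1 = 1 - a * fst x - b * snd x" and "l2 = 1 + a * fst x - b * snd x"
  have l: "0 < l1" "l1 \<le> 3" "0 < l2" "l2 \<le> 3"
    using lin_less abs_ge_self[of "a * fst x"] abs_ge_minus_self[of "a * fst x"]
      abs_ge_self[of "b * snd x"] abs_ge_minus_self[of "b * snd x"]
    unfolding l1_def l2_def abs_le by linarith+
  have strip: "1 - a * fst w - b * snd w \<in> {0..6} \<and> 1 + a * fst w - b * snd w \<in> {0..6}"
    if "w \<in> lball \<alpha>" for w
  proof -
    have "a * \<bar>fst w\<bar> + b * \<bar>snd w\<bar> \<le> 1" using that by (intro lin_le) (cases w, simp add: lball_iff)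
    then show ?thesis
      using abs_ge_self[of "a * fst w"] abs_ge_minus_self[of "a * fst w"]
        abs_ge_self[of "b * snd w"] abs_ge_minus_self[of "b * snd w"]
      unfolding abs_le by simp
  qed
  have dx: "\<bar>fst x - x0\<bar> \<le> \<delta>" "\<bar>snd x - y0\<bar> \<le> \<delta>"
    using abs_component_le_norm[of "x - (x0, y0)"] \<delta>(1) by simp_all
  have adx: "\<bar>a * (fst x - x0)\<bar> \<le> \<delta>" "\<bar>b * (snd x - y0)\<bar> \<le> \<delta>"
  proof -
    have "a * \<bar>fst x - x0\<bar> \<le> 1 * \<delta>" "b * \<bar>snd x - y0\<bar> \<le> 1 * \<delta>"
      using ab dx by (intro mult_mono; simp)+
    then show "\<bar>a * (fst x - x0)\<bar> \<le> \<delta>" "\<bar>b * (snd x - y0)\<bar> \<le> \<delta>" unfolding abs_le by simp_all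
  qed
  have y0ym: "ym \<le> y0"
  proof -
    have "y0 = (y0 powr \<alpha>) powr (1/\<alpha>)" using \<alpha> z by (simp add: powr_powr)
    moreover have "1 - r \<le> y0 powr \<alpha>" using x0r z(3) by linarith
    ultimately show ?thesis unfolding ym_def using rhalf \<alpha> powr_mono2[of "1/\<alpha>" "1 - r" "y0 powr \<alpha>"] by simp
  qed
  have x0m: "a * x0 \<le> r" unfolding am[symmetric] using ab x0m' by (intro mult_left_mono) auto
  have by0: "1 - r \<le> b * y0" unfolding bym[symmetric] using ab y0ym by (intro mult_left_mono) auto
  have ax0: "0 \<le> a * x0" using ab z by simp
  have lz: "1 - a * x0 - b * y0 \<le> \<delta>"
  proof (cases "\<delta> / 4 \<le> x0 powr \<alpha>")
    case True
    then have "m = x0" unfolding m_def r_def using \<alpha> z(1) by (simp add: powr_powr)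
    then have "a * x0 = r" using am by simp
    then show ?thesis using by0 \<delta>(2) by linarith
  next
    case False
    then have "r \<le> \<delta>" unfolding r_def using \<delta>(2) by simp
    then show ?thesis using by0 ax0 by linarith
  qed
  have l1: "l1 \<le> 3 * \<delta>"
  proof -
    have "l1 = (1 - a * x0 - b * y0) - a * (fst x - x0) - b * (snd x - y0)"
      unfolding l1_def by (simp add: algebra_simps)
    then show ?thesis using lz adx by linarith
  qed
  have l2: "l2 \<le> 16 * r"
  proof -
    have "l2 = (1 + a * x0 - b * y0) + a * (fst x - x0) - b * (snd x - y0)"
      unfolding l2_def by (simp add: algebra_simps)
    then show ?thesis using x0m by0 adx \<delta>r r0 by linarith
  qed
  define s where "s = 1 / sqrt \<sigma>"
  have s0: "0 < s" unfolding s_def using \<sigma> by simp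
  have ns: "1 / real n \<le> s * sqrt \<delta>"
    using inverse_nat_le_sqrt[OF \<sigma>] unfolding s_def by simp
  have sq1: "sqrt l1 + 1 / real n \<le> (2 + s) * sqrt \<delta>"
  proof -
    have "sqrt l1 \<le> sqrt (2\<^sup>2 * \<delta>)" using l1 \<delta>(2) by (intro real_sqrt_le_mono) simp
    also have "\<dots> = 2 * sqrt \<delta>" by (simp add: real_sqrt_mult)
    finally show ?thesis using ns by (simp add: algebra_simps)
  qed
  have sq2: "sqrt l2 + 1 / real n \<le> (4 + 2 * s) * sqrt r"
  proof -
    have "sqrt l2 \<le> sqrt (4\<^sup>2 * r)" using l2 by (intro real_sqrt_le_mono) simp
    also have "\<dots> = 4 * sqrt r" by (simp add: real_sqrt_mult)
    finally have 1: "sqrt l2 \<le> 4 * sqrt r" .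
    have "sqrt \<delta> \<le> sqrt (2\<^sup>2 * r)" using \<delta>r by (intro real_sqrt_le_mono) simp
    also have "\<dots> = 2 * sqrt r" by (simp add: real_sqrt_mult)
    finally have "s * sqrt \<delta> \<le> s * (2 * sqrt r)" using s0 by (intro mult_left_mono) auto
    then show ?thesis using 1 ns by (simp add: algebra_simps)
  qed
  obtain f where f: "f \<in> poly2 n" "f x = 1"
    "L2_inner (lball \<alpha>) f f \<le> 18 * 2400\<^sup>2 / (a * b) * ((sqrt l1 + 1 / real n) / real n * ((sqrt l2 + 1 / real n) / real n))"
    by (rule exists_poly2_peak[OF compact_lball[OF a0] ab(1) _ strip l1_def[symmetric] l2_def[symmetric] l n])
       (use ab in auto)
  have "christoffel n (lball \<alpha>) x \<le> L2_inner (lball \<alpha>) f f"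
    by (rule christoffel_le_L2_inner[OF compact_lball[OF a0] interior_lball_nonempty[OF a0] f(1,2)])
  also note f(3)
  also have "18 * 2400\<^sup>2 / (a * b) * ((sqrt l1 + 1 / real n) / real n * ((sqrt l2 + 1 / real n) / real n))
     \<le> 18 * 2400\<^sup>2 * (2 / a) * (((2 + s) * sqrt \<delta>) / real n * (((4 + 2 * s) * sqrt r) / real n))"
  proof (intro mult_mono divide_right_mono sq1 sq2)
    have "1 / (a * b) \<le> 2 / a" using ab by (simp add: field_simps)
    then have "18 * 2400\<^sup>2 * (1 / (a * b)) \<le> 18 * 2400\<^sup>2 * (2 / a)" by (intro mult_left_mono) auto
    then show "18 * 2400\<^sup>2 / (a * b) \<le> 18 * 2400\<^sup>2 * (2 / a)" by simp
  qed (use ab s0 \<delta>(2) r0 l in auto)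
  also have "\<dots> = 36 * 2400\<^sup>2 * (2 + s) * (4 + 2 * s) * (inverse ((real n)\<^sup>2) * sqrt \<delta> * (sqrt r / a))"
  proof -
    have "18 * K * (2 / a) * ((p * u) / N * ((q * v) / N)) = 36 * K * p * q * (inverse (N\<^sup>2) * u * (v / a))"
      for K p q u v N :: real by (simp add: power2_eq_square divide_inverse)
    then show ?thesis .
  qed
  also have "\<dots> \<le> 36 * 2400\<^sup>2 * (2 + s) * (4 + 2 * s) * (inverse ((real n)\<^sup>2) * sqrt \<delta> * (max \<delta> (x0 powr \<alpha>)) powr (1/\<alpha> - 1/2))"
  proof -
    have "sqrt r / a = r powr (1/\<alpha> - 1/2)"
    proof -
      have "sqrt r / a = m powr (\<alpha> / 2) / m powr (\<alpha> - 1)"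
        unfolding mr[symmetric] a_def by (simp add: powr_half_sqrt[symmetric] powr_powr)
      also have "\<dots> = m powr (\<alpha> * (1/\<alpha> - 1/2))"
        using \<alpha> m0 by (simp flip: powr_diff add: right_diff_distrib)
      also have "\<dots> = r powr (1/\<alpha> - 1/2)" unfolding mr[symmetric] by (simp add: powr_powr)
      finally show ?thesis .
    qed
    also have "\<dots> \<le> (max \<delta> (x0 powr \<alpha>)) powr (1/\<alpha> - 1/2)"
      using \<alpha> r0 \<delta>(2) unfolding r_def by (intro powr_mono2) (auto simp: field_simps)
    finally show ?thesis using s0 \<delta>(2) by (intro mult_left_mono) auto
  qed
  finally show ?thesis unfolding s_def using \<delta>(2) by (simp add: powr_half_sqrt)
qed

text \<open>The region lies below the tangent of slope \<open>- k\<close> at the boundary point vertically above \<open>(x1, y1)\<close>, lowered by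
\<open>e + c t\<^sup>2\<close>, where \<open>c = 1 / 3600\<close>. The linear terms of the two tangent inequalities cancel up to this
lowering. The width \<open>\<beta>\<close> is chosen so that the remainder in the first coordinate is at most a small multiple of
\<open>e + c t\<^sup>2\<close>: away from the singular point the second order term \<open>c t\<^sup>2\<close> absorbs it, and near that
point \<open>e\<close> and \<open>c t\<^sup>2\<close> together do.\<close>

lemma parabolic_region_subset_lball:
  assumes \<alpha>: "1 < \<alpha>" "\<alpha> < 2"
    and h: "h powr \<alpha> = 1 - \<bar>x1\<bar> powr \<alpha>" "1/10 \<le> h" "h \<le> 1" and x1: "\<bar>x1\<bar> \<le> 1"
    and y1: "1/10 \<le> y1 + h" and e: "0 < e" "2 * e \<le> h - y1" "e \<le> 1/7200"
    and \<beta>: "\<beta> = 1/432000 * (max \<bar>x1\<bar> (e powr (1/\<alpha>))) powr (1 - \<alpha>/2)"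
    and k: "k = sgn x1 * \<bar>x1\<bar> powr (\<alpha> - 1) / h powr (\<alpha> - 1)"
    and t: "\<bar>t\<bar> \<le> 1" and r: "0 \<le> r" "r \<le> 1"
  shows "(x1 + \<beta> * t, y1 + e - k * \<beta> * t - 1/3600 * t\<^sup>2 - 1/3600 * r) \<in> lball \<alpha>"
proof -
  \<comment> \<open>so small that the quadratic remainders of the two coordinates stay below a twentieth of the lowering each\<close>
  define c K :: real where "c = 1/3600" and "K = 1/432000"
  define m where "m = max \<bar>x1\<bar> (e powr (1/\<alpha>))"
  define \<tau> where "\<tau> = \<beta> * t"
  define b where "b = h powr (\<alpha> - 1)"
  define w where "w = e + k * \<tau> + c * t\<^sup>2"
  define Y where "Y = y1 + e - k * \<beta> * t - 1/3600 * t\<^sup>2 - 1/3600 * r"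
  have h0: "0 < h" using h by simp
  have b: "1/10 \<le> b"
  proof -
    have "h powr 1 \<le> h powr (\<alpha> - 1)" using h h0 \<alpha> by (intro powr_mono') auto
    then show ?thesis unfolding b_def using h h0 by simp
  qed
  have t2: "t\<^sup>2 \<le> 1" using t by (simp add: abs_square_le_1)
  have m0: "0 < m" unfolding m_def using e by (simp add: less_max_iff_disj)
  have m1: "m \<le> 1"
    unfolding m_def using x1 e \<alpha> powr_mono2[of "1/\<alpha>" e 1] by simp
  have \<beta>K: "0 < \<beta>" "\<beta> \<le> K"
  proof -
    have "m powr (1 - \<alpha>/2) \<le> 1 powr (1 - \<alpha>/2)" using m0 m1 \<alpha> by (intro powr_mono2) auto
    then show "\<beta> \<le> K" unfolding \<beta> m_def[symmetric] K_def by simp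
    show "0 < \<beta>" unfolding \<beta> m_def[symmetric] using m0 by simp
  qed
  \<comment> \<open>the slope is chosen so that the linear terms of both coordinates cancel\<close>
  have kb: "k * b = sgn x1 * \<bar>x1\<bar> powr (\<alpha> - 1)" unfolding k b_def using h0 by simp
  have k10: "\<bar>k\<bar> \<le> 10"
  proof -
    have "\<bar>k\<bar> * b = \<bar>sgn x1 * \<bar>x1\<bar> powr (\<alpha> - 1)\<bar>" using b by (simp flip: kb add: abs_mult)
    also have "\<dots> \<le> 1 * 1"
      unfolding abs_mult using x1 \<alpha> powr_mono2[of "\<alpha> - 1" "\<bar>x1\<bar>" 1]
      by (intro mult_mono) (auto simp: sgn_if)
    finally have "\<bar>k\<bar> * b \<le> 1" by simp
    moreover have "\<bar>k\<bar> * (1/10) \<le> \<bar>k\<bar> * b" using b by (intro mult_left_mono) auto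
    ultimately show ?thesis by simp
  qed
  have \<tau>: "\<bar>\<tau>\<bar> \<le> K * \<bar>t\<bar>" unfolding \<tau>_def abs_mult using \<beta>K by (intro mult_right_mono) auto
  have k\<tau>: "\<bar>k * \<tau>\<bar> \<le> 10 * (K * \<bar>t\<bar>)"
    unfolding abs_mult using k10 \<tau> by (intro mult_mono) auto
  have k\<tau>1: "\<bar>k * \<tau>\<bar> \<le> 10 * K"
    using k\<tau> t unfolding K_def by linarith
  have Yw: "Y = y1 + 2 * e - w - c * r" unfolding Y_def w_def c_def \<tau>_def by (simp add: algebra_simps)
  have up: "Y \<le> h - w" unfolding Yw using e(2) r unfolding c_def by simp
  have low: "- (h - w) \<le> Y"
  proof -
    have "Y + (h - w) = (y1 + h) - 2 * (k * \<tau>) - 2 * c * t\<^sup>2 - c * r"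
      unfolding Yw unfolding w_def by (simp add: algebra_simps)
    also have "\<dots> \<ge> 1/10 - 20 * K - 2 * c - c"
    proof -
      have "2 * c * t\<^sup>2 \<le> 2 * c" "c * r \<le> c" using t2 r unfolding c_def by simp_all
      then show ?thesis using y1 k\<tau>1 by linarith
    qed
    finally show ?thesis unfolding K_def c_def by simp
  qed
  have "\<bar>Y\<bar> powr \<alpha> \<le> \<bar>h + (- w)\<bar> powr \<alpha>" using up low \<alpha> by (intro powr_mono2) auto
  also have "\<dots> \<le> h powr \<alpha> + \<alpha> * b * (- w) + 3 * h powr (\<alpha> - 2) * w\<^sup>2"
    using powr_le_tangent_quadratic[OF \<alpha>, of h "- w"] h0 unfolding b_def by simp
  also have "\<dots> \<le> h powr \<alpha> + \<alpha> * b * (- w) + 3 * 10 * w\<^sup>2"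
  proof -
    have "h powr (\<alpha> - 2) \<le> (1/10) powr (\<alpha> - 2)" using h \<alpha> by (intro powr_mono2') auto
    also have "\<dots> \<le> (1/10) powr (- 1)" using \<alpha> by (intro powr_mono') auto
    also have "\<dots> = 10" by (simp add: powr_minus_divide)
    finally show ?thesis by (intro add_left_mono mult_right_mono mult_left_mono) auto
  qed
  finally have YY: "\<bar>Y\<bar> powr \<alpha> \<le> h powr \<alpha> - \<alpha> * b * w + 30 * w\<^sup>2" by simp
  have ww: "30 * w\<^sup>2 \<le> (e + c * t\<^sup>2) / 20"
  proof -
    have three: "(p + q + s)\<^sup>2 \<le> 3 * (p\<^sup>2 + q\<^sup>2 + s\<^sup>2)" for p q s :: real
    proof -
      have "0 \<le> (p - q)\<^sup>2 + (q - s)\<^sup>2 + (p - s)\<^sup>2" by simp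
      then show ?thesis by (simp add: power2_eq_square algebra_simps)
    qed
    have e2: "e\<^sup>2 \<le> 1/7200 * e" using e by (simp add: power2_eq_square)
    have "(k * \<tau>)\<^sup>2 \<le> (10 * (K * \<bar>t\<bar>))\<^sup>2"
      using k\<tau> unfolding abs_le_square_iff[symmetric] K_def by simp
    also have "\<dots> = 100 * K\<^sup>2 * t\<^sup>2" by (simp add: power_mult_distrib)
    finally have k2: "(k * \<tau>)\<^sup>2 \<le> 100 * K\<^sup>2 * t\<^sup>2" .
    have c2: "(c * t\<^sup>2)\<^sup>2 \<le> c\<^sup>2 * t\<^sup>2"
      using t2 mult_right_mono[of "t\<^sup>2" 1 "t\<^sup>2"] by (simp add: power_mult_distrib power2_eq_square[of "t\<^sup>2"] mult_left_mono)
    have "w\<^sup>2 \<le> 3 * (e\<^sup>2 + (k * \<tau>)\<^sup>2 + (c * t\<^sup>2)\<^sup>2)" unfolding w_def by (rule three)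
    also have "\<dots> \<le> 3 * (1/7200 * e + 100 * K\<^sup>2 * t\<^sup>2 + c\<^sup>2 * t\<^sup>2)" using e2 k2 c2 by (intro mult_left_mono add_mono) auto
    finally have "30 * w\<^sup>2 \<le> 90 * (1/7200 * e + 100 * K\<^sup>2 * t\<^sup>2 + c\<^sup>2 * t\<^sup>2)" by linarith
    also have "\<dots> = 1/80 * e + (9000 * K\<^sup>2 + 90 * c\<^sup>2) * t\<^sup>2" by (simp add: algebra_simps)
    also have "\<dots> \<le> 1/20 * e + (c / 20) * t\<^sup>2"
      using e(1) unfolding K_def c_def by (intro add_mono mult_right_mono) (auto simp: power2_eq_square)
    finally show ?thesis by simp
  qed
  have XX: "\<bar>x1 + \<tau>\<bar> powr \<alpha> \<le> \<bar>x1\<bar> powr \<alpha> + \<alpha> * (k * b) * \<tau> + (e + c * t\<^sup>2) / 20"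
  proof (cases "e powr (1/\<alpha>) \<le> \<bar>x1\<bar>")
    case True
    then have mx: "m = \<bar>x1\<bar>" unfolding m_def by simp
    then have x0: "x1 \<noteq> 0" using m0 by auto
    have "\<tau> = K * m powr (1 - \<alpha>/2) * t"
      unfolding \<tau>_def \<beta> m_def[symmetric] K_def by simp
    then have "\<tau>\<^sup>2 = K\<^sup>2 * (m powr (1 - \<alpha>/2))\<^sup>2 * t\<^sup>2"
      by (simp only: power_mult_distrib)
    also have "(m powr (1 - \<alpha>/2))\<^sup>2 = m powr (2 - \<alpha>)"
      unfolding power2_eq_square by (simp flip: powr_add)
    finally have "\<bar>x1\<bar> powr (\<alpha> - 2) * \<tau>\<^sup>2 = (m powr (\<alpha> - 2) * m powr (2 - \<alpha>)) * (K\<^sup>2 * t\<^sup>2)"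
      unfolding mx by (simp add: mult_ac)
    also have "m powr (\<alpha> - 2) * m powr (2 - \<alpha>) = 1" using m0 by (simp flip: powr_add)
    finally have "3 * \<bar>x1\<bar> powr (\<alpha> - 2) * \<tau>\<^sup>2 = 3 * K\<^sup>2 * t\<^sup>2" by simp
    also have "\<dots> \<le> c / 20 * t\<^sup>2" unfolding K_def c_def by (intro mult_right_mono) (auto simp: power2_eq_square)
    finally have "3 * \<bar>x1\<bar> powr (\<alpha> - 2) * \<tau>\<^sup>2 \<le> (e + c * t\<^sup>2) / 20" using e(1) by (simp add: add_divide_distrib)
    then show ?thesis using powr_le_tangent_quadratic[OF \<alpha> x0, of \<tau>] unfolding kb by linarith
  next
    case False
    then have me: "m = e powr (1/\<alpha>)" unfolding m_def by simp
    define q where "q = max e (t\<^sup>2)"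
    have q: "0 < q" "e \<le> q" "t\<^sup>2 \<le> q" "q \<le> e + t\<^sup>2" unfolding q_def using e(1) by auto
    have "\<bar>\<tau>\<bar> powr \<alpha> = (K * (m powr (1 - \<alpha>/2) * \<bar>t\<bar>)) powr \<alpha>"
      unfolding \<tau>_def \<beta> m_def[symmetric] K_def by (simp add: abs_mult)
    also have "\<dots> = K powr \<alpha> * ((m powr (1 - \<alpha>/2)) powr \<alpha> * \<bar>t\<bar> powr \<alpha>)"
      unfolding powr_mult ..
    also have "(m powr (1 - \<alpha>/2)) powr \<alpha> = e powr (1 - \<alpha>/2)"
      unfolding me using \<alpha> by (simp add: powr_powr)
    also have "\<bar>t\<bar> powr \<alpha> = (t\<^sup>2) powr (\<alpha>/2)"
      using powr_powr[of "\<bar>t\<bar>" 2 "\<alpha>/2"] by simp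
    also have "K powr \<alpha> * (e powr (1 - \<alpha>/2) * (t\<^sup>2) powr (\<alpha>/2)) \<le> K powr 1 * (q powr (1 - \<alpha>/2) * q powr (\<alpha>/2))"
      using q e(1) \<alpha> unfolding K_def by (intro mult_mono powr_mono2 powr_mono') auto
    also have "q powr (1 - \<alpha>/2) * q powr (\<alpha>/2) = q" using q(1) by (simp flip: powr_add)
    also have "K powr 1 * q \<le> K * (e + t\<^sup>2)" unfolding K_def using q by simp
    finally have "6 * \<bar>\<tau>\<bar> powr \<alpha> \<le> c / 20 * (e + t\<^sup>2)" unfolding K_def c_def by simp
    also have "\<dots> \<le> (e + c * t\<^sup>2) / 20" unfolding c_def using e(1) by (simp add: algebra_simps)
    finally show ?thesis using powr_le_tangent_powr[OF \<alpha>, of x1 \<tau>] unfolding kb by linarith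
  qed
  have "\<bar>x1 + \<tau>\<bar> powr \<alpha> + \<bar>Y\<bar> powr \<alpha>
     \<le> 1 + \<alpha> * (k * b) * \<tau> - \<alpha> * b * w + (e + c * t\<^sup>2) / 10"
    using XX YY ww h(1) by linarith
  also have "\<dots> = 1 - \<alpha> * b * (e + c * t\<^sup>2) + (e + c * t\<^sup>2) / 10"
    unfolding w_def by (simp add: algebra_simps)
  also have "\<dots> \<le> 1"
  proof -
    have "1 * (1/10) \<le> \<alpha> * b" using \<alpha> b by (intro mult_mono) auto
    then have "(1/10) * (e + c * t\<^sup>2) \<le> \<alpha> * b * (e + c * t\<^sup>2)"
      using e(1) unfolding c_def by (intro mult_right_mono) auto
    then show ?thesis by simp
  qed
  finally show ?thesis unfolding lball_iff Y_def \<tau>_def .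
qed

text \<open>For points near the boundary these bounds come from the position of the nearest boundary point in the octant;
for deep points they come from comparing \<open>\<delta>\<close> with the distances to the boundary points on the horizontal and
the vertical line through the point.\<close>

lemma interior_point_position:
  assumes \<alpha>: "1 < \<alpha>" "\<alpha> < 2" and z: "0 \<le> x0" "x0 \<le> y0" "x0 powr \<alpha> + y0 powr \<alpha> = 1"
    and x: "\<bar>x1\<bar> powr \<alpha> + \<bar>y1\<bar> powr \<alpha> < 1"
    and \<delta>: "\<delta> = norm ((x1, y1) - (x0, y0))"
    and near: "\<And>p. p \<in> frontier (lball \<alpha>) \<Longrightarrow> \<delta> \<le> norm ((x1, y1) - p)"
    and h: "h = (1 - \<bar>x1\<bar> powr \<alpha>) powr (1/\<alpha>)"
  shows "\<bar>x1\<bar> \<le> 9/10" "\<delta> \<le> h - y1" "h - y1 \<le> 2" "1/10 \<le> y1 + h" "1/10 \<le> h" "h \<le> 1"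
    "h powr \<alpha> = 1 - \<bar>x1\<bar> powr \<alpha>" "\<bar>x1 - x0\<bar> \<le> \<delta>"
proof -
  note B = upper_octant_bounds[OF \<alpha> z]
  have a0: "0 < \<alpha>" using \<alpha> by simp
  have prof: "\<bar>p\<bar> \<le> (1 - \<bar>q\<bar> powr \<alpha>) powr (1/\<alpha>) \<and> (1 - \<bar>q\<bar> powr \<alpha>) powr (1/\<alpha>) \<le> 1
      \<and> ((1 - \<bar>q\<bar> powr \<alpha>) powr (1/\<alpha>)) powr \<alpha> = 1 - \<bar>q\<bar> powr \<alpha>"
    if "\<bar>q\<bar> powr \<alpha> + \<bar>p\<bar> powr \<alpha> < 1" for p q
  proof (intro conjI)
    have "\<bar>p\<bar> = (\<bar>p\<bar> powr \<alpha>) powr (1/\<alpha>)" using \<alpha> by (simp add: powr_powr)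
    also have "\<dots> \<le> (1 - \<bar>q\<bar> powr \<alpha>) powr (1/\<alpha>)" using that \<alpha> by (intro powr_mono2) auto
    finally show "\<bar>p\<bar> \<le> (1 - \<bar>q\<bar> powr \<alpha>) powr (1/\<alpha>)" .
    have q: "0 \<le> 1 - \<bar>q\<bar> powr \<alpha>" using that powr_ge_zero[of "\<bar>p\<bar>" \<alpha>] by linarith
    then have "(1 - \<bar>q\<bar> powr \<alpha>) powr (1/\<alpha>) \<le> 1 powr (1/\<alpha>)" using \<alpha> by (intro powr_mono2) auto
    then show "(1 - \<bar>q\<bar> powr \<alpha>) powr (1/\<alpha>) \<le> 1" by simp
    show "((1 - \<bar>q\<bar> powr \<alpha>) powr (1/\<alpha>)) powr \<alpha> = 1 - \<bar>q\<bar> powr \<alpha>" using q \<alpha> by (simp add: powr_powr)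
  qed
  have hy: "\<bar>y1\<bar> \<le> h" "h \<le> 1" "h powr \<alpha> = 1 - \<bar>x1\<bar> powr \<alpha>"
    using prof[of x1 y1] x unfolding h by auto
  show "h \<le> 1" "h powr \<alpha> = 1 - \<bar>x1\<bar> powr \<alpha>" by fact+
  have h0: "0 \<le> h" unfolding h by simp
  have fr: "(x1, h) \<in> frontier (lball \<alpha>)" "(x1, - h) \<in> frontier (lball \<alpha>)"
    using hy(3) h0 by (simp_all add: frontier_lball_iff[OF a0])
  have d1: "\<delta> \<le> \<bar>y1 - h\<bar>" and d2: "\<delta> \<le> \<bar>y1 + h\<bar>"
    using near[OF fr(1)] near[OF fr(2)] by simp_all
  show dh: "\<delta> \<le> h - y1" using d1 hy(1) by linarith
  show "h - y1 \<le> 2" using hy(1,2) by linarith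
  have dx: "\<bar>x1 - x0\<bar> \<le> \<delta>" "\<bar>y1 - y0\<bar> \<le> \<delta>"
    using abs_component_le_norm[of "(x1, y1) - (x0, y0)"] unfolding \<delta> by simp_all
  show "\<bar>x1 - x0\<bar> \<le> \<delta>" by fact
  show "1/10 \<le> y1 + h"
  proof (cases "1/10 \<le> \<delta>")
    case True
    then show ?thesis using d2 hy(1) by linarith
  next
    case False
    then show ?thesis using dx(2) B(1) h0 by linarith
  qed
  show x9: "\<bar>x1\<bar> \<le> 9/10"
  proof (cases "1/10 \<le> \<delta>")
    case True
    define g where "g = (1 - \<bar>y1\<bar> powr \<alpha>) powr (1/\<alpha>)"
    have g: "\<bar>x1\<bar> \<le> g" "g \<le> 1" "g powr \<alpha> = 1 - \<bar>y1\<bar> powr \<alpha>" "0 \<le> g"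
      using prof[of y1 x1] x unfolding g_def by auto
    have "(g, y1) \<in> frontier (lball \<alpha>)" "(- g, y1) \<in> frontier (lball \<alpha>)"
      using g by (simp_all add: frontier_lball_iff[OF a0])
    then have "\<delta> \<le> \<bar>x1 - g\<bar>" "\<delta> \<le> \<bar>x1 + g\<bar>"
      using near[of "(g, y1)"] near[of "(- g, y1)"] by simp_all
    then show ?thesis using g(1,2) True by linarith
  next
    case False
    have "x0 \<le> 8/10"
    proof (rule ccontr)
      assume "\<not> x0 \<le> 8/10"
      then have "(8/10) powr 2 \<le> x0 powr 2" by (intro powr_mono2) auto
      also have "\<dots> \<le> x0 powr \<alpha>" using \<alpha> z B(7) by (intro powr_mono') auto
      finally show False using B(6) by (simp add: power2_eq_square)
    qed
    then show ?thesis using dx(1) False z(1) by linarith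
  qed
  have "\<bar>x1\<bar> powr \<alpha> \<le> (9/10) powr \<alpha>" using x9 \<alpha> by (intro powr_mono2) auto
  also have "\<dots> \<le> (9/10) powr 1" using \<alpha> by (intro powr_mono') auto
  finally have "1/10 \<le> h powr \<alpha>" unfolding hy(3) by simp
  also have "\<dots> \<le> h powr 1" using \<alpha> h0 hy(2) by (intro powr_mono') auto
  finally show "1/10 \<le> h" using h0 by simp
qed

text \<open>The parabolic region contains the point at the parameter \<open>s\<close> of order \<open>d\<close>, the vertical depth, which is at
least \<open>\<delta>\<close>. The estimate on the region loses \<open>n\<close> in the tangential variable, \<open>n / sqrt s\<close> in
the vertical one and \<open>1 / \<beta>\<close> by the Jacobian; \<open>\<beta>\<close> has at least the order of the last factor of the claim.\<close>

lemma christoffel_lball_lower: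
  assumes \<alpha>: "1 < \<alpha>" "\<alpha> < 2" and z: "0 \<le> x0" "x0 \<le> y0" "x0 powr \<alpha> + y0 powr \<alpha> = 1"
    and x: "\<bar>x1\<bar> powr \<alpha> + \<bar>y1\<bar> powr \<alpha> < 1"
    and \<delta>: "\<delta> = norm ((x1, y1) - (x0, y0))" "0 < \<delta>" "\<delta> \<le> 1"
    and near: "\<And>p. p \<in> frontier (lball \<alpha>) \<Longrightarrow> \<delta> \<le> norm ((x1, y1) - p)"
    and \<sigma>: "0 < \<sigma>" "\<sigma> * inverse ((real n)\<^sup>2) \<le> \<delta>" and n: "1 \<le> n"
  shows "inverse (64 * 2 * 57600 * 432000 * 3600 * (1 + 2 / sqrt \<sigma>))
    * (inverse ((real n)\<^sup>2) * \<delta> powr (1/2) * (max \<delta> (x0 powr \<alpha>)) powr (1/\<alpha> - 1/2))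
    \<le> christoffel n (lball \<alpha>) (x1, y1)"
proof -
  have a0: "0 < \<alpha>" using \<alpha> by simp
  define h where "h = (1 - \<bar>x1\<bar> powr \<alpha>) powr (1/\<alpha>)"
  note P = interior_point_position[OF \<alpha> z x \<delta>(1) near h_def]
  define d where "d = h - y1"
  have d: "\<delta> \<le> d" "d \<le> 2" "0 < d" using P \<delta>(2) unfolding d_def by auto
  \<comment> \<open>the vertical depth is at most two, so the point lies in the upper half of the region\<close>
  define s where "s = d / 4"
  define e where "e = 1/3600 * s"
  define m where "m = max \<bar>x1\<bar> (e powr (1/\<alpha>))"
  define \<beta> where "\<beta> = 1/432000 * m powr (1 - \<alpha>/2)"
  define k where "k = sgn x1 * \<bar>x1\<bar> powr (\<alpha> - 1) / h powr (\<alpha> - 1)"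
  have s: "0 < s" "s \<le> 1/2" unfolding s_def using d by auto
  have e: "0 < e" "2 * e \<le> h - y1" "e \<le> 1/7200" unfolding e_def s_def d_def[symmetric] using d by auto
  have m0: "0 < m" unfolding m_def using e by (simp add: less_max_iff_disj)
  have \<beta>0: "0 < \<beta>" unfolding \<beta>_def using m0 by simp
  define K where "K = 64 * real n * ((real n + 1 / sqrt s) / sqrt s) / (\<beta> * (1/3600))"
  have "inverse K \<le> christoffel n (lball \<alpha>) (x1, y1)"
  proof (rule inverse_le_christoffel[OF compact_lball[OF a0] interior_lball_nonempty[OF a0]])
    fix f assume f: "f \<in> poly2 n"
    show "(f (x1, y1))\<^sup>2 \<le> K * L2_inner (lball \<alpha>) f f"
      unfolding K_def
    proof (rule poly2_point_le_integral[OF compact_lball[OF a0] f n \<beta>0 _ s, where k = "k * \<beta>"])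
      fix r t :: real assume rt: "r \<in> {0..1}" "t \<in> {-1..1}"
      show "(x1 + \<beta> * t, y1 + 1/3600 * s - k * \<beta> * t - 1/3600 * t\<^sup>2 - 1/3600 * r) \<in> lball \<alpha>"
        unfolding e_def[symmetric]
        by (rule parabolic_region_subset_lball[OF \<alpha> P(7,5,6) _ P(4) e \<beta>_def[unfolded m_def] k_def])
           (use P(1) rt in auto)
    qed simp
  qed
  moreover have "inverse (64 * 2 * 57600 * 432000 * 3600 * (1 + 2 / sqrt \<sigma>))
    * (inverse ((real n)\<^sup>2) * \<delta> powr (1/2) * (max \<delta> (x0 powr \<alpha>)) powr (1/\<alpha> - 1/2)) \<le> inverse K"
  proof -
    define W where "W = (max \<delta> (x0 powr \<alpha>)) powr (1/\<alpha> - 1/2)"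
    define g where "g = 1 + 2 / sqrt \<sigma>"
    have W0: "0 < W" unfolding W_def using \<delta>(2) by (simp add: less_max_iff_disj)
    have g0: "0 < g" unfolding g_def using \<sigma>(1) by (simp add: add_pos_nonneg)
    have ss: "sqrt \<delta> / 2 \<le> sqrt s"
    proof -
      have "sqrt (\<delta> / 2\<^sup>2) \<le> sqrt s" unfolding s_def using d by (intro real_sqrt_le_mono) simp
      then show ?thesis by (simp add: real_sqrt_divide)
    qed
    have s\<delta>: "1 / sqrt s \<le> 2 / sqrt \<delta>" using ss \<delta>(2) s(1) by (simp add: field_simps)
    have n\<delta>: "1 / sqrt \<delta> \<le> real n / sqrt \<sigma>"
      using inverse_nat_le_sqrt[OF \<sigma>] \<sigma>(1) \<delta>(2) n by (simp add: field_simps)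
    have nn: "real n + 1 / sqrt s \<le> real n * g"
    proof -
      have "1 / sqrt s \<le> 2 * (real n / sqrt \<sigma>)" using s\<delta> n\<delta> by simp
      then show ?thesis unfolding g_def by (simp add: algebra_simps)
    qed
    have mW: "W \<le> 57600 * m powr (1 - \<alpha>/2)"
    proof -
      have me: "e \<le> m powr \<alpha>" "\<bar>x1\<bar> powr \<alpha> \<le> m powr \<alpha>"
      proof -
        have "e = (e powr (1/\<alpha>)) powr \<alpha>" using \<alpha> e(1) by (simp add: powr_powr)
        also have "\<dots> \<le> m powr \<alpha>" unfolding m_def using \<alpha> by (intro powr_mono2) auto
        finally show "e \<le> m powr \<alpha>" .
        show "\<bar>x1\<bar> powr \<alpha> \<le> m powr \<alpha>" unfolding m_def using \<alpha> by (intro powr_mono2) auto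
      qed
      have \<delta>m: "\<delta> \<le> 14400 * m powr \<alpha>" using me(1) d unfolding e_def s_def by simp
      define q where "q = max \<bar>x1\<bar> \<delta>"
      have "\<delta> powr \<alpha> \<le> \<delta> powr 1" using \<alpha> \<delta> by (intro powr_mono') auto
      then have qm: "q powr \<alpha> \<le> 14400 * m powr \<alpha>"
        using \<delta>m me(2) \<delta>(2) unfolding q_def by (auto simp: max_def)
      have "x0 powr \<alpha> \<le> (2 * q) powr \<alpha>" using P(8) z(1) \<alpha> unfolding q_def by (intro powr_mono2) auto
      also have "\<dots> = 2 powr \<alpha> * q powr \<alpha>" by (rule powr_mult)
      also have "\<dots> \<le> 2 powr 2 * (14400 * m powr \<alpha>)" using qm \<alpha> by (intro mult_mono powr_mono) auto
      finally have "x0 powr \<alpha> \<le> 57600 * m powr \<alpha>" by simp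
      moreover have "\<delta> \<le> 57600 * m powr \<alpha>" using \<delta>m powr_ge_zero[of m \<alpha>] by linarith
      ultimately have "max \<delta> (x0 powr \<alpha>) \<le> 57600 * m powr \<alpha>" by simp
      then have "W \<le> (57600 * m powr \<alpha>) powr (1/\<alpha> - 1/2)"
        unfolding W_def using \<alpha> \<delta>(2) by (intro powr_mono2) (auto simp: field_simps)
      also have "\<dots> = 57600 powr (1/\<alpha> - 1/2) * m powr (1 - \<alpha>/2)"
        using \<alpha> by (simp add: powr_mult powr_powr right_diff_distrib)
      also have "\<dots> \<le> 57600 powr 1 * m powr (1 - \<alpha>/2)"
        using \<alpha> by (intro mult_right_mono powr_mono) (auto simp: field_simps)
      finally show ?thesis by simp
    qed
    have "1 / \<beta> \<le> 432000 * 57600 / W"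
    proof -
      have "W \<le> 57600 * (432000 * \<beta>)" using mW unfolding \<beta>_def by simp
      then show ?thesis using W0 \<beta>0 by (simp add: field_simps)
    qed
    note \<beta>W = this
    have "K = 64 * real n * ((real n + 1 / sqrt s) * (1 / sqrt s)) * (1 / \<beta>) * 3600"
      unfolding K_def by simp
    also have "\<dots> \<le> 64 * real n * ((real n * g) * (2 / sqrt \<delta>)) * (432000 * 57600 / W) * 3600"
      using nn s\<delta> \<beta>W s(1) \<beta>0 g0 \<delta>(2) W0 by (intro mult_mono mult_nonneg_nonneg) auto
    also have "\<dots> = (64 * 2 * 57600 * 432000 * 3600 * g) * ((real n)\<^sup>2 / (sqrt \<delta> * W))"
      by (simp add: power2_eq_square)
    finally have K: "K \<le> (64 * 2 * 57600 * 432000 * 3600 * g) * ((real n)\<^sup>2 / (sqrt \<delta> * W))" .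
    have K0: "0 < K" unfolding K_def using n s \<beta>0 by (intro divide_pos_pos mult_pos_pos add_pos_pos) auto
    have "inverse ((64 * 2 * 57600 * 432000 * 3600 * g) * ((real n)\<^sup>2 / (sqrt \<delta> * W))) \<le> inverse K"
      by (rule le_imp_inverse_le[OF K K0])
    moreover have "inverse ((64 * 2 * 57600 * 432000 * 3600 * g) * ((real n)\<^sup>2 / (sqrt \<delta> * W)))
       = inverse (64 * 2 * 57600 * 432000 * 3600 * g) * (inverse ((real n)\<^sup>2) * sqrt \<delta> * W)"
      by (simp only: inverse_mult_distrib inverse_divide divide_inverse inverse_inverse_eq mult_ac)
    ultimately show ?thesis unfolding W_def[symmetric] g_def[symmetric]
      using \<delta>(2) by (simp only: powr_half_sqrt[OF less_imp_le])
  qed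
  ultimately show ?thesis by linarith
qed

theorem theorem2:
  fixes \<alpha> :: real
  assumes "1 < \<alpha>" and "\<alpha> < 2"
  shows "(\<exists>c0 C. 0 < c0 \<and> c0 < 1 \<and> 1 \<le> C \<and>
      (\<forall>x0 y0 u v. (x0, y0) \<in> frontier (lball \<alpha>) \<and> 0 \<le> x0 \<and> x0 \<le> y0 \<and>
          outward_unit_normal (lball \<alpha>) (x0, y0) u \<and> norm v = 1 \<and> u \<bullet> v = 0 \<longrightarrow>
        (\<forall>i\<in>{1, 2}. \<forall>t. 0 < t \<and> t \<le> c0 \<longrightarrow>
          inverse C * t powr (1/2) * (max t (x0 powr \<alpha>)) powr (1/\<alpha> - 1/2)
            \<le> half_chord (lball \<alpha>) (x0, y0) u v i t \<and>
          half_chord (lball \<alpha>) (x0, y0) u v i t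
            \<le> C * t powr (1/2) * (max t (x0 powr \<alpha>)) powr (1/\<alpha> - 1/2))))
    \<and> (\<forall>\<sigma>>0. \<exists>C\<ge>1. \<forall>x0 y0 (n::nat) x \<delta>.
        (x0, y0) \<in> frontier (lball \<alpha>) \<and> 0 \<le> x0 \<and> x0 \<le> y0 \<and> 1 \<le> n \<and>
        x \<in> lball \<alpha> - frontier (lball \<alpha>) \<and>
        \<delta> = norm (x - (x0, y0)) \<and> (\<forall>p\<in>frontier (lball \<alpha>). \<delta> \<le> norm (x - p)) \<and>
        \<sigma> * inverse ((real n)\<^sup>2) \<le> \<delta> \<and> \<delta> \<le> 1 \<longrightarrow>
          inverse C * inverse ((real n)\<^sup>2) * \<delta> powr (1/2)
              * (max \<delta> (x0 powr \<alpha>)) powr (1/\<alpha> - 1/2)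
            \<le> christoffel n (lball \<alpha>) x \<and>
          christoffel n (lball \<alpha>) x
            \<le> C * inverse ((real n)\<^sup>2) * \<delta> powr (1/2)
              * (max \<delta> (x0 powr \<alpha>)) powr (1/\<alpha> - 1/2))"
proof (intro conjI allI impI, goal_cases)
  case 1
  have a0: "0 < \<alpha>" using assms by simp
  define c0 where "c0 = (1/48::real) powr (\<alpha> / (\<alpha> - 1))"
  define C where "C = max 48 (64 / (\<alpha> - 1) + 4)"
  have c0: "0 < c0" "c0 < 1"
    unfolding c0_def using assms powr_less_mono2[of "\<alpha> / (\<alpha> - 1)" "1/48" 1] by auto
  have C: "48 \<le> C" "64 / (\<alpha> - 1) + 4 \<le> C" unfolding C_def by auto
  show ?case
  proof (rule exI[of _ c0], rule exI[of _ C], rule conjI[OF c0(1)], rule conjI[OF c0(2)],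
      rule conjI, use C in simp, intro allI impI ballI, goal_cases)
    case H: (1 x0 y0 u v i t)
    then have t: "0 < t" "t \<le> c0" by simp_all
    have z: "0 \<le> x0" "x0 \<le> y0" "x0 powr \<alpha> + y0 powr \<alpha> = 1"
      using H frontier_lball_iff[OF a0, of x0 y0] by auto
    have "t powr (1 - 1/\<alpha>) \<le> c0 powr (1 - 1/\<alpha>)" using t assms by (intro powr_mono2) auto
    also have "\<dots> = 1/48" unfolding c0_def using assms by (simp add: powr_powr field_simps)
    finally have t48: "t powr (1 - 1/\<alpha>) \<le> 1/48" .
    have t1: "t \<le> 1" using t c0(2) by simp
    note hc = half_chord_bounds[OF assms z _ _ _ _ t48 t1, of u v i]
    have L: "0 < chord_scale \<alpha> t x0"
      using chord_scale_facts(3)[OF assms z(1) upper_octant_bounds(7)[OF assms z] _ t1] t by simp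
    have "inverse C * chord_scale \<alpha> t x0 \<le> 1/48 * chord_scale \<alpha> t x0"
      using C(1) L le_imp_inverse_le[of 48 C] by (intro mult_right_mono) auto
    also have "\<dots> \<le> half_chord (lball \<alpha>) (x0, y0) u v i t" using hc(1) H t by blast
    finally have lo: "inverse C * chord_scale \<alpha> t x0 \<le> half_chord (lball \<alpha>) (x0, y0) u v i t" .
    have "half_chord (lball \<alpha>) (x0, y0) u v i t \<le> (64 / (\<alpha> - 1) + 4) * chord_scale \<alpha> t x0"
      using hc(2) H t by blast
    also have "\<dots> \<le> C * chord_scale \<alpha> t x0" using C(2) L by (intro mult_right_mono) auto
    finally show ?case using lo unfolding chord_scale_def by (simp only: mult.assoc)
  qed
next
  case (2 \<sigma>)
  then have \<sigma>: "0 < \<sigma>" .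
  have a0: "0 < \<alpha>" using assms by simp
  define C1 where "C1 = 36 * 2400\<^sup>2 * (2 + 1 / sqrt \<sigma>) * (4 + 2 / sqrt \<sigma>)"
  define C2 where "C2 = 64 * 2 * 57600 * 432000 * 3600 * (1 + 2 / sqrt \<sigma>)"
  have C12: "0 < C1" "0 < C2" unfolding C1_def C2_def using \<sigma>
    by (auto intro!: mult_pos_pos add_pos_pos divide_pos_pos)
  show ?case
  proof (rule exI[of _ "1 + C1 + C2"], rule conjI, use C12 in simp, intro allI impI, goal_cases)
    case H: (1 x0 y0 n x \<delta>)
    define W where "W = inverse ((real n)\<^sup>2) * \<delta> powr (1/2) * (max \<delta> (x0 powr \<alpha>)) powr (1/\<alpha> - 1/2)"
    have W0: "0 \<le> W" unfolding W_def by simp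
    have z: "0 \<le> x0" "x0 \<le> y0" "x0 powr \<alpha> + y0 powr \<alpha> = 1"
      using H frontier_lball_iff[OF a0, of x0 y0] by auto
    have n: "1 \<le> n" using H by simp
    have "0 < \<sigma> * inverse ((real n)\<^sup>2)" using \<sigma> n by simp
    then have \<delta>: "0 < \<delta>" "\<delta> \<le> 1" "\<sigma> * inverse ((real n)\<^sup>2) \<le> \<delta>" "\<delta> = norm (x - (x0, y0))"
      using H by linarith+
    have x: "\<bar>fst x\<bar> powr \<alpha> + \<bar>snd x\<bar> powr \<alpha> < 1"
    proof -
      have "(fst x, snd x) \<in> lball \<alpha>" "(fst x, snd x) \<notin> frontier (lball \<alpha>)" using H by auto
      then show ?thesis unfolding lball_iff frontier_lball_iff[OF a0] by linarith
    qed
    have "christoffel n (lball \<alpha>) x \<le> C1 * W"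
      unfolding C1_def W_def using \<delta>
      by (intro christoffel_lball_upper[OF assms z x _ \<delta>(1,2) \<sigma> \<delta>(3) n]) simp
    also have "\<dots> \<le> (1 + C1 + C2) * W" using C12 W0 by (intro mult_right_mono) auto
    finally have U: "christoffel n (lball \<alpha>) x \<le> (1 + C1 + C2) * W" .
    have "inverse (1 + C1 + C2) * W \<le> inverse C2 * W"
      using C12 W0 by (intro mult_right_mono le_imp_inverse_le) auto
    also have "\<dots> \<le> christoffel n (lball \<alpha>) (fst x, snd x)"
      unfolding C2_def W_def using \<delta>(4) H
      by (intro christoffel_lball_lower[OF assms z x _ \<delta>(1,2) _ \<sigma> \<delta>(3) n]) auto
    finally have Lo: "inverse (1 + C1 + C2) * W \<le> christoffel n (lball \<alpha>) x" by simp
    show ?case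
      using U Lo unfolding W_def by (simp only: mult.assoc)
  qed
qed

end
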